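(* Let $X_n=G_2$ and $r=2$ (hence $t_r=3$), and let $\lambda\in\overline P$. Assume that the positive integer $s$ lies in $3\mathbb Z+1$ or $3\mathbb Z+2$, and put $s_0=1$ or $2$, respectively. Then $$\lim\ q^{-c(\{m^{(a)}_{i,0}\})}M(W^{(2)\otimes L}_s,\lambda,q)=\sum_{\xi,\eta,\zeta,m}\frac{q^{\phi}\,M(W(\eta),\lambda,q^{-1})\,M_{\frac{s-s_0}3}(W(\xi),q^{-1})\,\Phi}{\Bigl(\prod_{1\le a\le2}(q)_{\eta_a}(q)_{\xi_a}\Bigr)(q)_\zeta},$$ $$W(\eta)=\bigotimes_{a=1}^2W^{(a)\otimes\eta_a}_1,\qquad W(\xi)=\bigotimes_{a=1}^2W^{(a)\otimes\xi_a}_1,$$ $$\phi=\frac12\Bigl|\sum_{a=1}^2(\eta_a-\xi_a)\overline\Lambda_a\Bigr|^2+\frac{m^2}2+\frac38\Bigl(\zeta-\frac{s_0\eta_2+(3-s_0)\xi_2}3\Bigr)^2,$$ $$\Phi=\left[{\frac12\bigl(\zeta+(2-s_0)\eta_2+(s_0-1)\xi_2\bigr)\atop m}\right]_q.$$ Here the limit $L\to\infty$ is taken over $L\in2\mathbb Z$. The sum runs over non-negative integers $\eta_a,\xi_a$ ($1\le a\le2$), $\zeta$ and $m$ such that both $$\zeta+(2-s_0)\eta_2+(s_0-1)\xi_2\in2\mathbb Z\quad\text{and}\quad m+\frac{(3-s_0)\xi_2+s_0\eta_2+\zeta}2\in2\mathbb Z.$$ For $s=s_0$ (i.e. $s=1,2$),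 $\xi=0$ is understood ($\xi_1=\xi_2=0$), with $M_0$ of the trivial (empty) $W$ equal to $1$.
   Context: Lie algebra notation. $X_n=G_2$, $n=2$, with $\alpha_1$ long and $\alpha_2$ short; $\overline\Lambda_a$ are the fundamental weights, $\overline P=\mathbb Z\overline\Lambda_1\oplus\mathbb Z\overline\Lambda_2$; $(\alpha_1|\alpha_1)=2$, $(\alpha_2|\alpha_2)=\frac23$, $(\alpha_1|\alpha_2)=-1$, $|x|^2=(x|x)$; $t_1=1$, $t_2=3$; $(\overline\Lambda_1|\overline\Lambda_1)=2$, $(\overline\Lambda_1|\overline\Lambda_2)=1$, $(\overline\Lambda_2|\overline\Lambda_2)=\frac23$. The point $m^{(a)}_{j,0}$ ($a=1,2$, $j\ge1$), depending on $L$: if $s\in3\mathbb Z+1$, $m^{(1)}_{j,0}=L(2\delta_{j,\frac{s-1}3}+\delta_{j,\frac{s+2}3})$, $m^{(2)}_{j,0}=L(\delta_{j,s-1}+\frac12\delta_{j,s}+\frac12\delta_{j,s+2})$; if $s\in3\mathbb Z+2$, $m^{(1)}_{j,0}=L(\delta_{j,\frac{s-2}3}+2\delta_{j,\frac{s+1}3})$, $m^{(2)}_{j,0}=L(\frac12\delta_{j,s-2}+\frac12\delta_{j,s}+\delta_{j,s+1})$. $q$-notation. $(q)_k=\prod_{i=1}^k(1-q^i)$. For $m\in\mathbb Z_{\ge0}$, $p\in\mathbb Z$, $\left[{p+m\atop m}\right]_q$ is the usual $q$-binomial coefficient $\frac{(q)_{p+m}}{(q)_p(q)_m}$ if $p\ge0$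 and $0$ if $p<0$. The limit is coefficientwise, as formal power series in $q$. Fermionic forms. The symbol $W=\bigotimes_{a=1}^n\bigotimes_{j\ge1}(W^{(a)}_j)^{\otimes\nu^{(a)}_j}$ records data $\nu^{(a)}_j\in\mathbb Z_{\ge0}$, finitely many non-zero. For $\lambda\in\overline P$, $$M(W,\lambda,q)=\sum_{\{m\}}q^{c(\{m\})}\prod_{1\le a\le n,\,i\ge1}\left[{p^{(a)}_i+m^{(a)}_i\atop m^{(a)}_i}\right]_q,$$ $$c(\{m\})=\tfrac12\sum_{a,b}(\alpha_a|\alpha_b)\sum_{j,k\ge1}\min(t_bj,t_ak)m^{(a)}_jm^{(b)}_k-\sum_a\sum_{j,k\ge1}\nu^{(a)}_j\min(j,k)m^{(a)}_k,$$ $$p^{(a)}_i=\sum_{j\ge1}\nu^{(a)}_j\min(i,j)-\sum_b(\alpha_a|\alpha_b)\sum_{k\ge1}\min(t_bi,t_ak)m^{(b)}_k,$$ summed over $m^{(a)}_i\in\mathbb Z_{\ge0}$ with all $p^{(a)}_i\ge0$ and $\sum_{a,i}i\,m^{(a)}_i\alpha_a=\sum_{a,i}i\,\nu^{(a)}_i\overline\Lambda_a-\lambda$. For $l\in\mathbb Z_{\ge1}$ let $H_l=\{(a,j)\mid1\le a\le n,\ 1\le j\le t_al\}$; for $W=\bigotimes_{(a,j)\in H_l}(W^{(a)}_j)^{\otimes\nu^{(a)}_j}$, $$M_l(W,q)=\sum_{\{m\}}q^{c_l(\{m\})}\prod_{(a,i)\in H_l}\left[{p^{(a)}_i+m^{(a)}_i\atop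 m^{(a)}_i}\right]_q,$$ where $c_l$ and $p^{(a)}_i$ are given by the same formulas as $c$ and $p^{(a)}_i$ above with all sums over $(a,j),(b,k)$ restricted to $H_l$, and the sum is over $\{m^{(a)}_i\in\mathbb Z_{\ge0}\mid(a,i)\in H_l\}$ with all $p^{(a)}_i\ge0$ and $\sum_{(a,i)\in H_l}i\,m^{(a)}_i\alpha_a=\sum_{(a,i)\in H_l}i\,\nu^{(a)}_i\overline\Lambda_a$. In the theorem, $c$ is the quadratic form attached to $W^{(2)\otimes L}_s$, i.e. to $\nu^{(a)}_j=L\delta_{a,2}\delta_{j,s}$. *)

theory Defs
  imports
    "HOL-Analysis.Product_Vector"
    "HOL-Computational_Algebra.Formal_Laurent_Series"
begin

section \<open>Root data of type G2\<close>

text \<open>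
  The dual of the Cartan subalgebra is \<^typ>\<open>real \<times> real\<close>, in coordinates with respect to the
  fundamental weights: the pair (x, y) stands for x times the first plus y times the second
  fundamental weight. The nodes of the Dynkin diagram are the numbers 1 (long) and 2 (short);
  the values at other arguments are irrelevant.
\<close>

definition fund_weight :: "nat \<Rightarrow> real \<times> real" where
  "fund_weight a = (if a = 1 then (1, 0) else (0, 1))"

text \<open>The coordinates of the simple roots are the columns of the Cartan matrix.\<close>

definition simple_root :: "nat \<Rightarrow> real \<times> real" where
  "simple_root a = (if a = 1 then (2, -3) else (-1, 2))"

definition weight_form :: "real \<times> real \<Rightarrow> real \<times> real \<Rightarrow> real" where
  "weight_form x y = 2 * fst x * fst y + fst x * snd y + snd x * fst y + 2/3 * snd x * snd y"

definition weight_lattice :: "(real \<times> real) set" where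
  "weight_lattice =
     {of_int x *\<^sub>R fund_weight 1 + of_int y *\<^sub>R fund_weight 2 | x y :: int. True}"

definition tnum :: "nat \<Rightarrow> nat" where
  "tnum a = (if a = 1 then 1 else 3)"

lemma weight_form_simple_root:
  "weight_form (simple_root 1) (simple_root 1) = 2"
  "weight_form (simple_root 2) (simple_root 2) = 2/3"
  "weight_form (simple_root 1) (simple_root 2) = -1"
  "weight_form (simple_root 2) (simple_root 1) = -1"
  by (simp_all add: weight_form_def simple_root_def)

lemma weight_form_fund_weight:
  "weight_form (fund_weight 1) (fund_weight 1) = 2"
  "weight_form (fund_weight 1) (fund_weight 2) = 1"
  "weight_form (fund_weight 2) (fund_weight 2) = 2/3"
  by (simp_all add: weight_form_def fund_weight_def)

lemma weight_form_simple_root_fund_weight: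
  assumes "a \<in> {1, 2}" "b \<in> {1, 2}"
  shows "weight_form (simple_root a) (fund_weight b) = (if a = b then 1 / real (tnum a) else 0)"
  using assms by (auto simp: weight_form_def simple_root_def fund_weight_def tnum_def)

section \<open>q-notation\<close>

text \<open>
  The base q is an element of an arbitrary field; below it is either the indeterminate of the
  field of formal Laurent series or its inverse, none of whose positive powers is 1, so that the
  denominators do not vanish.
\<close>

definition qpoch :: "'a::field \<Rightarrow> nat \<Rightarrow> 'a" where
  "qpoch q k = (\<Prod>i=1..k. (1 - q ^ i))"

text \<open>The q-binomial coefficient with upper entry N = p + m and lower entry m.\<close>

definition qbinom :: "'a::field \<Rightarrow> int \<Rightarrow> nat \<Rightarrow> 'a" where
  "qbinom q N m =
     (let p = N - int m
      in if p \<ge> 0 then qpoch q (nat N) / (qpoch q (nat p) * qpoch q m) else 0)"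

section \<open>Fermionic forms\<close>

text \<open>
  Both fermionic forms are instances of one sum, for which the pairs (a, j) range over an index
  set H. The families are functions of a and j. As all of them have finite support, each sum
  over j is written as a finite sum over the support inside H.
\<close>

definition supp_in :: "(nat \<times> nat) set \<Rightarrow> (nat \<Rightarrow> nat \<Rightarrow> 'b::zero) \<Rightarrow> nat \<Rightarrow> nat set" where
  "supp_in H f a = {j. (a, j) \<in> H \<and> f a j \<noteq> 0}"

definition cform ::
    "(nat \<times> nat) set \<Rightarrow> (nat \<Rightarrow> nat \<Rightarrow> nat) \<Rightarrow> (nat \<Rightarrow> nat \<Rightarrow> real) \<Rightarrow> real" where
  "cform H \<nu> m =
     1/2 * (\<Sum>a\<in>{1,2}. \<Sum>b\<in>{1,2}. weight_form (simple_root a) (simple_root b) *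
              (\<Sum>j\<in>supp_in H m a. \<Sum>k\<in>supp_in H m b.
                 real (min (tnum b * j) (tnum a * k)) * m a j * m b k))
     - (\<Sum>a\<in>{1,2}. \<Sum>j\<in>supp_in H \<nu> a. \<Sum>k\<in>supp_in H m a.
          real (\<nu> a j) * real (min j k) * m a k)"

definition vacancy ::
    "(nat \<times> nat) set \<Rightarrow> (nat \<Rightarrow> nat \<Rightarrow> nat) \<Rightarrow> (nat \<Rightarrow> nat \<Rightarrow> nat) \<Rightarrow> nat \<Rightarrow> nat \<Rightarrow> real" where
  "vacancy H \<nu> m a i =
     (\<Sum>j\<in>supp_in H \<nu> a. real (\<nu> a j) * real (min i j))
     - (\<Sum>b\<in>{1,2}. weight_form (simple_root a) (simple_root b) *
          (\<Sum>k\<in>supp_in H m b. real (min (tnum b * i) (tnum a * k)) * real (m b k)))"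

text \<open>
  The weight condition only makes sense for families of finite support, which is therefore
  required explicitly.
\<close>

definition configs ::
    "(nat \<times> nat) set \<Rightarrow> (nat \<Rightarrow> nat \<Rightarrow> nat) \<Rightarrow> real \<times> real \<Rightarrow> (nat \<Rightarrow> nat \<Rightarrow> nat) set" where
  "configs H \<nu> wt =
     {m. (\<forall>a i. (a, i) \<notin> H \<longrightarrow> m a i = 0) \<and> finite {(a, i). m a i \<noteq> 0} \<and>
         (\<forall>(a, i)\<in>H. vacancy H \<nu> m a i \<ge> 0) \<and>
         (\<Sum>a\<in>{1,2}. \<Sum>i\<in>supp_in H m a. (real i * real (m a i)) *\<^sub>R simple_root a)
           = (\<Sum>a\<in>{1,2}. \<Sum>i\<in>supp_in H \<nu> a. (real i * real (\<nu> a i)) *\<^sub>R fund_weight a) - wt}"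

text \<open>
  The values of \<^const>\<open>cform\<close> and \<^const>\<open>vacancy\<close> occurring here are integers (see below), so
  rounding down only changes their type. The factors of the product with m a i = 0 are
  equal to 1, as the vacancy numbers are non-negative. The set of configurations is finite
  (see below).
\<close>

definition fermionic ::
    "(nat \<times> nat) set \<Rightarrow> (nat \<Rightarrow> nat \<Rightarrow> nat) \<Rightarrow> real \<times> real \<Rightarrow> 'a::field \<Rightarrow> 'a" where
  "fermionic H \<nu> wt q =
     (\<Sum>m\<in>configs H \<nu> wt.
        q powi \<lfloor>cform H \<nu> (\<lambda>a i. real (m a i))\<rfloor> *
        (\<Prod>a\<in>{1,2}. \<Prod>i\<in>supp_in H m a.
           qbinom q (\<lfloor>vacancy H \<nu> m a i\<rfloor> + int (m a i)) (m a i)))"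

definition H_all :: "(nat \<times> nat) set" where
  "H_all = {(a, j). 1 \<le> a \<and> a \<le> 2 \<and> 1 \<le> j}"

definition H_level :: "nat \<Rightarrow> (nat \<times> nat) set" where
  "H_level l = {(a, j). 1 \<le> a \<and> a \<le> 2 \<and> 1 \<le> j \<and> j \<le> tnum a * l}"

definition M_ferm :: "(nat \<Rightarrow> nat \<Rightarrow> nat) \<Rightarrow> real \<times> real \<Rightarrow> 'a::field \<Rightarrow> 'a" where
  "M_ferm \<nu> wt q = fermionic H_all \<nu> wt q"

text \<open>
  For l = 0 the index set is empty, and the value is 1 (see below).
\<close>

definition M_level :: "nat \<Rightarrow> (nat \<Rightarrow> nat \<Rightarrow> nat) \<Rightarrow> 'a::field \<Rightarrow> 'a" where
  "M_level l \<nu> q = fermionic (H_level l) \<nu> 0 q"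

section \<open>Data of the theorem\<close>

definition W_short :: "nat \<Rightarrow> nat \<Rightarrow> nat \<Rightarrow> nat \<Rightarrow> nat" where
  "W_short s L a j = (if a = 2 \<and> j = s then L else 0)"

definition W_one :: "nat \<Rightarrow> nat \<Rightarrow> nat \<Rightarrow> nat \<Rightarrow> nat" where
  "W_one x1 x2 a j = (if j = 1 then if a = 1 then x1 else if a = 2 then x2 else 0 else 0)"

text \<open>
  A Kronecker delta is an \<^const>\<open>of_bool\<close>. Entries at j = 0, which occur for s = 1 and s = 2,
  do not count, since the index set \<^const>\<open>H_all\<close> only contains positive j.
\<close>

definition m_min :: "nat \<Rightarrow> nat \<Rightarrow> nat \<Rightarrow> nat \<Rightarrow> real" where
  "m_min s L a j =
     (if s mod 3 = 1 then
        (if a = 1 then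
           real L * (2 * of_bool (j = (s - 1) div 3) + of_bool (j = (s + 2) div 3))
         else if a = 2 then
           real L * (of_bool (j = s - 1) + 1/2 * of_bool (j = s) + 1/2 * of_bool (j = s + 2))
         else 0)
      else if s mod 3 = 2 then
        (if a = 1 then
           real L * (of_bool (j = (s - 2) div 3) + 2 * of_bool (j = (s + 1) div 3))
         else if a = 2 then
           real L * (1/2 * of_bool (j = s - 2) + 1/2 * of_bool (j = s) + of_bool (j = s + 1))
         else 0)
      else 0)"

text \<open>Summation indices are tuples (eta1, eta2, xi1, xi2, zeta, m).\<close>

type_synonym sum_index = "nat \<times> nat \<times> nat \<times> nat \<times> nat \<times> nat"

definition sum_indices :: "nat \<Rightarrow> nat \<Rightarrow> sum_index set" where
  "sum_indices s s0 =
     {(\<eta>1, \<eta>2, \<xi>1, \<xi>2, \<zeta>, m).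
        even (\<zeta> + (2 - s0) * \<eta>2 + (s0 - 1) * \<xi>2) \<and>
        even ((3 - s0) * \<xi>2 + s0 * \<eta>2 + \<zeta>) \<and>
        even (m + ((3 - s0) * \<xi>2 + s0 * \<eta>2 + \<zeta>) div 2) \<and>
        (s = s0 \<longrightarrow> \<xi>1 = 0 \<and> \<xi>2 = 0)}"

definition phi :: "nat \<Rightarrow> sum_index \<Rightarrow> real" where
  "phi s0 = (\<lambda>(\<eta>1, \<eta>2, \<xi>1, \<xi>2, \<zeta>, m).
     (let v = (real \<eta>1 - real \<xi>1) *\<^sub>R fund_weight 1 + (real \<eta>2 - real \<xi>2) *\<^sub>R fund_weight 2
      in 1/2 * weight_form v v)
     + (real m)\<^sup>2 / 2
     + 3/8 * (real \<zeta> - (real s0 * real \<eta>2 + (3 - real s0) * real \<xi>2) / 3)\<^sup>2)"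

definition Phi :: "nat \<Rightarrow> sum_index \<Rightarrow> 'a::field \<Rightarrow> 'a" where
  "Phi s0 = (\<lambda>(\<eta>1, \<eta>2, \<xi>1, \<xi>2, \<zeta>, m) q.
     qbinom q (int ((\<zeta> + (2 - s0) * \<eta>2 + (s0 - 1) * \<xi>2) div 2)) m)"

text \<open>
  On \<^const>\<open>sum_indices\<close> the values of \<^const>\<open>phi\<close> are integers (see below).
\<close>

definition summand :: "nat \<Rightarrow> nat \<Rightarrow> real \<times> real \<Rightarrow> sum_index \<Rightarrow> 'a::field \<Rightarrow> 'a" where
  "summand s s0 wt = (\<lambda>(\<eta>1, \<eta>2, \<xi>1, \<xi>2, \<zeta>, m) q.
     q powi \<lfloor>phi s0 (\<eta>1, \<eta>2, \<xi>1, \<xi>2, \<zeta>, m)\<rfloor>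
       * M_ferm (W_one \<eta>1 \<eta>2) wt (inverse q)
       * M_level ((s - s0) div 3) (W_one \<xi>1 \<xi>2) (inverse q)
       * Phi s0 (\<eta>1, \<eta>2, \<xi>1, \<xi>2, \<zeta>, m) q
     / (qpoch q \<eta>1 * qpoch q \<xi>1 * (qpoch q \<eta>2 * qpoch q \<xi>2) * qpoch q \<zeta>))"

section \<open>Coefficientwise limits and sums\<close>

text \<open>
  Coefficients are regarded as discrete: in a limit every coefficient is eventually constant, and
  in a sum every coefficient receives only finitely many non-zero contributions.
\<close>

definition coeffwise_limit :: "(nat \<Rightarrow> 'a::zero fls) \<Rightarrow> 'a fls \<Rightarrow> bool" where
  "coeffwise_limit f F \<longleftrightarrow> (\<forall>n. \<forall>\<^sub>F k in sequentially. fls_nth (f k) n = fls_nth F n)"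

definition coeffwise_sum :: "('i \<Rightarrow> 'a::comm_monoid_add fls) \<Rightarrow> 'i set \<Rightarrow> 'a fls \<Rightarrow> bool" where
  "coeffwise_sum f I F \<longleftrightarrow>
     (\<forall>n. finite {x \<in> I. fls_nth (f x) n \<noteq> 0} \<and>
          (\<Sum>x | x \<in> I \<and> fls_nth (f x) n \<noteq> 0. fls_nth (f x) n) = fls_nth F n)"

section \<open>Consistency of the definitions\<close>

lemma cform_in_Ints: "cform H \<nu> (\<lambda>a i. real (m a i)) \<in> \<int>"
proof -
  define S where "S = supp_in H (\<lambda>a i. real (m a i))"
  define T where "T = (\<lambda>a b. \<Sum>j\<in>S a. \<Sum>k\<in>S b.
    real (min (tnum b * j) (tnum a * k)) * real (m a j) * real (m b k))"
  have sym: "T 2 1 = T 1 2"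
    unfolding T_def by (subst sum.swap) (intro sum.cong refl, simp add: min.commute mult_ac)
  have int12: "T 1 2 \<in> \<int>" and int11: "T 1 1 \<in> \<int>"
    unfolding T_def by (intro Ints_sum Ints_mult Ints_of_nat)+
  have "T 2 2 / 3 = (\<Sum>j\<in>S 2. \<Sum>k\<in>S 2. real (min j k) * real (m 2 j) * real (m 2 k))"
    unfolding T_def sum_divide_distrib
    by (intro sum.cong refl) (simp add: tnum_def min_def)
  also have "\<dots> \<in> \<int>" by (intro Ints_sum Ints_mult Ints_of_nat)
  finally have int22: "T 2 2 / 3 \<in> \<int>" .
  define U where "U = (\<Sum>a\<in>{1,2}. \<Sum>j\<in>supp_in H \<nu> a. \<Sum>k\<in>S a.
          real (\<nu> a j) * real (min j k) * real (m a k))"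
  have "U \<in> \<int>" unfolding U_def by (intro Ints_sum Ints_mult Ints_of_nat)
  have "cform H \<nu> (\<lambda>a i. real (m a i)) = 
      1/2 * (\<Sum>a\<in>{1,2}. \<Sum>b\<in>{1,2}. weight_form (simple_root a) (simple_root b) * T a b) - U"
    unfolding cform_def T_def U_def S_def ..
  also have "\<dots> = T 1 1 - T 1 2 + T 2 2 / 3 - U"
    using weight_form_simple_root sym by simp
  also have "\<dots> \<in> \<int>"
    using int11 int12 int22 \<open>U \<in> \<int>\<close> by (intro Ints_diff Ints_add)
  finally show ?thesis .
qed

lemma cform_m_min_in_Ints: "cform H \<nu> (m_min s (2 * k)) \<in> \<int>"
proof -
  define n :: "nat \<Rightarrow> nat \<Rightarrow> nat" where "n a j =
     (if s mod 3 = 1 then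
        (if a = 1 then k * (4 * of_bool (j = (s - 1) div 3) + 2 * of_bool (j = (s + 2) div 3))
         else if a = 2 then
           k * (2 * of_bool (j = s - 1) + of_bool (j = s) + of_bool (j = s + 2))
         else 0)
      else if s mod 3 = 2 then
        (if a = 1 then k * (2 * of_bool (j = (s - 2) div 3) + 4 * of_bool (j = (s + 1) div 3))
         else if a = 2 then
           k * (of_bool (j = s - 2) + of_bool (j = s) + 2 * of_bool (j = s + 1))
         else 0)
      else 0)" for a j
  have "m_min s (2 * k) = (\<lambda>a j. real (n a j))"
    unfolding m_min_def n_def fun_eq_iff if_distrib[of real]
    by (intro allI if_cong refl) (simp_all add: distrib_left)
  thus ?thesis using cform_in_Ints by metis
qed

lemma vacancy_in_Ints:
  assumes "a \<in> {1, 2}"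
  shows "vacancy H \<nu> m a i \<in> \<int>"
proof -
  have *: "weight_form (simple_root a) (simple_root b) * 
      (\<Sum>k\<in>A. real (min (tnum b * i) (tnum a * k)) * real (m b k)) \<in> \<int>"
    if "b \<in> {1, 2}" for b A
  proof -
    have **: "weight_form (simple_root a) (simple_root b) * real (min (tnum b * i) (tnum a * k)) \<in> \<int>"
      for k
    proof (cases "a = 2 \<and> b = 2")
      case True
      have "2/3 * real (min (3 * i) (3 * k)) = real (2 * min i k)" by (simp add: min_def)
      then have "weight_form (simple_root a) (simple_root b) * real (min (tnum b * i) (tnum a * k))
          = real (2 * min i k)"
        using True weight_form_simple_root(2) by (simp only: tnum_def) simp
      then show ?thesis by (metis Ints_of_nat)
    next
      case False
      then have "weight_form (simple_root a) (simple_root b) \<in> \<int>"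
        using that assms weight_form_simple_root by auto
      then show ?thesis by (intro Ints_mult Ints_of_nat)
    qed
    show ?thesis
      unfolding sum_distrib_left mult.assoc[symmetric]
      by (intro Ints_sum Ints_mult[OF ** Ints_of_nat])
  qed
  show ?thesis
    unfolding vacancy_def by (intro Ints_diff Ints_sum * Ints_mult Ints_of_nat)
qed

lemma phi_in_Ints:
  assumes "x \<in> sum_indices s s0" "s0 \<in> {1, 2}"
  shows "phi s0 x \<in> \<int>"
proof -
  obtain \<eta>1 \<eta>2 \<xi>1 \<xi>2 \<zeta> m where x: "x = (\<eta>1, \<eta>2, \<xi>1, \<xi>2, \<zeta>, m)" by (metis prod_cases6)
  define A where "A = (3 - s0) * \<xi>2 + s0 * \<eta>2"
  have ev: "even (A + \<zeta>)" "even (m + (A + \<zeta>) div 2)"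
    using assms(1) by (simp_all add: x sum_indices_def A_def)
  obtain h where h: "A + \<zeta> = 2 * h" using ev(1) by (rule evenE)
  have "even (m + h)" using ev(2) h by simp
  then obtain k where k: "m + h = 2 * k" by (rule evenE)
  define d where "d = int \<eta>2 - int \<xi>2"
  define u where "u = int \<eta>1 - int \<xi>1"
  have rA: "real A = real s0 * real \<eta>2 + (3 - real s0) * real \<xi>2"
    using assms(2) by (auto simp: A_def)
  obtain e where e: "int A = int s0 * d + 3 * e"
    using assms(2) unfolding A_def d_def
    by (elim insertE) (auto intro: that[of "int \<xi>2"] simp: algebra_simps)
  define f where "f = (if s0 = 1 then d^2 + 2*d*e else 2*d^2 + 4*d*e) + 3 * e^2"
  have f: "(int A)^2 + 2 * d^2 = 3 * f"
    using assms(2) e by (auto simp: f_def power2_eq_square algebra_simps)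
  have z: "int \<zeta> = 2 * int h - int A" and m: "int m = 2 * int k - int h"
    using h k by linarith+
  have "even (3 * f + 3 * (int \<zeta>)^2)"
    unfolding f[symmetric] z by simp
  then have "even (f + (int \<zeta>)^2)" by (simp add: algebra_simps)
  then obtain g where g: "f + (int \<zeta>)^2 = 2 * g" by (rule evenE)
  have "phi s0 x = real_of_int (u^2 + u * d) + (of_int d)^2 / 3 + (of_int (int m))^2 / 2
      + 3/8 * (of_int (int \<zeta>) - of_int (int A) / 3)^2"
    unfolding phi_def x Let_def u_def d_def prod.case rA[symmetric]
    by (simp add: weight_form_def fund_weight_def power2_eq_square algebra_simps)
  also have "\<dots> = of_int (u^2 + u * d + 2 * (int k)^2 - 2 * int k * int h + g)"
  proof -
    have g': "3 * (of_int (int \<zeta>))^2 + (real_of_int (int A))^2 + 2 * (of_int d)^2 = 6 * real_of_int g"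
      using arg_cong[OF f, of real_of_int] arg_cong[OF g, of real_of_int] by simp
    have h': "real A = 2 * real h - real \<zeta>" and m': "real m = 2 * real k - real h"
      using h k by linarith+
    have "48 * ((of_int d)^2 / 3 + (real m)^2 / 2 + 3/8 * (real \<zeta> - real A / 3)^2)
        = 48 * (2 * (real k)^2 - 2 * real k * real h) + 8 * (3 * (real \<zeta>)^2 + (real A)^2 + 2 * (of_int d)^2)"
      unfolding m' h' by (simp add: power2_eq_square field_simps)
    then show ?thesis using g' by simp
  qed
  finally show ?thesis by (metis Ints_of_int)
qed

lemma finite_configs:
  assumes H: "H \<subseteq> H_all"
  shows "finite (configs H \<nu> wt)"
proof -
  define v where "v = (\<Sum>a\<in>{1,2}. \<Sum>i\<in>supp_in H \<nu> a. (real i * real (\<nu> a i)) *\<^sub>R fund_weight a) - wt"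
  define B where "B = nat \<lceil>max (2 * fst v + snd v) (3 * fst v + 2 * snd v)\<rceil>"
  define D where "D = {1, 2::nat} \<times> {..B}"
  define Fs where "Fs = {f. \<forall>x. (x \<in> D \<longrightarrow> f x \<in> {..B}) \<and> (x \<notin> D \<longrightarrow> f x = (0::nat))}"
  have "finite Fs"
    unfolding Fs_def by (rule finite_set_of_finite_funs) (auto simp: D_def)
  moreover have "configs H \<nu> wt \<subseteq> curry ` Fs"
  proof
    fix m assume m: "m \<in> configs H \<nu> wt"
    define S where "S a = (\<Sum>i\<in>supp_in H m a. real i * real (m a i))" for a
    have fin: "finite (supp_in H m a)" for a
    proof -
      have "finite {(a, i). m a i \<noteq> 0}" using m by (simp add: configs_def)
      then have "finite (snd ` {(a, i). m a i \<noteq> 0})" by (rule finite_imageI)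
      then show ?thesis by (rule rev_finite_subset) (force simp: supp_in_def)
    qed
    have "(\<Sum>a\<in>{1,2}. S a *\<^sub>R simple_root a) = v"
      using m unfolding configs_def v_def S_def scaleR_sum_left by simp
    then have "v = S 1 *\<^sub>R simple_root 1 + S 2 *\<^sub>R simple_root 2" by simp
    then have "fst v = 2 * S 1 - S 2" "snd v = 2 * S 2 - 3 * S 1"
      by (simp_all add: simple_root_def)
    then have S12: "S 1 = 2 * fst v + snd v" "S 2 = 3 * fst v + 2 * snd v" by simp_all
    have S: "S a \<le> real B" if "a \<in> {1, 2}" for a
    proof -
      have "S a \<le> max (2 * fst v + snd v) (3 * fst v + 2 * snd v)"
        using that S12 by (elim insertE) auto
      also have "\<dots> \<le> real B" unfolding B_def by (rule real_nat_ceiling_ge)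
      finally show ?thesis .
    qed
    have key: "a \<in> {1, 2} \<and> i \<le> B \<and> m a i \<le> B" if nz: "m a i \<noteq> 0" for a i
    proof -
      have "\<forall>a i. (a, i) \<notin> H \<longrightarrow> m a i = 0" using m unfolding configs_def by blast
      then have inH: "(a, i) \<in> H" using nz by (cases "(a, i) \<in> H") simp_all
      then have a: "a \<in> {1, 2}" and i: "i \<ge> 1" using H by (auto simp: H_all_def)
      have "real i * real (m a i) \<le> S a"
        unfolding S_def using inH nz fin by (intro member_le_sum) (auto simp: supp_in_def)
      also have "\<dots> \<le> real B" using a by (rule S)
      finally have "i * m a i \<le> B" by (metis of_nat_le_iff of_nat_mult)
      moreover have "i \<le> i * m a i" "m a i \<le> i * m a i" using i nz by auto
      ultimately show ?thesis using a by linarith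
    qed
    have "case_prod m \<in> Fs"
      unfolding Fs_def D_def using key by force
    then show "m \<in> curry ` Fs" by (metis curry_case_prod image_eqI)
  qed
  ultimately show ?thesis by (meson finite_imageI finite_subset)
qed

lemma M_level_0: "M_level 0 (W_one 0 0) q = 1"
proof -
  have H: "H_level 0 = {}" by (auto simp: H_level_def)
  have "configs {} (W_one 0 0) 0 = {\<lambda>_ _. 0}"
    by (auto simp: configs_def supp_in_def)
  then show ?thesis
    by (simp add: M_level_def fermionic_def H supp_in_def cform_def)
qed

end

theory Submission
  imports Defs "HOL-Library.Groups_Big_Fun"
begin

text \<open>
  Write a configuration m through its tails X k = sum over i > k of m 1 i and Y k = sum over i > k
  of m 2 i. Then the quadratic form, the vacancy numbers and the weight condition all become sums
  over blocks that consist of one X k and of Y (3 k), Y (3 k + 1), Y (3 k + 2), and the energy of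
  a block is a quarter of a sum of four squares, hence positive definite.

  The point m_min has vanishing vacancy numbers, so it is stationary: for m = m_min + n the
  exponent is that of m_min plus the quadratic form of n, and the vacancy numbers depend on n
  only. As L grows, the entries at the bulk positions (those where m_min does not vanish) become
  unconstrained and their q-binomials tend to 1 / (q)_p. Since only finitely many n have bounded
  energy, the limit is the sum over all deviations n.

  With s = 3 l + s0, cut the tails of n at block l. The blocks to its right form a configuration of
  W(eta), those to its left, reversed and negated, form a configuration of W(xi) at level l, and
  eta, xi, zeta are the vacancy numbers at the bulk positions, while m is the entry at the one
  position between them. The energy of block l itself is phi. Finally, c + sum p m is minus the
  energy, so inverting q in M turns its powers of q into the energies of the two outer parts.
\<close>

section \<open>Tails of configurations\<close>

text \<open>The vacancy numbers are partial sums over blocks that start from 0, and their eventual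
  values are the coordinates of the weight. This is what makes the cut work. To the right of it, the
  vacancy numbers at the cut act as the constant offsets eta of a product of factors with j = 1, and
  the weight stays lambda. To the left, read backwards from the cut, the vacancy numbers run from xi
  to the 0 at the origin, and this final 0 is the weight condition of M_l, whose weight is 0.
  Reversal changes the sign of differences, which the negation undoes; a quadratic energy does not
  notice it. For l = 0 nothing lies to the left, which is why xi = 0 there.

  Inside block l the tail of node 1 is constant, so the second differences of the vacancy numbers of
  node 2 are twice the entries. At the one position of the block between bulk positions, p + m is
  therefore the mean of the two neighbouring vacancy numbers, and this mean is the upper entry of
  Phi. The parity conditions express that the tails in block l are integers.

  L has to be even because entries L/2 occur in m_min.\<close>

definition step :: "(nat \<Rightarrow> 'a::comm_ring_1) \<Rightarrow> nat \<Rightarrow> 'a" where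
  "step X i = (if i = 0 then 0 else X (i - 1) - X i)"

text \<open>
  The vacancy numbers of the configuration with tails X and Y, without the contribution of W.
\<close>

definition vac1 :: "(nat \<Rightarrow> 'a::comm_ring_1) \<Rightarrow> (nat \<Rightarrow> 'a) \<Rightarrow> nat \<Rightarrow> 'a" where
  "vac1 X Y i = (\<Sum>k<i. Y (3*k) + Y (3*k+1) + Y (3*k+2) - 2 * X k)"

definition vac2 :: "(nat \<Rightarrow> 'a::comm_ring_1) \<Rightarrow> (nat \<Rightarrow> 'a) \<Rightarrow> nat \<Rightarrow> 'a" where
  "vac2 X Y j = (\<Sum>k<j. X (k div 3) - 2 * Y k)"

text \<open>This is half the quadratic form of the Cartan matrix of type D4, with \<open>X k\<close>
  at the central node and the three values of Y at the outer ones; G2 is the folding of D4.\<close>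

definition block_energy :: "(nat \<Rightarrow> 'a::comm_ring_1) \<Rightarrow> (nat \<Rightarrow> 'a) \<Rightarrow> nat \<Rightarrow> 'a" where
  "block_energy X Y k = (X k)\<^sup>2 - X k * (Y (3*k) + Y (3*k+1) + Y (3*k+2))
     + (Y (3*k))\<^sup>2 + (Y (3*k+1))\<^sup>2 + (Y (3*k+2))\<^sup>2"

lemma step_0 [simp]: "step X 0 = 0"
  by (simp add: step_def)

lemma step_Suc [simp]: "step X (Suc k) = X k - X (Suc k)"
  by (simp add: step_def)

lemma step_beyond:
  assumes "\<And>k. k \<ge> N \<Longrightarrow> X k = 0" "j > N"
  shows "step X j = 0"
  using assms by (cases j) auto

section \<open>Summation by parts: from multiplicities of parts to tails\<close>

lemma sum_lessThan_mult3:
  fixes f :: "nat \<Rightarrow> 'a::comm_ring_1"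
  shows "(\<Sum>k<3*n. f k) = (\<Sum>k<n. f (3*k) + f (3*k+1) + f (3*k+2))"
  by (induction n) (simp_all add: algebra_simps numeral_3_eq_3)

lemma sum_lessThan_add:
  fixes f :: "nat \<Rightarrow> 'a::comm_monoid_add"
  shows "(\<Sum>k<n + m. f k) = (\<Sum>k<n. f k) + (\<Sum>k<m. f (n + k))"
  by (induction m) (simp_all add: add.assoc)

text \<open>Summation by parts. Going from n to n + 1 adds u indices i, on all of which i div u is
  n; the boundary term disappears as soon as X vanishes at n.\<close>

lemma sum_step_partial:
  fixes X G :: "nat \<Rightarrow> 'a::comm_ring_1"
  assumes "u > 0"
  shows "(\<Sum>j\<le>n. step X j * (\<Sum>i<u*j. G i)) =
    (\<Sum>i<u*n. X (i div u) * G i) - X n * (\<Sum>i<u*n. G i)"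
proof (induction n)
  case (Suc n)
  have "(\<Sum>i<u * n + u. X (i div u) * G i) =
      (\<Sum>i<u*n. X (i div u) * G i) + (\<Sum>k<u. X n * G (u * n + k))"
    unfolding sum_lessThan_add using assms by simp
  moreover have "(\<Sum>i<u * n + u. G i) = (\<Sum>i<u*n. G i) + (\<Sum>k<u. G (u * n + k))"
    unfolding sum_lessThan_add ..
  moreover have "u * Suc n = u * n + u" by simp
  ultimately show ?case
    using Suc by (simp add: algebra_simps sum_distrib_left[symmetric] del: mult_Suc_right)
qed simp

lemma sum_step:
  fixes X G :: "nat \<Rightarrow> 'a::comm_ring_1"
  assumes "u > 0" "\<And>k. k \<ge> N \<Longrightarrow> X k = 0" "finite S" "{j. step X j \<noteq> 0} \<subseteq> S"
  shows "(\<Sum>j\<in>S. step X j * (\<Sum>i<u*j. G i)) = (\<Sum>i<u*N. X (i div u) * G i)"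
proof -
  have "(\<Sum>j\<in>S. step X j * (\<Sum>i<u*j. G i)) = (\<Sum>j\<in>{j. step X j \<noteq> 0}. step X j * (\<Sum>i<u*j. G i))"
    using assms by (intro sum.mono_neutral_right) auto
  also have "\<dots> = (\<Sum>j\<le>N. step X j * (\<Sum>i<u*j. G i))"
  proof (intro sum.mono_neutral_left)
    show "{j. step X j \<noteq> 0} \<subseteq> {..N}"
      using step_beyond[of N X] assms(2) by (auto simp: not_le[symmetric])
  qed auto
  finally show ?thesis
    using sum_step_partial[OF assms(1), of X G N] assms(2)[of N] by simp
qed

text \<open>Writes \<open>min\<close> as a partial sum of an indicator, the shape to which
  \<open>sum_step\<close> applies.\<close>

lemma min_eq_sum: "of_nat (min A B) = (\<Sum>i<B. of_bool (i < A) :: 'a::comm_ring_1)"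
proof -
  have "(\<Sum>i<B. of_bool (i < A) :: 'a) = of_nat (card ({..<B} \<inter> {i. i < A}))"
    by (simp add: sum.inter_restrict[symmetric] of_bool_def sum.If_cases)
  also have "{..<B} \<inter> {i. i < A} = {..<min A B}" by auto
  finally show ?thesis by simp
qed

lemma sum_min_step:
  fixes X :: "nat \<Rightarrow> 'a::comm_ring_1"
  assumes "u > 0" "\<And>k. k \<ge> N \<Longrightarrow> X k = 0" "finite S" "{j. step X j \<noteq> 0} \<subseteq> S"
  shows "(\<Sum>j\<in>S. of_nat (min A (u*j)) * step X j) = (\<Sum>i<A. X (i div u))"
proof -
  have "(\<Sum>j\<in>S. of_nat (min A (u*j)) * step X j) = (\<Sum>i<u*N. X (i div u) * of_bool (i < A))"
    unfolding min_eq_sum using sum_step[OF assms, where G = "\<lambda>i. of_bool (i < A)"]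
    by (simp add: mult.commute)
  also have "\<dots> = (\<Sum>i\<in>{..<u*N} \<inter> {..<A}. X (i div u))"
    by (simp add: sum.inter_restrict of_bool_def if_distrib cong: if_cong)
  also have "\<dots> = (\<Sum>i<A. X (i div u))"
  proof (intro sum.mono_neutral_left ballI)
    fix i assume "i \<in> {..<A} - {..<u*N} \<inter> {..<A}"
    then have "u * N \<le> i" by auto
    then have "N \<le> i div u" using assms(1) by (simp add: less_eq_div_iff_mult_less_eq mult.commute)
    then show "X (i div u) = 0" by (rule assms(2))
  qed auto
  finally show ?thesis .
qed

text \<open>\<open>min (u*j) (v*k)\<close> counts the i below both bounds, and i < u*j means i div u
  < j. Summing the multiplicities of all such j and k leaves the tails at i div u and i div
  v.\<close>

lemma sum_min_step_step:
  fixes X Y :: "nat \<Rightarrow> 'a::comm_ring_1"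
  assumes "u > 0" "v > 0" "\<And>k. k \<ge> N \<Longrightarrow> X k = 0" "\<And>k. k \<ge> M \<Longrightarrow> Y k = 0"
    "finite S" "{j. step X j \<noteq> 0} \<subseteq> S" "finite T" "{j. step Y j \<noteq> 0} \<subseteq> T"
  shows "(\<Sum>j\<in>S. \<Sum>k\<in>T. of_nat (min (u*j) (v*k)) * step X j * step Y k)
     = (\<Sum>i<u*N. X (i div u) * Y (i div v))"
proof -
  have "(\<Sum>j\<in>S. \<Sum>k\<in>T. of_nat (min (u*j) (v*k)) * step X j * step Y k)
      = (\<Sum>j\<in>S. step X j * (\<Sum>k\<in>T. of_nat (min (u*j) (v*k)) * step Y k))"
    by (simp add: sum_distrib_left mult_ac)
  also have "\<dots> = (\<Sum>j\<in>S. step X j * (\<Sum>i<u*j. Y (i div v)))"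
    using sum_min_step[OF assms(2,4,7,8)] by simp
  also have "\<dots> = (\<Sum>i<u*N. X (i div u) * Y (i div v))"
    by (rule sum_step[OF assms(1,3,5,6)])
  finally show ?thesis .
qed

text \<open>The hypothesis ignores the values of m outside H. This matters for \<open>m_min\<close>,
  which can have entries at j = 0 when s is 1 or 2.\<close>

lemma supp_in_eq:
  assumes "\<And>j. (if (a, j) \<in> H then m a j else 0) = step X j"
  shows "supp_in H m a = {j. step X j \<noteq> 0}" "j \<in> supp_in H m a \<Longrightarrow> m a j = step X j"
proof -
  have *: "(a, j) \<in> H \<Longrightarrow> m a j = step X j" "(a, j) \<notin> H \<Longrightarrow> step X j = 0" for j
    using assms[of j] by simp_all
  show "supp_in H m a = {j. step X j \<noteq> 0}"
  proof (intro set_eqI)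
    fix j show "j \<in> supp_in H m a \<longleftrightarrow> j \<in> {j. step X j \<noteq> 0}"
      using *[of j] by (cases "(a, j) \<in> H") (simp_all add: supp_in_def)
  qed
  show "j \<in> supp_in H m a \<Longrightarrow> m a j = step X j"
    using *(1)[of j] by (simp add: supp_in_def)
qed

lemma finite_step_support:
  assumes "\<And>k. k \<ge> N \<Longrightarrow> X k = 0"
  shows "finite {j. step X j \<noteq> 0}"
  by (rule finite_subset[of _ "{..N}"]) (use step_beyond[of N X] assms in \<open>auto simp: not_le[symmetric]\<close>)

lemma div_3: "(3 * k) div 3 = k" "Suc (3 * k) div 3 = k" "Suc (Suc (3 * k)) div 3 = k" for k :: nat
  by simp_all

lemma sum_block_energy:
  fixes X Y :: "nat \<Rightarrow> 'a::comm_ring_1"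
  shows "(\<Sum>k<N. block_energy X Y k) = (\<Sum>k<N. X k * X k) - (\<Sum>k<3*N. X (k div 3) * Y k) + (\<Sum>k<3*N. Y k * Y k)"
  unfolding sum_lessThan_mult3
  by (simp add: block_energy_def sum.distrib sum_subtractf power2_eq_square distrib_left div_3)

lemma vac1_eq:
  fixes X Y :: "nat \<Rightarrow> 'a::comm_ring_1"
  shows "vac1 X Y i = (\<Sum>k<3*i. Y k) - 2 * (\<Sum>k<i. X k)"
  unfolding sum_lessThan_mult3 vac1_def by (simp add: sum_subtractf sum_distrib_left)

lemma vac2_eq:
  fixes X Y :: "nat \<Rightarrow> 'a::comm_ring_1"
  shows "vac2 X Y i = (\<Sum>k<i. X (k div 3)) - 2 * (\<Sum>k<i. Y k)"
  unfolding vac2_def by (simp add: sum_subtractf sum_distrib_left)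

section \<open>Quadratic form, vacancy numbers and weight in terms of tails\<close>

lemma cform_tails:
  fixes X Y :: "nat \<Rightarrow> real"
  assumes X: "\<And>k. k \<ge> N \<Longrightarrow> X k = 0" and Y: "\<And>k. k \<ge> 3*N \<Longrightarrow> Y k = 0"
    and m1: "\<And>j. (if (1, j) \<in> H then m 1 j else 0) = step X j"
    and m2: "\<And>j. (if (2, j) \<in> H then m 2 j else 0) = step Y j"
  shows "cform H \<nu> m = (\<Sum>k<N. block_energy X Y k)
     - (\<Sum>j\<in>supp_in H \<nu> 1. real (\<nu> 1 j) * (\<Sum>i<j. X i))
     - (\<Sum>j\<in>supp_in H \<nu> 2. real (\<nu> 2 j) * (\<Sum>i<j. Y i))"
proof -
  note s1 = supp_in_eq[where m = m, OF m1] and s2 = supp_in_eq[where m = m, OF m2]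
  note f1 = finite_step_support[of N X, OF X] and f2 = finite_step_support[of "3*N" Y, OF Y]
  have T11: "(\<Sum>j\<in>supp_in H m 1. \<Sum>k\<in>supp_in H m 1.
      real (min (tnum 1 * j) (tnum 1 * k)) * m 1 j * m 1 k) = (\<Sum>k<N. X k * X k)"
    using sum_min_step_step[of 1 1 N X N X "{j. step X j \<noteq> 0}" "{j. step X j \<noteq> 0}"] X f1 s1
    by (simp add: tnum_def)
  have T12: "(\<Sum>j\<in>supp_in H m 1. \<Sum>k\<in>supp_in H m 2.
      real (min (tnum 2 * j) (tnum 1 * k)) * m 1 j * m 2 k) = (\<Sum>k<3*N. X (k div 3) * Y k)"
    using sum_min_step_step[of 3 1 N X "3*N" Y "{j. step X j \<noteq> 0}" "{j. step Y j \<noteq> 0}"] X Y f1 f2 s1 s2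
    by (simp add: tnum_def)
  have T21: "(\<Sum>j\<in>supp_in H m 2. \<Sum>k\<in>supp_in H m 1.
      real (min (tnum 1 * j) (tnum 2 * k)) * m 2 j * m 1 k) = (\<Sum>k<3*N. X (k div 3) * Y k)"
    using sum_min_step_step[of 1 3 "3*N" Y N X "{j. step Y j \<noteq> 0}" "{j. step X j \<noteq> 0}"] X Y f1 f2 s1 s2
    by (simp add: tnum_def mult.commute[of "X _"])
  \<comment> \<open>Both arguments of \<open>min\<close> carry t_2 = 3, which cancels the
    denominator of 2/3, the squared length of the short root.\<close>
  have "(\<Sum>j\<in>supp_in H m 2. \<Sum>k\<in>supp_in H m 2.
      real (min (tnum 2 * j) (tnum 2 * k)) * m 2 j * m 2 k)
     = 3 * (\<Sum>j\<in>supp_in H m 2. \<Sum>k\<in>supp_in H m 2. real (min (1 * j) (1 * k)) * m 2 j * m 2 k)"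
    unfolding sum_distrib_left by (intro sum.cong refl) (simp add: tnum_def min_def)
  also have "\<dots> = 3 * (\<Sum>k<3*N. Y k * Y k)"
    using sum_min_step_step[of 1 1 "3*N" Y "3*N" Y "{j. step Y j \<noteq> 0}" "{j. step Y j \<noteq> 0}"] Y f2 s2
    by simp
  finally have T22: "(\<Sum>j\<in>supp_in H m 2. \<Sum>k\<in>supp_in H m 2.
      real (min (tnum 2 * j) (tnum 2 * k)) * m 2 j * m 2 k) = 3 * (\<Sum>k<3*N. Y k * Y k)" .
  have U1: "(\<Sum>k\<in>supp_in H m 1. real (\<nu> 1 j) * real (min j k) * m 1 k)
      = real (\<nu> 1 j) * (\<Sum>i<j. X i)" for j
    using sum_min_step[of 1 N X "{j. step X j \<noteq> 0}" j] X f1 s1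
    by (simp add: mult.assoc sum_distrib_left[symmetric])
  have U2: "(\<Sum>k\<in>supp_in H m 2. real (\<nu> 2 j) * real (min j k) * m 2 k)
      = real (\<nu> 2 j) * (\<Sum>i<j. Y i)" for j
    using sum_min_step[of 1 "3*N" Y "{j. step Y j \<noteq> 0}" j] Y f2 s2
    by (simp add: mult.assoc sum_distrib_left[symmetric])
  have "cform H \<nu> m = 1/2 * (2 * (\<Sum>k<N. X k * X k) - (\<Sum>k<3*N. X (k div 3) * Y k)
      + (- (\<Sum>k<3*N. X (k div 3) * Y k) + 2/3 * (3 * (\<Sum>k<3*N. Y k * Y k))))
     - ((\<Sum>j\<in>supp_in H \<nu> 1. real (\<nu> 1 j) * (\<Sum>i<j. X i))
     + (\<Sum>j\<in>supp_in H \<nu> 2. real (\<nu> 2 j) * (\<Sum>i<j. Y i)))"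
    unfolding cform_def by (simp add: weight_form_simple_root T11 T12 T21 T22 U1 U2 del: One_nat_def)
  then show ?thesis by (simp add: sum_block_energy)
qed

text \<open>For the third claim, the sums of i * m a i are the sums of all tails, and applying the
  Cartan matrix to them gives minus the vacancy numbers at any point beyond the support.\<close>

lemma vacancy_tails:
  fixes X Y :: "nat \<Rightarrow> real"
  assumes X: "\<And>k. k \<ge> N \<Longrightarrow> X k = 0" and Y: "\<And>k. k \<ge> 3*N \<Longrightarrow> Y k = 0"
    and m1: "\<And>j. (if (1, j) \<in> H then real (m 1 j) else 0) = step X j"
    and m2: "\<And>j. (if (2, j) \<in> H then real (m 2 j) else 0) = step Y j"
  shows "vacancy H \<nu> m 1 i = (\<Sum>j\<in>supp_in H \<nu> 1. real (\<nu> 1 j) * real (min i j)) + vac1 X Y i"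
    and "vacancy H \<nu> m 2 i = (\<Sum>j\<in>supp_in H \<nu> 2. real (\<nu> 2 j) * real (min i j)) + vac2 X Y i"
    and "(\<Sum>a\<in>{1,2}. \<Sum>i\<in>supp_in H m a. (real i * real (m a i)) *\<^sub>R simple_root a)
       = (- vac1 X Y N, - vac2 X Y (3*N))"
proof -
  have supp_real: "supp_in H (\<lambda>a i. real (m a i)) = supp_in H m"
    by (simp add: supp_in_def fun_eq_iff)
  note s1 = supp_in_eq[where m = "\<lambda>a i. real (m a i)", OF m1, unfolded supp_real]
  note s2 = supp_in_eq[where m = "\<lambda>a i. real (m a i)", OF m2, unfolded supp_real]
  note f1 = finite_step_support[of N X, OF X] and f2 = finite_step_support[of "3*N" Y, OF Y]
  have V11: "(\<Sum>k\<in>supp_in H m 1. real (min (tnum 1 * i) (tnum 1 * k)) * real (m 1 k)) = (\<Sum>k<i. X k)"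
    using sum_min_step[of 1 N X "{j. step X j \<noteq> 0}" i] X f1 s1 by (simp add: tnum_def)
  have V12: "(\<Sum>k\<in>supp_in H m 2. real (min (tnum 2 * i) (tnum 1 * k)) * real (m 2 k)) = (\<Sum>k<3*i. Y k)"
    using sum_min_step[of 1 "3*N" Y "{j. step Y j \<noteq> 0}" "3*i"] Y f2 s2 by (simp add: tnum_def)
  have V21: "(\<Sum>k\<in>supp_in H m 1. real (min (tnum 1 * i) (tnum 2 * k)) * real (m 1 k)) = (\<Sum>k<i. X (k div 3))"
    using sum_min_step[of 3 N X "{j. step X j \<noteq> 0}" i] X f1 s1 by (simp add: tnum_def)
  have "(\<Sum>k\<in>supp_in H m 2. real (min (tnum 2 * i) (tnum 2 * k)) * real (m 2 k))
      = 3 * (\<Sum>k\<in>supp_in H m 2. real (min i (1 * k)) * real (m 2 k))"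
    unfolding sum_distrib_left by (intro sum.cong refl) (simp add: tnum_def min_def)
  also have "\<dots> = 3 * (\<Sum>k<i. Y k)"
    using sum_min_step[of 1 "3*N" Y "{j. step Y j \<noteq> 0}" i] Y f2 s2 by simp
  finally have V22: "(\<Sum>k\<in>supp_in H m 2. real (min (tnum 2 * i) (tnum 2 * k)) * real (m 2 k))
    = 3 * (\<Sum>k<i. Y k)" .
  show "vacancy H \<nu> m 1 i = (\<Sum>j\<in>supp_in H \<nu> 1. real (\<nu> 1 j) * real (min i j)) + vac1 X Y i"
    unfolding vacancy_def vac1_eq by (simp add: weight_form_simple_root V11 V12 del: One_nat_def)
  show "vacancy H \<nu> m 2 i = (\<Sum>j\<in>supp_in H \<nu> 2. real (\<nu> 2 j) * real (min i j)) + vac2 X Y i"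
    unfolding vacancy_def vac2_eq by (simp add: weight_form_simple_root V21 V22 del: One_nat_def)
  have W1: "(\<Sum>i\<in>supp_in H m 1. real i * real (m 1 i)) = (\<Sum>k<N. X k)"
    using sum_step[of 1 N X "{j. step X j \<noteq> 0}" "\<lambda>_. 1"] X f1 s1 by (simp add: mult.commute)
  have W2: "(\<Sum>i\<in>supp_in H m 2. real i * real (m 2 i)) = (\<Sum>k<3*N. Y k)"
    using sum_step[of 1 "3*N" Y "{j. step Y j \<noteq> 0}" "\<lambda>_. 1"] Y f2 s2 by (simp add: mult.commute)
  have W3: "(\<Sum>k<3*N. X (k div 3)) = 3 * (\<Sum>k<N. X k)"
    unfolding sum_lessThan_mult3 sum_distrib_left by (simp add: div_3)
  show "(\<Sum>a\<in>{1,2}. \<Sum>i\<in>supp_in H m a. (real i * real (m a i)) *\<^sub>R simple_root a)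
       = (- vac1 X Y N, - vac2 X Y (3*N))"
    unfolding scaleR_sum_left[symmetric] vac1_eq vac2_eq W3
    by (simp add: W1 W2 simple_root_def del: One_nat_def)
qed

section \<open>The weight condition as the limit of the vacancy numbers\<close>

definition eventually_zero :: "(nat \<Rightarrow> int) \<Rightarrow> bool" where
  "eventually_zero X \<longleftrightarrow> (\<forall>\<^sub>F k in sequentially. X k = 0)"

text \<open>Phrased with "eventually" instead of at a bound for the support, so that it can be
  carried through shifts of the tails and through the cut without keeping track of bounds.\<close>

definition vac_limit :: "(nat \<Rightarrow> int) \<Rightarrow> (nat \<Rightarrow> int) \<Rightarrow> real \<Rightarrow> real \<Rightarrow> bool" where
  "vac_limit X Y w1 w2 \<longleftrightarrow>
     (\<forall>\<^sub>F i in sequentially. of_int (vac1 X Y i) = w1 \<and> of_int (vac2 X Y i) = w2)"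

lemma eventually_zero_bound:
  assumes "eventually_zero X" "eventually_zero Y"
  obtains N where "\<And>k. k \<ge> N \<Longrightarrow> X k = 0" "\<And>k. k \<ge> N \<Longrightarrow> Y k = 0"
proof -
  have "\<forall>\<^sub>F k in sequentially. X k = 0 \<and> Y k = 0"
    using assms unfolding eventually_zero_def by (rule eventually_conj)
  then show ?thesis using that unfolding eventually_sequentially by blast
qed

lemma eventually_zeroI: "(\<And>k. k \<ge> N \<Longrightarrow> X k = 0) \<Longrightarrow> eventually_zero X"
  unfolding eventually_zero_def eventually_sequentially by blast

lemma vac1_const:
  assumes "\<And>k. k \<ge> N \<Longrightarrow> X k = 0" "\<And>k. k \<ge> 3*N \<Longrightarrow> Y k = 0" "i \<ge> N"
  shows "vac1 X Y i = vac1 X Y N"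
  using assms(3)
proof (induction i rule: dec_induct)
  case (step i)
  then show ?case using assms(1,2) by (simp add: vac1_def)
qed simp

lemma vac2_const:
  assumes "\<And>k. k \<ge> N \<Longrightarrow> X k = 0" "\<And>k. k \<ge> 3*N \<Longrightarrow> Y k = 0" "i \<ge> 3*N"
  shows "vac2 X Y i = vac2 X Y (3*N)"
  using assms(3)
proof (induction i rule: dec_induct)
  case (step i)
  then have "N \<le> i div 3" by simp
  then show ?case using assms(1)[of "i div 3"] assms(2)[of i] step by (simp add: vac2_def)
qed simp

lemma vac_limit_iff:
  assumes "\<And>k. k \<ge> N \<Longrightarrow> X k = 0" "\<And>k. k \<ge> 3*N \<Longrightarrow> Y k = 0"
  shows "vac_limit X Y w1 w2 \<longleftrightarrow> of_int (vac1 X Y N) = w1 \<and> of_int (vac2 X Y (3*N)) = w2"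
proof
  assume "vac_limit X Y w1 w2"
  then obtain M where M: "\<And>i. i \<ge> M \<Longrightarrow> of_int (vac1 X Y i) = w1 \<and> of_int (vac2 X Y i) = w2"
    unfolding vac_limit_def eventually_sequentially by blast
  have "vac1 X Y (max M (3*N)) = vac1 X Y N"
    by (rule vac1_const) (use assms in simp_all)
  moreover have "vac2 X Y (max M (3*N)) = vac2 X Y (3*N)"
    by (rule vac2_const) (use assms in simp_all)
  ultimately show "of_int (vac1 X Y N) = w1 \<and> of_int (vac2 X Y (3*N)) = w2"
    using M[of "max M (3*N)"] by simp
next
  assume *: "of_int (vac1 X Y N) = w1 \<and> of_int (vac2 X Y (3*N)) = w2"
  show "vac_limit X Y w1 w2"
    unfolding vac_limit_def eventually_sequentially
  proof (intro exI[of _ "3*N"] allI impI)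
    fix i assume i: "3 * N \<le> i"
    have "vac1 X Y i = vac1 X Y N"
      by (rule vac1_const) (use assms i in simp_all)
    moreover have "vac2 X Y i = vac2 X Y (3*N)"
      by (rule vac2_const) (use assms i in simp_all)
    ultimately show "of_int (vac1 X Y i) = w1 \<and> of_int (vac2 X Y i) = w2"
      using * by simp
  qed
qed

lemma step_of_int: "step (\<lambda>k. of_int (X k)) i = of_int (step X i)"
  by (simp add: step_def)

lemma vac1_of_int: "vac1 (\<lambda>k. of_int (X k)) (\<lambda>k. of_int (Y k)) i = of_int (vac1 X Y i)"
  by (simp add: vac1_def)

lemma vac2_of_int: "vac2 (\<lambda>k. of_int (X k)) (\<lambda>k. of_int (Y k)) i = of_int (vac2 X Y i)"
  by (simp add: vac2_def)

lemma block_energy_of_int: "block_energy (\<lambda>k. of_int (X k)) (\<lambda>k. of_int (Y k)) i = of_int (block_energy X Y i)"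
  by (simp add: block_energy_def)

section \<open>Correspondence between configurations and pairs of tails\<close>

definition tail :: "(nat \<Rightarrow> nat) \<Rightarrow> nat \<Rightarrow> int" where
  "tail f k = (\<Sum>i | k < i \<and> f i \<noteq> 0. int (f i))"

lemma tail_rec:
  assumes "finite {i. f i \<noteq> 0}"
  shows "tail f k = int (f (Suc k)) + tail f (Suc k)"
proof (cases "f (Suc k) = 0")
  case True
  then have "{i. k < i \<and> f i \<noteq> 0} = {i. Suc k < i \<and> f i \<noteq> 0}"
    by (auto intro: Suc_lessI)
  then show ?thesis using True by (simp add: tail_def)
next
  case False
  then have "{i. k < i \<and> f i \<noteq> 0} = insert (Suc k) {i. Suc k < i \<and> f i \<noteq> 0}"
    by (auto intro: Suc_lessI)
  moreover have "finite {i. Suc k < i \<and> f i \<noteq> 0}"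
    using assms by (rule rev_finite_subset) auto
  ultimately show ?thesis by (simp add: tail_def)
qed

lemma step_tail:
  assumes "finite {i. f i \<noteq> 0}" "f 0 = 0"
  shows "step (tail f) i = int (f i)"
  using assms tail_rec[of f "i - 1"] by (cases i) (simp_all add: step_def)

lemma eventually_zero_tail:
  assumes "finite {i. f i \<noteq> 0}"
  shows "eventually_zero (tail f)"
proof -
  obtain N where N: "\<forall>i\<in>{i. f i \<noteq> 0}. i \<le> N"
    using assms finite_nat_set_iff_bounded_le by blast
  show ?thesis
  proof (rule eventually_zeroI[of N])
    fix k assume "N \<le> k"
    then have "f i = 0" if "k < i" for i
      using N that by (metis (mono_tags) leD le_less_trans mem_Collect_eq)
    then have "{i. k < i \<and> f i \<noteq> 0} = {}" by auto
    then show "tail f k = 0" by (simp only: tail_def) simp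
  qed
qed

text \<open>Equal steps make the difference of the two sequences constant, and it is 0 far
  out.\<close>

lemma eventually_zero_step_eq:
  assumes "eventually_zero X" "eventually_zero X'" "\<And>i. step X i = step X' i"
  shows "X = X'"
proof
  fix k
  obtain N where N: "\<And>k. k \<ge> N \<Longrightarrow> X k = 0" "\<And>k. k \<ge> N \<Longrightarrow> X' k = 0"
    using eventually_zero_bound[OF assms(1,2)] by blast
  have "X k - X' k = X (k + n) - X' (k + n)" for n
  proof (induction n)
    case (Suc n)
    then show ?case using assms(3)[of "Suc (k + n)"] by simp
  qed simp
  from this[of N] show "X k = X' k" using N by simp
qed

definition conf :: "(nat \<Rightarrow> int) \<times> (nat \<Rightarrow> int) \<Rightarrow> nat \<Rightarrow> nat \<Rightarrow> nat" where
  "conf = (\<lambda>(X, Y) a i. if a = 1 then nat (step X i) else if a = 2 then nat (step Y i) else 0)"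

definition vac_offset :: "(nat \<times> nat) set \<Rightarrow> (nat \<Rightarrow> nat \<Rightarrow> nat) \<Rightarrow> nat \<Rightarrow> nat \<Rightarrow> int" where
  "vac_offset H \<nu> a i = (\<Sum>j\<in>supp_in H \<nu> a. int (\<nu> a j) * int (min i j))"

definition weight_total :: "(nat \<times> nat) set \<Rightarrow> (nat \<Rightarrow> nat \<Rightarrow> nat) \<Rightarrow> nat \<Rightarrow> real" where
  "weight_total H \<nu> a = (\<Sum>i\<in>supp_in H \<nu> a. real i * real (\<nu> a i))"

text \<open>For finitely supported \<nu>, \<open>vac_offset\<close> equals
  \<open>weight_total\<close> beyond the support of \<nu>. The last conjunct thus says that the full
  vacancy numbers settle at the coordinates of \<open>wt\<close>.\<close>

definition tail_configs ::
    "(nat \<times> nat) set \<Rightarrow> (nat \<Rightarrow> nat \<Rightarrow> nat) \<Rightarrow> real \<times> real \<Rightarrow> ((nat \<Rightarrow> int) \<times> (nat \<Rightarrow> int)) set" where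
  "tail_configs H \<nu> wt = {(X, Y). eventually_zero X \<and> eventually_zero Y \<and>
     (\<forall>i. step X i \<ge> 0 \<and> ((1, i) \<notin> H \<longrightarrow> step X i = 0)) \<and>
     (\<forall>i. step Y i \<ge> 0 \<and> ((2, i) \<notin> H \<longrightarrow> step Y i = 0)) \<and>
     (\<forall>i. (1, i) \<in> H \<longrightarrow> vac_offset H \<nu> 1 i + vac1 X Y i \<ge> 0) \<and>
     (\<forall>i. (2, i) \<in> H \<longrightarrow> vac_offset H \<nu> 2 i + vac2 X Y i \<ge> 0) \<and>
     vac_limit X Y (fst wt - weight_total H \<nu> 1) (snd wt - weight_total H \<nu> 2)}"

lemma real_vac_offset:
  "real_of_int (vac_offset H \<nu> a i) = (\<Sum>j\<in>supp_in H \<nu> a. real (\<nu> a j) * real (min i j))"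
  by (simp add: vac_offset_def)

context
  fixes H :: "(nat \<times> nat) set"
  assumes H: "H \<subseteq> H_all"
begin

context
  fixes X Y :: "nat \<Rightarrow> int"
  assumes eventually_zero: "eventually_zero X" "eventually_zero Y"
    and step_nonneg: "\<And>i. step X i \<ge> 0" "\<And>i. step Y i \<ge> 0"
    and step_outside: "\<And>i. (1, i) \<notin> H \<Longrightarrow> step X i = 0" "\<And>i. (2, i) \<notin> H \<Longrightarrow> step Y i = 0"
begin

lemma conf_real:
  "(if (1, j) \<in> H then real (conf (X, Y) 1 j) else 0) = step (\<lambda>k. of_int (X k)) j"
  "(if (2, j) \<in> H then real (conf (X, Y) 2 j) else 0) = step (\<lambda>k. of_int (Y k)) j"
  using step_nonneg[of j] step_outside[of j] by (simp_all add: conf_def step_of_int)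

lemma vacancy_conf:
  "vacancy H \<nu> (conf (X, Y)) 1 i = of_int (vac_offset H \<nu> 1 i + vac1 X Y i)"
  "vacancy H \<nu> (conf (X, Y)) 2 i = of_int (vac_offset H \<nu> 2 i + vac2 X Y i)"
proof -
  obtain N where N: "\<And>k. k \<ge> N \<Longrightarrow> X k = 0" "\<And>k. k \<ge> N \<Longrightarrow> Y k = 0"
    using eventually_zero_bound[OF eventually_zero] by blast
  note V = vacancy_tails[of N "\<lambda>k. of_int (X k)" "\<lambda>k. of_int (Y k)", OF _ _ conf_real]
  show "vacancy H \<nu> (conf (X, Y)) 1 i = of_int (vac_offset H \<nu> 1 i + vac1 X Y i)"
    using N by (subst V(1)) (simp_all add: real_vac_offset vac1_of_int)
  show "vacancy H \<nu> (conf (X, Y)) 2 i = of_int (vac_offset H \<nu> 2 i + vac2 X Y i)"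
    using N by (subst V(2)) (simp_all add: real_vac_offset vac2_of_int)
qed

lemma weight_conf:
  "(\<Sum>a\<in>{1,2}. \<Sum>i\<in>supp_in H (conf (X, Y)) a. (real i * real (conf (X, Y) a i)) *\<^sub>R simple_root a)
      = (\<Sum>a\<in>{1,2}. \<Sum>i\<in>supp_in H \<nu> a. (real i * real (\<nu> a i)) *\<^sub>R fund_weight a) - wt
   \<longleftrightarrow> vac_limit X Y (fst wt - weight_total H \<nu> 1) (snd wt - weight_total H \<nu> 2)"
proof -
  obtain N where N: "\<And>k. k \<ge> N \<Longrightarrow> X k = 0" "\<And>k. k \<ge> N \<Longrightarrow> Y k = 0"
    using eventually_zero_bound[OF eventually_zero] by blast
  note V = vacancy_tails[of N "\<lambda>k. of_int (X k)" "\<lambda>k. of_int (Y k)", OF _ _ conf_real]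
  have "(\<Sum>a\<in>{1,2}. \<Sum>i\<in>supp_in H (conf (X, Y)) a. (real i * real (conf (X, Y) a i)) *\<^sub>R simple_root a)
      = (- of_int (vac1 X Y N), - of_int (vac2 X Y (3 * N)))"
    using N by (subst V(3)) (simp_all add: vac1_of_int vac2_of_int)
  moreover have "(\<Sum>a\<in>{1,2}. \<Sum>i\<in>supp_in H \<nu> a. (real i * real (\<nu> a i)) *\<^sub>R fund_weight a) - wt
      = (weight_total H \<nu> 1 - fst wt, weight_total H \<nu> 2 - snd wt)"
    unfolding scaleR_sum_left[symmetric] weight_total_def
    by (simp add: fund_weight_def prod_eq_iff)
  moreover have "vac_limit X Y (fst wt - weight_total H \<nu> 1) (snd wt - weight_total H \<nu> 2) \<longleftrightarrow>
      of_int (vac1 X Y N) = fst wt - weight_total H \<nu> 1 \<and>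
      of_int (vac2 X Y (3 * N)) = snd wt - weight_total H \<nu> 2"
    using N by (intro vac_limit_iff) auto
  ultimately show ?thesis by auto
qed

lemma conf_in_configs:
  "conf (X, Y) \<in> configs H \<nu> wt \<longleftrightarrow> (X, Y) \<in> tail_configs H \<nu> wt"
proof -
  obtain N where N: "\<And>k. k \<ge> N \<Longrightarrow> X k = 0" "\<And>k. k \<ge> N \<Longrightarrow> Y k = 0"
    using eventually_zero_bound[OF eventually_zero] by blast
  have "{(a, i). conf (X, Y) a i \<noteq> 0} \<subseteq> {1, 2} \<times> {..N}"
  proof
    fix p assume "p \<in> {(a, i). conf (X, Y) a i \<noteq> 0}"
    then obtain a i where p: "p = (a, i)" "conf (X, Y) a i \<noteq> 0" by blast
    then have "a \<in> {1, 2}" "step X i \<noteq> 0 \<or> step Y i \<noteq> 0"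
      by (auto simp: conf_def split: if_splits)
    moreover have "step X i = 0 \<and> step Y i = 0" if "i > N"
      using step_beyond[of N X i, OF N(1) that] step_beyond[of N Y i, OF N(2) that] by simp
    ultimately show "p \<in> {1, 2} \<times> {..N}" using p by (cases "i \<le> N") auto
  qed
  then have fin: "finite {(a, i). conf (X, Y) a i \<noteq> 0}"
    by (rule finite_subset) auto
  have out: "\<forall>a i. (a, i) \<notin> H \<longrightarrow> conf (X, Y) a i = 0"
    by (simp add: conf_def step_outside del: One_nat_def)
  have "(\<forall>(a, i)\<in>H. vacancy H \<nu> (conf (X, Y)) a i \<ge> 0) \<longleftrightarrow>
     (\<forall>i. (1, i) \<in> H \<longrightarrow> vacancy H \<nu> (conf (X, Y)) 1 i \<ge> 0) \<and>
     (\<forall>i. (2, i) \<in> H \<longrightarrow> vacancy H \<nu> (conf (X, Y)) 2 i \<ge> 0)" (is "?l = ?r")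
  proof
    assume r: ?r
    show ?l
    proof clarify
      fix a i assume ai: "(a, i) \<in> H"
      then have "a = 1 \<or> a = 2" using H by (auto simp: H_all_def)
      then show "vacancy H \<nu> (conf (X, Y)) a i \<ge> 0" using r ai by auto
    qed
  qed blast
  then have "conf (X, Y) \<in> configs H \<nu> wt \<longleftrightarrow>
     (\<forall>i. (1, i) \<in> H \<longrightarrow> vac_offset H \<nu> 1 i + vac1 X Y i \<ge> 0) \<and>
     (\<forall>i. (2, i) \<in> H \<longrightarrow> vac_offset H \<nu> 2 i + vac2 X Y i \<ge> 0) \<and>
     vac_limit X Y (fst wt - weight_total H \<nu> 1) (snd wt - weight_total H \<nu> 2)"
    unfolding configs_def mem_Collect_eq weight_conf vacancy_conf of_int_0_le_iff
    using fin out by blast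
  then show ?thesis
    unfolding tail_configs_def mem_Collect_eq prod.case
    using eventually_zero step_nonneg step_outside by simp
qed

end

text \<open>The inverse takes the tails of both rows. Tails do not see an entry at position 0;
  \<open>H \<subseteq> H_all\<close> guarantees that there is none.\<close>

lemma bij_betw_conf: "bij_betw conf (tail_configs H \<nu> wt) (configs H \<nu> wt)"
proof (rule bij_betw_byWitness[where f' = "\<lambda>m. (tail (m 1), tail (m 2))"])
  have H0: "(a, 0) \<notin> H" for a using H by (auto simp: H_all_def)
  have fin: "finite {i. m a i \<noteq> 0}" if "m \<in> configs H \<nu> wt" for m a
  proof -
    have "finite (snd ` {(a, i). m a i \<noteq> 0})" using that by (simp add: configs_def)
    then show ?thesis by (rule rev_finite_subset) force
  qed
  have zero: "(a, i) \<notin> H \<Longrightarrow> m a i = 0" if "m \<in> configs H \<nu> wt" for m a i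
    using that by (simp add: configs_def)
  have st: "step (tail (m a)) i = int (m a i)" if "m \<in> configs H \<nu> wt" for m a i
    using fin[OF that] zero[OF that H0] by (rule step_tail)
  have ct: "conf (tail (m 1), tail (m 2)) = m" if m: "m \<in> configs H \<nu> wt" for m
  proof (intro ext)
    fix a i
    have "m a i = 0" if "a \<noteq> 1" "a \<noteq> 2"
      using that H by (intro zero[OF m]) (auto simp: H_all_def)
    then show "conf (tail (m 1), tail (m 2)) a i = m a i"
      unfolding conf_def prod.case st[OF m] nat_int by metis
  qed
  show "\<forall>m\<in>configs H \<nu> wt. conf (tail (m 1), tail (m 2)) = m"
    using ct by blast
  show "(\<lambda>m. (tail (m 1), tail (m 2))) ` configs H \<nu> wt \<subseteq> tail_configs H \<nu> wt"
  proof (rule image_subsetI)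
    fix m assume m: "m \<in> configs H \<nu> wt"
    have "conf (tail (m 1), tail (m 2)) \<in> configs H \<nu> wt" using ct[OF m] m by simp
    moreover have "conf (tail (m 1), tail (m 2)) \<in> configs H \<nu> wt \<longleftrightarrow>
       (tail (m 1), tail (m 2)) \<in> tail_configs H \<nu> wt"
      by (rule conf_in_configs) (use eventually_zero_tail fin[OF m] zero[OF m] in \<open>simp_all add: st[OF m]\<close>)
    ultimately show "(tail (m 1), tail (m 2)) \<in> tail_configs H \<nu> wt" by simp
  qed
  have im: "conf (X, Y) \<in> configs H \<nu> wt" if XY: "(X, Y) \<in> tail_configs H \<nu> wt" for X Y
  proof -
    have "conf (X, Y) \<in> configs H \<nu> wt \<longleftrightarrow> (X, Y) \<in> tail_configs H \<nu> wt"
      by (rule conf_in_configs) (use XY in \<open>simp_all add: tail_configs_def\<close>)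
    then show "conf (X, Y) \<in> configs H \<nu> wt" using XY by simp
  qed
  then show "conf ` tail_configs H \<nu> wt \<subseteq> configs H \<nu> wt"
    by (metis image_subsetI surj_pair)
  show "\<forall>z\<in>tail_configs H \<nu> wt. (tail (conf z 1), tail (conf z 2)) = z"
  proof
    fix z assume "z \<in> tail_configs H \<nu> wt"
    then obtain X Y where z: "z = (X, Y)" and XY: "(X, Y) \<in> tail_configs H \<nu> wt"
      by (cases z) simp
    note m = im[OF XY]
    have "tail (conf (X, Y) 1) = X"
      by (rule eventually_zero_step_eq) (use eventually_zero_tail fin[OF m] XY in
        \<open>simp_all add: st[OF m] tail_configs_def, simp add: conf_def\<close>)
    moreover have "tail (conf (X, Y) 2) = Y"
      by (rule eventually_zero_step_eq) (use eventually_zero_tail fin[OF m] XY in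
        \<open>simp_all add: st[OF m] tail_configs_def, simp add: conf_def\<close>)
    ultimately show "(tail (conf z 1), tail (conf z 2)) = z" by (simp add: z)
  qed
qed

end

section \<open>Fermionic forms in terms of tails\<close>

text \<open>Each factor satisfies 1 - q^(-i) = - q^(-i) (1 - q^i); the exponents add up to a
  triangular number.\<close>

lemma qpoch_inverse:
  fixes q :: "'a::field"
  assumes "q \<noteq> 0"
  shows "qpoch (inverse q) k = (-1) ^ k * q powi (- int (\<Sum>i=1..k. i)) * qpoch q k"
proof (induction k)
  case 0
  then show ?case by (simp add: qpoch_def)
next
  case (Suc k)
  define S where "S = (\<Sum>i=1..k. i)"
  have S: "(\<Sum>i=1..Suc k. i) = S + Suc k" by (simp add: S_def)
  have "1 - inverse q ^ Suc k = - (q powi (- int (Suc k))) * (1 - q ^ Suc k)"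
    using assms unfolding power_int_minus power_int_of_nat power_inverse
    by (simp add: field_simps del: power_Suc)
  moreover have "q powi (- int (S + Suc k)) = q powi (- int S) * q powi (- int (Suc k))"
    unfolding of_nat_add minus_add_distrib using assms by (intro power_int_add) simp
  ultimately show ?case
    using Suc unfolding S S_def[symmetric] qpoch_def
    by (simp add: prod.nat_ivl_Suc' mult_ac del: of_nat_Suc of_nat_add power_Suc)
       (simp add: mult_ac)
qed

text \<open>The q-binomial in terms of the vacancy number p and the entry n. Both are integers, so
  that steps of integer-valued tails can be inserted directly.\<close>

definition qfac :: "'a::field \<Rightarrow> int \<Rightarrow> int \<Rightarrow> 'a" where
  "qfac q p n = qbinom q (p + n) (nat n)"

lemma qfac_eq:
  assumes "p \<ge> 0" "n \<ge> 0"
  shows "qfac q p n = qpoch q (nat (p + n)) / (qpoch q (nat p) * qpoch q (nat n))"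
  using assms by (simp add: qfac_def qbinom_def)

text \<open>The triangular numbers satisfy S (a + b) = S a + S b + a b, so only the power with
  exponent - a b survives in the quotient; the signs cancel.\<close>

lemma qfac_inverse:
  fixes q :: "'a::field"
  assumes "q \<noteq> 0" "p \<ge> 0" "n \<ge> 0"
  shows "qfac (inverse q) p n = q powi (- (p * n)) * qfac q p n"
proof -
  define a b where "a = nat p" and "b = nat n"
  have ab: "p = int a" "n = int b" using assms by (simp_all add: a_def b_def)
  define S where "S k = int (\<Sum>i=1..k. i)" for k :: nat
  have S: "S (a + b) = S a + S b + int a * int b"
    by (induction b) (simp_all add: S_def algebra_simps)
  have "q powi (- S (a + b)) = q powi (- (int a * int b)) * (q powi (- S a) * q powi (- S b))"
    unfolding S using assms by (simp add: power_int_add[symmetric] algebra_simps)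
  moreover have "q powi (- S a) \<noteq> 0" "q powi (- S b) \<noteq> 0" using assms by simp_all
  moreover have "qpoch (inverse q) k = (-1) ^ k * q powi (- S k) * qpoch q k" for k
    unfolding S_def by (rule qpoch_inverse[OF assms(1)])
  ultimately show ?thesis
    unfolding ab using assms(1) by (simp add: qfac_eq nat_add_distrib power_add)
qed

lemma qfac_0_right:
  assumes "p \<ge> 0" "\<And>k. qpoch q k \<noteq> 0"
  shows "qfac q p 0 = 1"
  using assms by (simp add: qfac_eq) (simp add: qpoch_def)

text \<open>\<open>Sum_any\<close> avoids naming a bound for the support. Its default value for
  infinite support does not arise when both tails are eventually zero.\<close>

definition energy :: "(nat \<Rightarrow> int) \<Rightarrow> (nat \<Rightarrow> int) \<Rightarrow> int" where
  "energy X Y = Sum_any (block_energy X Y)"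

lemma energy_eq:
  assumes "\<And>k. k \<ge> N \<Longrightarrow> X k = 0" "\<And>k. k \<ge> 3*N \<Longrightarrow> Y k = 0"
  shows "energy X Y = (\<Sum>k<N. block_energy X Y k)"
  unfolding energy_def
proof (rule Sum_any.expand_superset)
  show "{k. block_energy X Y k \<noteq> 0} \<subseteq> {..<N}"
  proof
    fix k assume "k \<in> {k. block_energy X Y k \<noteq> 0}"
    then show "k \<in> {..<N}"
      using assms(1)[of k] assms(2)[of "3*k"] assms(2)[of "3*k+1"] assms(2)[of "3*k+2"]
      by (cases "k < N") (auto simp: block_energy_def)
  qed
qed simp

lemma sum_step_vac1:
  assumes "\<And>k. k \<ge> N \<Longrightarrow> X k = 0"
  shows "(\<Sum>i | step X i \<noteq> 0. step X i * vac1 X Y i)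
    = (\<Sum>k<N. X k * (Y (3*k) + Y (3*k+1) + Y (3*k+2) - 2 * X k))"
  using sum_step[of 1 N X "{i. step X i \<noteq> 0}" "\<lambda>k. Y (3*k) + Y (3*k+1) + Y (3*k+2) - 2 * X k"]
    assms finite_step_support[of N X] by (simp add: vac1_def)

lemma sum_step_vac2:
  assumes "\<And>k. k \<ge> N \<Longrightarrow> Y k = 0"
  shows "(\<Sum>i | step Y i \<noteq> 0. step Y i * vac2 X Y i)
    = (\<Sum>k<N. Y k * (X (k div 3) - 2 * Y k))"
  using sum_step[of 1 N Y "{i. step Y i \<noteq> 0}" "\<lambda>k. X (k div 3) - 2 * Y k"]
    assms finite_step_support[of N Y] by (simp add: vac2_def)

lemma sum_step_offset:
  assumes "\<And>k. k \<ge> N \<Longrightarrow> X k = 0"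
  shows "(\<Sum>i | step X i \<noteq> 0. step X i * vac_offset H \<nu> a i)
    = (\<Sum>j\<in>supp_in H \<nu> a. int (\<nu> a j) * (\<Sum>i<j. X i))"
proof -
  have "int (\<nu> a j) * (\<Sum>i<j. X i)
     = (\<Sum>i | step X i \<noteq> 0. step X i * (int (\<nu> a j) * int (min i j)))" for j
  proof -
    have "(\<Sum>i<j. X i) = (\<Sum>i | step X i \<noteq> 0. int (min j i) * step X i)"
      using sum_min_step[of 1 N X "{i. step X i \<noteq> 0}" j] assms finite_step_support[of N X] by simp
    then show ?thesis
      by (simp only: sum_distrib_left min.commute[of _ j]) (simp add: mult_ac)
  qed
  then have "(\<Sum>j\<in>supp_in H \<nu> a. int (\<nu> a j) * (\<Sum>i<j. X i))
     = (\<Sum>j\<in>supp_in H \<nu> a. \<Sum>i | step X i \<noteq> 0. step X i * (int (\<nu> a j) * int (min i j)))"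
    by (rule sum.cong[OF refl])
  also have "\<dots> = (\<Sum>i | step X i \<noteq> 0. step X i * vac_offset H \<nu> a i)"
    unfolding vac_offset_def by (subst sum.swap) (simp add: sum_distrib_left)
  finally show ?thesis by simp
qed

definition linear_part ::
    "(nat \<times> nat) set \<Rightarrow> (nat \<Rightarrow> nat \<Rightarrow> nat) \<Rightarrow> (nat \<Rightarrow> int) \<Rightarrow> (nat \<Rightarrow> int) \<Rightarrow> int" where
  "linear_part H \<nu> X Y = (\<Sum>j\<in>supp_in H \<nu> 1. int (\<nu> 1 j) * (\<Sum>i<j. X i))
     + (\<Sum>j\<in>supp_in H \<nu> 2. int (\<nu> 2 j) * (\<Sum>i<j. Y i))"

lemma cform_energy:
  assumes "eventually_zero X" "eventually_zero Y"
    and "\<And>j. (if (1, j) \<in> H then m 1 j else 0) = of_int (step X j)"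
    and "\<And>j. (if (2, j) \<in> H then m 2 j else 0) = of_int (step Y j)"
  shows "cform H \<nu> m = of_int (energy X Y - linear_part H \<nu> X Y)"
proof -
  obtain N where N: "\<And>k. k \<ge> N \<Longrightarrow> X k = 0" "\<And>k. k \<ge> N \<Longrightarrow> Y k = 0"
    using eventually_zero_bound[OF assms(1,2)] by blast
  have "cform H \<nu> m = (\<Sum>k<N. block_energy (\<lambda>k. of_int (X k)) (\<lambda>k. of_int (Y k)) k)
     - (\<Sum>j\<in>supp_in H \<nu> 1. real (\<nu> 1 j) * (\<Sum>i<j. of_int (X i)))
     - (\<Sum>j\<in>supp_in H \<nu> 2. real (\<nu> 2 j) * (\<Sum>i<j. of_int (Y i)))"
    by (rule cform_tails) (use N assms(3,4) in \<open>simp_all add: step_of_int\<close>)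
  moreover have "energy X Y = (\<Sum>k<N. block_energy X Y k)"
    using N by (intro energy_eq) auto
  ultimately show ?thesis
    by (simp add: block_energy_of_int linear_part_def)
qed

text \<open>Euler's identity for homogeneous functions: the vacancy numbers are minus the gradient
  of c, and c is the energy, of degree 2, minus a linear part, of degree 1.\<close>

lemma sum_step_vacancy:
  assumes "eventually_zero X" "eventually_zero Y"
  shows "(\<Sum>i | step X i \<noteq> 0. (vac_offset H \<nu> 1 i + vac1 X Y i) * step X i)
      + (\<Sum>i | step Y i \<noteq> 0. (vac_offset H \<nu> 2 i + vac2 X Y i) * step Y i)
    = linear_part H \<nu> X Y - 2 * energy X Y"
proof -
  obtain N where N: "\<And>k. k \<ge> N \<Longrightarrow> X k = 0" "\<And>k. k \<ge> N \<Longrightarrow> Y k = 0"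
    using eventually_zero_bound[OF assms] by blast
  have "energy X Y = (\<Sum>k<N. block_energy X Y k)"
    using N by (intro energy_eq) auto
  moreover have "(\<Sum>i | step X i \<noteq> 0. step X i * vac1 X Y i)
    = (\<Sum>k<N. X k * (Y (3*k) + Y (3*k+1) + Y (3*k+2) - 2 * X k))"
    using N by (intro sum_step_vac1) auto
  moreover have "(\<Sum>i | step Y i \<noteq> 0. step Y i * vac2 X Y i)
    = (\<Sum>k<3*N. Y k * (X (k div 3) - 2 * Y k))"
    using N by (intro sum_step_vac2) auto
  moreover note sum_step_offset[of N X H \<nu> 1, OF N(1)] sum_step_offset[of N Y H \<nu> 2, OF N(2)]
  moreover have "(\<Sum>k<N. X k * (Y (3*k) + Y (3*k+1) + Y (3*k+2) - 2 * X k))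
      + (\<Sum>k<3*N. Y k * (X (k div 3) - 2 * Y k)) = - 2 * (\<Sum>k<N. block_energy X Y k)"
    unfolding sum_lessThan_mult3 sum_distrib_left sum.distrib[symmetric]
    by (intro sum.cong refl) (simp add: block_energy_def div_3, simp add: power2_eq_square algebra_simps)
  moreover have "(\<Sum>i\<in>A. (f i + g i) * h i) = (\<Sum>i\<in>A. h i * f i) + (\<Sum>i\<in>A. h i * g i)"
    for f g h :: "nat \<Rightarrow> int" and A
    unfolding sum.distrib[symmetric] by (intro sum.cong refl) (simp add: algebra_simps)
  ultimately show ?thesis
    by (simp add: linear_part_def)
qed

definition qfac_prod :: "'a::field \<Rightarrow> (nat \<Rightarrow> int) \<Rightarrow> (nat \<Rightarrow> int) \<Rightarrow> 'a" where
  "qfac_prod q p X = (\<Prod>i | step X i \<noteq> 0. qfac q (p i) (step X i))"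

lemma qfac_prod_inverse:
  assumes "q \<noteq> 0" "\<And>i. step X i \<ge> 0" "\<And>i. step X i \<noteq> 0 \<Longrightarrow> p i \<ge> 0"
  shows "qfac_prod (inverse q) p X = q powi (- (\<Sum>i | step X i \<noteq> 0. p i * step X i)) * qfac_prod q p X"
proof -
  have *: "(\<Prod>i\<in>A. q powi f i) = q powi (\<Sum>i\<in>A. f i)" for A :: "nat set" and f
    by (induction A rule: infinite_finite_induct) (simp_all add: power_int_add assms(1))
  show ?thesis
    using assms unfolding qfac_prod_def
    by (simp add: qfac_inverse prod.distrib * sum_negf[symmetric])
qed

lemma fermionic_tails:
  assumes H: "H \<subseteq> H_all"
  shows "fermionic H \<nu> wt q = (\<Sum>(X, Y)\<in>tail_configs H \<nu> wt.
     q powi (energy X Y - linear_part H \<nu> X Y)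
       * (qfac_prod q (\<lambda>i. vac_offset H \<nu> 1 i + vac1 X Y i) X
       * qfac_prod q (\<lambda>i. vac_offset H \<nu> 2 i + vac2 X Y i) Y))"
  unfolding fermionic_def
proof (subst sum.reindex_bij_betw[OF bij_betw_conf[OF H], symmetric], intro sum.cong refl, clarify)
  fix X Y assume XY: "(X, Y) \<in> tail_configs H \<nu> wt"
  have eventually_zero: "eventually_zero X" "eventually_zero Y" and nonneg: "\<And>i. step X i \<ge> 0" "\<And>i. step Y i \<ge> 0"
    and out: "\<And>i. (1, i) \<notin> H \<Longrightarrow> step X i = 0" "\<And>i. (2, i) \<notin> H \<Longrightarrow> step Y i = 0"
    using XY by (auto simp: tail_configs_def)
  have conf_step: "int (conf (X, Y) 1 i) = step X i" "int (conf (X, Y) 2 i) = step Y i" for i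
    using nonneg[of i] by (simp_all add: conf_def)
  have nat_step: "conf (X, Y) 1 i = nat (step X i)" "conf (X, Y) 2 i = nat (step Y i)" for i
    by (simp_all add: conf_def)
  have c: "cform H \<nu> (\<lambda>a i. real (conf (X, Y) a i)) = of_int (energy X Y - linear_part H \<nu> X Y)"
    by (rule cform_energy[OF eventually_zero])
       (use conf_real[OF H eventually_zero nonneg out] in \<open>simp_all add: step_of_int\<close>)
  have v: "\<lfloor>vacancy H \<nu> (conf (X, Y)) 1 i\<rfloor> = vac_offset H \<nu> 1 i + vac1 X Y i"
    "\<lfloor>vacancy H \<nu> (conf (X, Y)) 2 i\<rfloor> = vac_offset H \<nu> 2 i + vac2 X Y i" for i
    using vacancy_conf[OF H eventually_zero nonneg out] by (simp_all del: of_int_add)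
  have s: "supp_in H (conf (X, Y)) 1 = {i. step X i \<noteq> 0}" "supp_in H (conf (X, Y)) 2 = {i. step Y i \<noteq> 0}"
  proof -
    show "supp_in H (conf (X, Y)) 1 = {i. step X i \<noteq> 0}"
      unfolding supp_in_def using out(1) conf_step(1) by (metis (lifting) of_nat_0 of_nat_eq_iff)
    show "supp_in H (conf (X, Y)) 2 = {i. step Y i \<noteq> 0}"
      unfolding supp_in_def using out(2) conf_step(2) by (metis (lifting) of_nat_0 of_nat_eq_iff)
  qed
  show "q powi \<lfloor>cform H \<nu> (\<lambda>a i. real (conf (X, Y) a i))\<rfloor> *
      (\<Prod>a\<in>{1,2}. \<Prod>i\<in>supp_in H (conf (X, Y)) a.
         qbinom q (\<lfloor>vacancy H \<nu> (conf (X, Y)) a i\<rfloor> + int (conf (X, Y) a i)) (conf (X, Y) a i))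
    = q powi (energy X Y - linear_part H \<nu> X Y)
       * (qfac_prod q (\<lambda>i. vac_offset H \<nu> 1 i + vac1 X Y i) X
       * qfac_prod q (\<lambda>i. vac_offset H \<nu> 2 i + vac2 X Y i) Y)"
    unfolding c floor_of_int qfac_prod_def qfac_def
    by (simp add: s v conf_step nat_step[symmetric] del: One_nat_def)
qed

lemma fermionic_inverse_tails:
  assumes H: "H \<subseteq> H_all" and q: "q \<noteq> 0"
  shows "fermionic H \<nu> wt (inverse q) = (\<Sum>(X, Y)\<in>tail_configs H \<nu> wt.
     q powi (energy X Y)
       * (qfac_prod q (\<lambda>i. vac_offset H \<nu> 1 i + vac1 X Y i) X
       * qfac_prod q (\<lambda>i. vac_offset H \<nu> 2 i + vac2 X Y i) Y))"
  unfolding fermionic_tails[OF H]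
proof (intro sum.cong refl, clarify)
  fix X Y assume XY: "(X, Y) \<in> tail_configs H \<nu> wt"
  have eventually_zero: "eventually_zero X" "eventually_zero Y" and nonneg: "\<And>i. step X i \<ge> 0" "\<And>i. step Y i \<ge> 0"
    using XY by (auto simp: tail_configs_def)
  have vac: "vac_offset H \<nu> 1 i + vac1 X Y i \<ge> 0" if "step X i \<noteq> 0" for i
    using XY that unfolding tail_configs_def by blast
  have vac': "vac_offset H \<nu> 2 i + vac2 X Y i \<ge> 0" if "step Y i \<noteq> 0" for i
    using XY that unfolding tail_configs_def by blast
  let ?S = "\<Sum>i | step X i \<noteq> 0. (vac_offset H \<nu> 1 i + vac1 X Y i) * step X i"
  let ?T = "\<Sum>i | step Y i \<noteq> 0. (vac_offset H \<nu> 2 i + vac2 X Y i) * step Y i"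
  have "energy X Y = - (energy X Y - linear_part H \<nu> X Y) + (- ?S + - ?T)"
    using sum_step_vacancy[OF eventually_zero, of H \<nu>] by linarith
  moreover have powi_add: "q powi (a + (b + c)) = q powi a * (q powi b * q powi c)" for a b c
    using q by (simp add: power_int_add)
  ultimately have e: "q powi energy X Y = inverse q powi (energy X Y - linear_part H \<nu> X Y)
     * (q powi (- ?S) * q powi (- ?T))"
    using powi_add[of "- (energy X Y - linear_part H \<nu> X Y)" "- ?S" "- ?T"]
    by (simp only: power_int_inverse power_int_minus)
  have e1: "qfac_prod (inverse q) (\<lambda>i. vac_offset H \<nu> 1 i + vac1 X Y i) X
     = q powi (- ?S) * qfac_prod q (\<lambda>i. vac_offset H \<nu> 1 i + vac1 X Y i) X"
    using q nonneg(1) vac by (rule qfac_prod_inverse)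
  have e2: "qfac_prod (inverse q) (\<lambda>i. vac_offset H \<nu> 2 i + vac2 X Y i) Y
     = q powi (- ?T) * qfac_prod q (\<lambda>i. vac_offset H \<nu> 2 i + vac2 X Y i) Y"
    using q nonneg(2) vac' by (rule qfac_prod_inverse)
  show "inverse q powi (energy X Y - linear_part H \<nu> X Y)
       * (qfac_prod (inverse q) (\<lambda>i. vac_offset H \<nu> 1 i + vac1 X Y i) X
       * qfac_prod (inverse q) (\<lambda>i. vac_offset H \<nu> 2 i + vac2 X Y i) Y)
     = q powi energy X Y
       * (qfac_prod q (\<lambda>i. vac_offset H \<nu> 1 i + vac1 X Y i) X
       * qfac_prod q (\<lambda>i. vac_offset H \<nu> 2 i + vac2 X Y i) Y)"
    unfolding e e1 e2
    by (simp only: mult_ac)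
qed

section \<open>Deviations from the minimal point\<close>

text \<open>For l = 0 this set, like \<open>short_bulk\<close>, contains position 0, which carries
  no entry and cannot grow with L. Later statements exempt it by i > 0 and use that the vacancy
  number there is 0.\<close>

definition long_bulk :: "nat \<Rightarrow> nat set" where
  "long_bulk l = {l, Suc l}"

definition short_bulk :: "nat \<Rightarrow> nat \<Rightarrow> nat set" where
  "short_bulk l s0 = {3 * l, 3 * l + s0, 3 * l + 3}"

text \<open>
  The tails of m - m_min for large L: entries at bulk positions may be negative.
\<close>

definition deviations :: "nat \<Rightarrow> nat \<Rightarrow> real \<times> real \<Rightarrow> ((nat \<Rightarrow> int) \<times> (nat \<Rightarrow> int)) set" where
  "deviations l s0 wt = {(X, Y). eventually_zero X \<and> eventually_zero Y \<and>
     (\<forall>i. i \<notin> long_bulk l \<longrightarrow> step X i \<ge> 0) \<and> (\<forall>i. i \<notin> short_bulk l s0 \<longrightarrow> step Y i \<ge> 0) \<and>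
     (\<forall>i. vac1 X Y i \<ge> 0) \<and> (\<forall>i. vac2 X Y i \<ge> 0) \<and> vac_limit X Y (fst wt) (snd wt)}"

section \<open>Positive definiteness, and finiteness below a given energy\<close>

lemma block_energy_squares:
  "4 * block_energy X Y k = (X k)\<^sup>2 + (2 * Y (3*k) - X k)\<^sup>2 + (2 * Y (3*k+1) - X k)\<^sup>2 + (2 * Y (3*k+2) - X k)\<^sup>2"
  by (simp add: block_energy_def power2_eq_square algebra_simps)

lemma abs_le_square: "\<bar>x\<bar> \<le> x\<^sup>2" for x :: int
proof (cases "x = 0")
  case False
  then have "\<bar>x\<bar> * 1 \<le> \<bar>x\<bar> * \<bar>x\<bar>" by (intro mult_left_mono) auto
  then show ?thesis by (simp add: power2_eq_square abs_mult_self_eq)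
qed simp

text \<open>An integer is at most its square in absolute value, so two of the four squares bound
  \<bar>X k\<bar> + \<bar>2 * Y j - X k\<bar>, which in turn is at least 2 * \<bar>Y
  j\<bar>.\<close>

lemma block_energy_bounds:
  fixes X Y :: "nat \<Rightarrow> int"
  shows "\<bar>X k\<bar> \<le> 4 * block_energy X Y k" "j div 3 = k \<Longrightarrow> \<bar>Y j\<bar> \<le> 4 * block_energy X Y k"
proof -
  have sq: "(X k)\<^sup>2 + (2 * Y j - X k)\<^sup>2 \<le> 4 * block_energy X Y k" if "j \<in> {3*k, 3*k+1, 3*k+2}" for j
    using that unfolding block_energy_squares by auto
  show "\<bar>X k\<bar> \<le> 4 * block_energy X Y k"
    using sq[of "3*k"] abs_le_square[of "X k"] zero_le_power2[of "2 * Y (3*k) - X k"]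
    unfolding insert_iff by linarith
  assume "j div 3 = k"
  then have "j \<in> {3*k, 3*k+1, 3*k+2}" by auto
  then have "(X k)\<^sup>2 + (2 * Y j - X k)\<^sup>2 \<le> 4 * block_energy X Y k" by (rule sq)
  then show "\<bar>Y j\<bar> \<le> 4 * block_energy X Y k"
    using abs_le_square[of "X k"] abs_le_square[of "2 * Y j - X k"] by linarith
qed

lemma block_energy_nonneg: "block_energy X Y k \<ge> 0" for X Y :: "nat \<Rightarrow> int"
  using block_energy_bounds(1)[of X k Y] by linarith

lemma sum_block_energy_le_energy:
  assumes "eventually_zero X" "eventually_zero Y" "finite A"
  shows "(\<Sum>k\<in>A. block_energy X Y k) \<le> energy X Y"
proof -
  obtain N where N: "\<And>k. k \<ge> N \<Longrightarrow> X k = 0" "\<And>k. k \<ge> N \<Longrightarrow> Y k = 0"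
    using eventually_zero_bound[OF assms(1,2)] by blast
  obtain M where M: "\<forall>k\<in>A. k < M"
    using assms(3) finite_nat_set_iff_bounded by blast
  have "energy X Y = (\<Sum>k<max M N. block_energy X Y k)"
    using N by (intro energy_eq) auto
  moreover have "(\<Sum>k\<in>A. block_energy X Y k) \<le> (\<Sum>k<max M N. block_energy X Y k)"
    using M by (intro sum_mono2) (auto simp: block_energy_nonneg)
  ultimately show ?thesis by simp
qed

lemma energy_nonneg: "eventually_zero X \<Longrightarrow> eventually_zero Y \<Longrightarrow> energy X Y \<ge> 0"
  using sum_block_energy_le_energy[of X Y "{}"] by simp

lemma eventually_zero_antitone:
  assumes "eventually_zero X" "\<And>k. k \<ge> a \<Longrightarrow> step X (Suc k) \<ge> 0" "a \<le> k"
  shows "X k \<ge> 0" "k \<le> k' \<Longrightarrow> X k' \<le> X k"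
proof -
  have anti: "k \<le> k' \<Longrightarrow> X k' \<le> X k" for k'
  proof (induction k' rule: dec_induct)
    case (step n)
    then show ?case using assms(2)[of n] assms(3) by simp
  qed simp
  obtain N where "\<And>k. k \<ge> N \<Longrightarrow> X k = 0"
    using eventually_zero_bound[OF assms(1,1)] by blast
  then show "X k \<ge> 0" using anti[of "max k N"] by simp
  show "k \<le> k' \<Longrightarrow> X k' \<le> X k" by (rule anti)
qed

text \<open>
  Beyond the bulk the tails decrease to 0, so a far non-zero tail forces many non-zero blocks, each
  of energy at least 1.
\<close>

lemma energy_bounds_support:
  assumes "eventually_zero X" "eventually_zero Y" "energy X Y \<le> int c" "k \<ge> a + c"
    and "\<And>k'. a \<le> k' \<Longrightarrow> k' \<le> k \<Longrightarrow> X k' \<noteq> 0 \<or> Y (3 * k') \<noteq> 0"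
  shows False
proof -
  have "block_energy X Y k' \<ge> 1" if "k' \<in> {a..k}" for k'
    using that assms(5)[of k'] block_energy_bounds(1)[of X k' Y] block_energy_bounds(2)[of "3*k'" k' Y X] by force
  then have "(\<Sum>k'\<in>{a..k}. 1) \<le> (\<Sum>k'\<in>{a..k}. block_energy X Y k')" by (intro sum_mono)
  also have "\<dots> \<le> int c"
    using sum_block_energy_le_energy[OF assms(1,2), of "{a..k}"] assms(3) by simp
  finally show False using assms(4) by simp
qed

text \<open>The energy bounds all values of the tails, and monotonicity to the right of the bulk
  bounds their support. To the left no sign or monotonicity is needed, since only finitely many
  positions lie there.\<close>

lemma finite_deviations_energy:
  assumes "s0 \<le> 2"
  shows "finite {(X, Y) \<in> deviations l s0 wt. energy X Y \<le> int c}"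
proof -
  define B where "B = 4 * int c"
  \<comment> \<open>The tails decrease from block \<open>Suc l\<close> on, and energy at most c
    leaves room for at most c non-zero blocks after that.\<close>
  define K where "K = Suc l + c"
  define Fs where "Fs N = {f. \<forall>x. (x \<in> {..<N} \<longrightarrow> f x \<in> {-B..B}) \<and> (x \<notin> {..<N} \<longrightarrow> f x = (0::int))}" for N :: nat
  have "finite (Fs N)" for N
    unfolding Fs_def by (rule finite_set_of_finite_funs) auto
  then have "finite (Fs K \<times> Fs (3 * K))" by blast
  moreover have "{(X, Y) \<in> deviations l s0 wt. energy X Y \<le> int c} \<subseteq> Fs K \<times> Fs (3 * K)"
  proof clarify
    fix X Y assume XY: "(X, Y) \<in> deviations l s0 wt" and e: "energy X Y \<le> int c"
    have eventually_zero: "eventually_zero X" "eventually_zero Y" using XY by (auto simp: deviations_def)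
    have stepX: "step X (Suc k) \<ge> 0" if "k \<ge> Suc l" for k
    proof -
      have "Suc k \<notin> long_bulk l" using that by (auto simp: long_bulk_def)
      then show ?thesis using XY unfolding deviations_def by blast
    qed
    have stepY: "step Y (Suc k) \<ge> 0" if "k \<ge> 3 * Suc l" for k
    proof -
      have "Suc k \<notin> short_bulk l s0" using that assms by (auto simp: short_bulk_def)
      then show ?thesis using XY unfolding deviations_def by blast
    qed
    have "block_energy X Y k \<le> int c" for k
      using sum_block_energy_le_energy[OF eventually_zero, of "{k}"] e by simp
    then have bound: "\<bar>X k\<bar> \<le> B" "\<bar>Y k\<bar> \<le> B" for k
      unfolding B_def using block_energy_bounds(1)[of X k Y] block_energy_bounds(2)[of k "k div 3" Y X]
      by (meson mult_left_mono order_trans zero_le_numeral)+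
    have X0: "X k = 0" if "k \<ge> K" for k
    proof (rule ccontr)
      assume "X k \<noteq> 0"
      moreover have "X k \<ge> 0"
        using that by (intro eventually_zero_antitone(1)[OF eventually_zero(1) stepX]) (auto simp: K_def)
      ultimately have "X k > 0" by simp
      have "X k' \<noteq> 0" if "Suc l \<le> k'" "k' \<le> k" for k'
        using eventually_zero_antitone(2)[OF eventually_zero(1) stepX that] \<open>X k > 0\<close> by simp
      then show False
        using energy_bounds_support[OF eventually_zero e, of "Suc l" k] \<open>k \<ge> K\<close> by (simp add: K_def)
    qed
    have Y0: "Y j = 0" if "j \<ge> 3 * K" for j
    proof (rule ccontr)
      assume "Y j \<noteq> 0"
      moreover have "Y j \<ge> 0"
        using that by (intro eventually_zero_antitone(1)[OF eventually_zero(2) stepY]) (auto simp: K_def)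
      ultimately have "Y j > 0" by simp
      have "Y (3 * k') \<noteq> 0" if "Suc l \<le> k'" "k' \<le> j div 3" for k'
        using eventually_zero_antitone(2)[OF eventually_zero(2) stepY, of "3 * Suc l" "3*k'" j] that \<open>Y j > 0\<close>
        by (simp add: less_eq_div_iff_mult_less_eq mult.commute)
      moreover have "j div 3 \<ge> Suc l + c" using that by (simp add: K_def)
      ultimately show False
        using energy_bounds_support[OF eventually_zero e, of "Suc l" "j div 3"] by blast
    qed
    have "X \<in> Fs K"
      unfolding Fs_def using X0 bound(1) by (auto simp: abs_le_iff minus_le_iff not_less)
    moreover have "Y \<in> Fs (3 * K)"
      unfolding Fs_def using Y0 bound(2) by (auto simp: abs_le_iff minus_le_iff not_less)
    ultimately show "X \<in> Fs K \<and> Y \<in> Fs (3 * K)" by simp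
  qed
  ultimately show ?thesis by (rule rev_finite_subset)
qed

section \<open>The limit\<close>

text \<open>Besides agreement up to q^c, both series have to be power series: without this,
  multiplication would not preserve the agreement. In particular \<open>fls_agree c f f\<close>
  expresses that f has no negative powers.\<close>

definition fls_agree :: "nat \<Rightarrow> 'a::field fls \<Rightarrow> 'a fls \<Rightarrow> bool" where
  "fls_agree c f g \<longleftrightarrow>
     (\<exists>F G. f = fps_to_fls F \<and> g = fps_to_fls G \<and> (\<forall>i\<le>c. fps_nth F i = fps_nth G i))"

lemma fls_agree_fps: "fls_agree c (fps_to_fls F) (fps_to_fls F)"
  unfolding fls_agree_def by blast

lemma fls_agree_1: "fls_agree c 1 1"
  using fls_agree_fps[of c 1] by simp

lemma fls_agree_mult:
  assumes "fls_agree c f g" "fls_agree c f' g'"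
  shows "fls_agree c (f * f') (g * g')"
proof -
  obtain F G F' G' where eqs: "f = fps_to_fls F" "g = fps_to_fls G" "f' = fps_to_fls F'" "g' = fps_to_fls G'"
    and co: "\<forall>i\<le>c. fps_nth F i = fps_nth G i" "\<forall>i\<le>c. fps_nth F' i = fps_nth G' i"
    using assms unfolding fls_agree_def by blast
  have "fps_nth (F * F') i = fps_nth (G * G') i" if "i \<le> c" for i
    unfolding fps_mult_nth using co that by (intro sum.cong) auto
  then show ?thesis
    unfolding fls_agree_def eqs fls_times_fps_to_fls[symmetric] by blast
qed

lemma fls_agree_prod:
  assumes "\<And>i. i \<in> A \<Longrightarrow> fls_agree c (f i) (g i)"
  shows "fls_agree c (\<Prod>i\<in>A. f i) (\<Prod>i\<in>A. g i)"
  using assms by (induction A rule: infinite_finite_induct) (auto intro: fls_agree_1 fls_agree_mult)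

lemma fls_agree_nth:
  assumes "fls_agree c f g" "n \<le> int c"
  shows "fls_nth f n = fls_nth g n"
  using assms unfolding fls_agree_def by auto

lemma fls_agree_neg:
  assumes "fls_agree c f g" "n < 0"
  shows "fls_nth f n = 0"
  using assms unfolding fls_agree_def by auto

lemma fls_agree_X_powi: "e \<ge> 0 \<Longrightarrow> fls_agree c (fls_X powi e) (fls_X powi e)"
proof -
  assume "e \<ge> 0"
  then have "(fls_X :: 'a fls) powi e = fps_to_fls (fps_X ^ nat e)"
    by (simp add: power_int_def fps_to_fls_power del: fls_X_power_int)
  then show ?thesis by (metis fls_agree_fps)
qed

text \<open>The constant term is 1, so the inverse is again a power series.\<close>

lemma fls_agree_qpoch:
  "fls_agree c (qpoch (fls_X :: 'a::field fls) k) (qpoch fls_X k)"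
  "fls_agree c (inverse (qpoch (fls_X :: 'a::field fls) k)) (inverse (qpoch fls_X k))"
  "qpoch (fls_X :: 'a::field fls) k \<noteq> 0"
proof -
  define P :: "'a fps" where "P = (\<Prod>i=1..k. (1 - fps_X ^ i))"
  have P0: "fps_nth P 0 = 1"
  proof -
    have "fps_nth (\<Prod>i\<in>A. (1 - fps_X ^ i :: 'a fps)) 0 = 1" if "finite A" "0 \<notin> A" for A :: "nat set"
      using that by (induction A) (auto simp: fps_mult_nth_0)
    then show ?thesis unfolding P_def by simp
  qed
  have eq: "qpoch fls_X k = fps_to_fls P"
  proof -
    have "fps_to_fls (\<Prod>i\<in>A. (1 - fps_X ^ i :: 'a fps)) = (\<Prod>i\<in>A. (1 - fls_X ^ i))" for A :: "nat set"
      by (induction A rule: infinite_finite_induct)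
         (simp_all add: fls_times_fps_to_fls fps_to_fls_power)
    then show ?thesis by (simp add: P_def qpoch_def)
  qed
  have inv: "inverse (fps_to_fls P) = fps_to_fls (inverse P)"
    using P0 by (intro fls_inverse_fps_to_fls) (metis one_neq_zero subdegree_eq_0)
  show "fls_agree c (qpoch (fls_X :: 'a fls) k) (qpoch fls_X k)"
    unfolding eq by (rule fls_agree_fps)
  show "fls_agree c (inverse (qpoch (fls_X :: 'a fls) k)) (inverse (qpoch fls_X k))"
    unfolding eq inv by (rule fls_agree_fps)
  show "qpoch (fls_X :: 'a fls) k \<noteq> 0"
    unfolding eq using P0 by auto
qed

lemma qfac_fls:
  assumes "p \<ge> 0" "n \<ge> 0"
  shows "qfac fls_X p n = qpoch fls_X (nat (p + n)) * (inverse (qpoch fls_X (nat p)) * inverse (qpoch fls_X (nat n)))"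
  using assms by (simp add: qfac_eq field_simps fls_agree_qpoch(3))

lemma fls_agree_qfac:
  assumes "p \<ge> 0" "n \<ge> 0"
  shows "fls_agree c (qfac fls_X p n) (qfac fls_X p n)"
  unfolding qfac_fls[OF assms] by (intro fls_agree_mult fls_agree_qpoch)

lemma fls_agree_one_minus_X:
  assumes "i > c"
  shows "fls_agree c (1 - fls_X ^ i) 1"
proof -
  have "(1 :: 'a fls) - fls_X ^ i = fps_to_fls (1 - fps_X ^ i)"
    by (simp add: fps_to_fls_power)
  moreover have "(1 :: 'a fls) = fps_to_fls 1" by simp
  moreover have "\<forall>j\<le>c. fps_nth (1 - fps_X ^ i) j = fps_nth (1 :: 'a fps) j"
    using assms by (simp add: fps_X_power_nth)
  ultimately show ?thesis unfolding fls_agree_def by blast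
qed

lemma qpoch_add: "qpoch q (m + n) = qpoch q m * (\<Prod>i=Suc m..m + n. 1 - q ^ i)"
proof -
  have "{1..m + n} = {1..m} \<union> {Suc m..m + n}" by auto
  then show ?thesis unfolding qpoch_def by (simp add: prod.union_disjoint)
qed

text \<open>Cancelling (q)_n leaves the factors 1 - q^i with n < i \<le> n + p over (q)_p, and each
  of these factors is 1 up to q^c.\<close>

lemma fls_agree_qfac_limit:
  assumes "p \<ge> 0" "n > int c"
  shows "fls_agree c (qfac fls_X p n) (inverse (qpoch fls_X (nat p)))"
proof -
  define R :: "'a fls" where "R = (\<Prod>i=Suc (nat n)..nat n + nat p. 1 - fls_X ^ i)"
  have "qpoch fls_X (nat (p + n)) = qpoch fls_X (nat n) * R"
    using assms qpoch_add[of fls_X "nat n" "nat p"] by (simp add: R_def nat_add_distrib add.commute)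
  then have "qfac fls_X p n = R * inverse (qpoch fls_X (nat p))"
    using assms by (simp add: qfac_eq field_simps fls_agree_qpoch(3))
  moreover have "fls_agree c R (\<Prod>i=Suc (nat n)..nat n + nat p. 1)"
    unfolding R_def by (intro fls_agree_prod fls_agree_one_minus_X) (use assms in auto)
  ultimately show ?thesis
    using fls_agree_mult[OF _ fls_agree_qpoch(2)[of c "nat p"], of R 1] by simp
qed

section \<open>Limits of the products of q-binomials\<close>

definition limit_factor :: "'a::field \<Rightarrow> nat set \<Rightarrow> (nat \<Rightarrow> int) \<Rightarrow> (nat \<Rightarrow> int) \<Rightarrow> nat \<Rightarrow> 'a" where
  "limit_factor q B p X i =
     (if i \<in> B then inverse (qpoch q (nat (p i))) else qfac q (p i) (step X i))"

definition limit_prod :: "'a::field \<Rightarrow> nat set \<Rightarrow> (nat \<Rightarrow> int) \<Rightarrow> (nat \<Rightarrow> int) \<Rightarrow> 'a" where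
  "limit_prod q B p X = Prod_any (limit_factor q B p X)"

lemma limit_prod_eq:
  assumes "\<And>k. qpoch q k \<noteq> 0" "\<And>i. p i \<ge> 0" "finite A" "B \<subseteq> A" "{i. step X i \<noteq> 0} \<subseteq> A"
  shows "limit_prod q B p X = (\<Prod>i\<in>A. limit_factor q B p X i)"
  unfolding limit_prod_def
proof (rule Prod_any.expand_superset[OF assms(3)])
  show "{i. limit_factor q B p X i \<noteq> 1} \<subseteq> A"
    using assms(4,5) qfac_0_right[OF assms(2,1)] by (auto simp: limit_factor_def split: if_splits)
qed

lemma qfac_prod_eq:
  assumes "\<And>k. qpoch q k \<noteq> 0" "\<And>i. i \<in> A \<Longrightarrow> p i \<ge> 0" "finite A" "{i. step X i \<noteq> 0} \<subseteq> A"
  shows "qfac_prod q p X = (\<Prod>i\<in>A. qfac q (p i) (step X i))"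
  unfolding qfac_prod_def using assms by (intro prod.mono_neutral_left) (auto intro: qfac_0_right)

lemma finite_step_nonzero: "eventually_zero X \<Longrightarrow> finite {i. step X i \<noteq> 0}"
  using eventually_zero_bound[of X X] finite_step_support by metis

text \<open>The condition \<open>p 0 = 0\<close> takes care of a bulk set that contains 0: the entry
  there does not grow, but the factor is 1 before and after the limit.\<close>

lemma fls_agree_qfac_prod:
  assumes "eventually_zero X" "eventually_zero X'" "finite B" "\<And>i. p i \<ge> 0" "p 0 = 0"
    and "\<And>i. step X' i \<ge> 0" "\<And>i. i \<notin> B \<Longrightarrow> step X' i = step X i"
    and "\<And>i. i \<in> B \<Longrightarrow> i > 0 \<Longrightarrow> step X' i > int c"
  shows "fls_agree c (qfac_prod fls_X p X') (limit_prod fls_X B p X)"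
proof -
  define A where "A = {i. step X i \<noteq> 0} \<union> {i. step X' i \<noteq> 0} \<union> B"
  have A: "finite A" "B \<subseteq> A" "{i. step X i \<noteq> 0} \<subseteq> A" "{i. step X' i \<noteq> 0} \<subseteq> A"
    using assms(1-3) by (auto simp: A_def finite_step_nonzero)
  have "fls_agree c (qfac fls_X (p i) (step X' i)) (limit_factor fls_X B p X i)" for i
  proof (cases "i \<in> B")
    case True
    show ?thesis
    proof (cases "i = 0")
      case True
      have "qfac fls_X (p i) (step X' i) = limit_factor fls_X B p X i"
        using True \<open>i \<in> B\<close> assms(5) by (simp add: limit_factor_def qfac_def qbinom_def) (simp add: qpoch_def)
      then show ?thesis using fls_agree_qfac[OF assms(4,6)] by metis
    next
      case False
      then show ?thesis
        using \<open>i \<in> B\<close> assms(4,8) by (simp add: limit_factor_def fls_agree_qfac_limit)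
    qed
  next
    case False
    then show ?thesis
      using fls_agree_qfac[OF assms(4,6)] assms(7) by (metis limit_factor_def)
  qed
  then show ?thesis
    unfolding limit_prod_eq[OF fls_agree_qpoch(3) assms(4) A(1,2,3)]
      qfac_prod_eq[OF fls_agree_qpoch(3) assms(4) A(1,4)]
    by (intro fls_agree_prod)
qed

definition limit_term :: "nat \<Rightarrow> nat \<Rightarrow> 'a::field \<Rightarrow> (nat \<Rightarrow> int) \<times> (nat \<Rightarrow> int) \<Rightarrow> 'a" where
  "limit_term l s0 q = (\<lambda>(X, Y). q powi energy X Y
     * (limit_prod q (long_bulk l) (vac1 X Y) X * limit_prod q (short_bulk l s0) (vac2 X Y) Y))"

lemma fls_nth_X_powi_mult_small:
  assumes "fls_agree c g g'" "n < e"
  shows "fls_nth (fls_X powi e * g) n = 0"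
proof -
  have "fls_nth (fls_X powi e * g) n = fls_nth g (n - e)"
    using fls_X_intpow_times_conv_shift(1)[of e g] by simp
  then show ?thesis using fls_agree_neg[OF assms(1)] assms(2) by simp
qed

text \<open>
  The tails of m_min for L = 2 k; they depend on s0 only in block l.
\<close>

definition bulk1 :: "nat \<Rightarrow> nat \<Rightarrow> nat \<Rightarrow> nat \<Rightarrow> int" where
  "bulk1 l s0 k i = int (if i < l then 6 * k else if i = l then 2 * k * s0 else 0)"

definition bulk2 :: "nat \<Rightarrow> nat \<Rightarrow> nat \<Rightarrow> nat \<Rightarrow> int" where
  "bulk2 l s0 k j = int (if j < 3 * l then 4 * k else if j < 3 * l + s0 then k * (s0 + 1)
     else if j < 3 * l + 3 then k * s0 else 0)"

lemma finite_tail_configs: "H \<subseteq> H_all \<Longrightarrow> finite (tail_configs H \<nu> wt)"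
  using bij_betw_conf finite_configs bij_betw_finite by blast

lemma step_add: "step (\<lambda>i. f i + g i) i = step f i + step g i"
  by (simp add: step_def)

text \<open>The double negation is the shape in which membership in \<open>H_all\<close> appears
  after \<open>tail_configs\<close> is unfolded. Outside B the step of f vanishes, so there
  non-negativity of the sum is a condition on g alone.\<close>

lemma step_nonneg_split:
  fixes f g :: "nat \<Rightarrow> int"
  assumes "\<And>i. i \<notin> B \<Longrightarrow> step f i = 0"
  shows "(\<forall>i. step f i + step g i \<ge> 0 \<and> (\<not> i \<noteq> 0 \<longrightarrow> step f i + step g i = 0))
     \<longleftrightarrow> (\<forall>i. i \<notin> B \<longrightarrow> step g i \<ge> 0) \<and> (\<forall>i. step f i + step g i \<ge> 0)"
proof (intro iffI conjI allI impI)
  fix i assume "\<forall>i. step f i + step g i \<ge> 0 \<and> (\<not> i \<noteq> 0 \<longrightarrow> step f i + step g i = 0)"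
  then have *: "step f i + step g i \<ge> 0" by blast
  then show "step f i + step g i \<ge> 0" .
  assume "i \<notin> B"
  then show "step g i \<ge> 0" using * assms by simp
qed simp_all

lemma eventually_zero_add:
  assumes "eventually_zero f"
  shows "eventually_zero (\<lambda>i. f i + g i) \<longleftrightarrow> eventually_zero g"
proof -
  have "\<forall>\<^sub>F k in sequentially. (f k + g k = 0) = (g k = 0)"
    using assms unfolding eventually_zero_def by (auto elim: eventually_mono)
  then show ?thesis unfolding eventually_zero_def by (rule eventually_subst)
qed

lemma vac_0: "vac1 X Y 0 = 0" "vac2 X Y 0 = 0"
  by (simp_all add: vac1_def vac2_def)

lemma vac1_add: "vac1 (\<lambda>i. f i + x i) (\<lambda>i. g i + y i) i = vac1 f g i + vac1 x y i"
  by (simp add: vac1_def sum.distrib[symmetric] algebra_simps)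

lemma vac2_add: "vac2 (\<lambda>i. f i + x i) (\<lambda>i. g i + y i) i = vac2 f g i + vac2 x y i"
  by (simp add: vac2_def sum.distrib[symmetric] algebra_simps)

section \<open>Expansion about the minimal point, for L = 2 k\<close>

context
  fixes l s0 k s :: nat and X0 Y0 :: "nat \<Rightarrow> int"
  assumes s0: "s0 = 1 \<or> s0 = 2"
  defines "s \<equiv> 3 * l + s0"
  defines "X0 \<equiv> bulk1 l s0 k" and "Y0 \<equiv> bulk2 l s0 k"
begin

text \<open>Stationarity of the minimal point in the direction of node 1: every block contributes 0
  to the vacancy numbers of that node.\<close>

lemma bulk_balance1: "Y0 (3 * i) + Y0 (3 * i + 1) + Y0 (3 * i + 2) = 2 * X0 i"
proof -
  consider "i < l" | "i = l" | "i > l" "3 * i \<ge> 3 * l + 3" by linarith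
  then show ?thesis
    using s0 by cases (auto simp: X0_def Y0_def bulk1_def bulk2_def)
qed

text \<open>Stationarity in the direction of node 2: the increment - 2 k = - L at each j < s is what
  the contribution L * min j s of W compensates.\<close>

lemma bulk_balance2: "X0 (j div 3) - 2 * Y0 j = (if j < s then - 2 * int k else 0)"
proof -
  consider "j < 3 * l" "j div 3 < l" | "j \<ge> 3 * l + 3" "j div 3 > l"
    | "j = 3 * l" | "j = 3 * l + 1" | "j = 3 * l + 2"
    by linarith
  then show ?thesis
    using s0 by cases (auto simp: X0_def Y0_def bulk1_def bulk2_def s_def)
qed

lemma eventually_zero_bulk: "eventually_zero X0" "eventually_zero Y0"
  by (rule eventually_zeroI[of "3 * l + 3"]; use s0 in \<open>auto simp: X0_def Y0_def bulk1_def bulk2_def\<close>)+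

lemma vac1_bulk: "vac1 X0 Y0 i = 0"
  unfolding vac1_def bulk_balance1 by simp

lemma vac2_bulk: "vac2 X0 Y0 i = - 2 * int k * int (min i s)"
  unfolding vac2_def bulk_balance2
  by (induction i) (auto simp: min_def algebra_simps not_le less_Suc_eq_le)

text \<open>The cross terms of the quadratic form are computed by the two balance equations: those
  with x vanish, and those with y form the linear part of c evaluated at the deviation.\<close>

lemma energy_bulk_add:
  assumes "eventually_zero x" "eventually_zero y"
  shows "energy (\<lambda>i. X0 i + x i) (\<lambda>i. Y0 i + y i) - 2 * int k * (\<Sum>j<s. Y0 j + y j)
    = (energy X0 Y0 - 2 * int k * (\<Sum>j<s. Y0 j)) + energy x y"
proof -
  obtain N1 where N1: "\<And>k. k \<ge> N1 \<Longrightarrow> x k = 0" "\<And>k. k \<ge> N1 \<Longrightarrow> y k = 0"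
    using eventually_zero_bound[OF assms] by blast
  obtain N2 where N2: "\<And>k. k \<ge> N2 \<Longrightarrow> X0 k = 0" "\<And>k. k \<ge> N2 \<Longrightarrow> Y0 k = 0"
    using eventually_zero_bound[OF eventually_zero_bulk] by blast
  define N where "N = N1 + N2 + s"
  have e: "energy (\<lambda>i. X0 i + x i) (\<lambda>i. Y0 i + y i) = (\<Sum>i<N. block_energy (\<lambda>i. X0 i + x i) (\<lambda>i. Y0 i + y i) i)"
    "energy x y = (\<Sum>i<N. block_energy x y i)" "energy X0 Y0 = (\<Sum>i<N. block_energy X0 Y0 i)"
    using N1 N2 by (intro energy_eq; simp add: N_def)+
  have "block_energy (\<lambda>i. X0 i + x i) (\<lambda>i. Y0 i + y i) i = block_energy X0 Y0 i + block_energy x y i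
      - ((X0 i - 2 * Y0 (3*i)) * y (3*i) + (X0 i - 2 * Y0 (3*i+1)) * y (3*i+1) + (X0 i - 2 * Y0 (3*i+2)) * y (3*i+2))" for i
  proof -
    have "block_energy (\<lambda>i. X0 i + x i) (\<lambda>i. Y0 i + y i) i = block_energy X0 Y0 i + block_energy x y i
      - ((X0 i - 2 * Y0 (3*i)) * y (3*i) + (X0 i - 2 * Y0 (3*i+1)) * y (3*i+1) + (X0 i - 2 * Y0 (3*i+2)) * y (3*i+2))
      + x i * (2 * X0 i - (Y0 (3 * i) + Y0 (3 * i + 1) + Y0 (3 * i + 2)))"
      unfolding block_energy_def by (simp add: power2_eq_square algebra_simps)
    then show ?thesis unfolding bulk_balance1 by simp
  qed
  then have "energy (\<lambda>i. X0 i + x i) (\<lambda>i. Y0 i + y i) = energy X0 Y0 + energy x y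
      - (\<Sum>i<N. (X0 i - 2 * Y0 (3*i)) * y (3*i) + (X0 i - 2 * Y0 (3*i+1)) * y (3*i+1) + (X0 i - 2 * Y0 (3*i+2)) * y (3*i+2))"
    unfolding e by (simp add: sum.distrib sum_subtractf)
  also have "(\<Sum>i<N. (X0 i - 2 * Y0 (3*i)) * y (3*i) + (X0 i - 2 * Y0 (3*i+1)) * y (3*i+1) + (X0 i - 2 * Y0 (3*i+2)) * y (3*i+2))
     = (\<Sum>j<3*N. (X0 (j div 3) - 2 * Y0 j) * y j)"
    unfolding sum_lessThan_mult3 by (simp add: div_3)
  also have "\<dots> = (\<Sum>j<s. - 2 * int k * y j)"
    unfolding bulk_balance2 by (rule sum.mono_neutral_cong_right) (auto simp: N_def)
  also have "\<dots> = - 2 * int k * (\<Sum>j<s. y j)"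
    by (simp add: sum_distrib_left)
  finally show ?thesis
    by (simp add: sum.distrib algebra_simps)
qed

text \<open>The smallest entry of the minimal point at a bulk position is L/2 = k; hence these
  entries outgrow any fixed deviation. The same bound holds for node 2.\<close>

lemma step_bulk1:
  "i \<notin> long_bulk l \<Longrightarrow> step X0 i = 0"
  "i \<in> long_bulk l \<Longrightarrow> i > 0 \<Longrightarrow> step X0 i \<ge> int k"
  using s0 by (cases i; auto simp: X0_def bulk1_def long_bulk_def)+

lemma step_bulk2:
  "i \<notin> short_bulk l s0 \<Longrightarrow> step Y0 i = 0"
  "i \<in> short_bulk l s0 \<Longrightarrow> i > 0 \<Longrightarrow> step Y0 i \<ge> int k"
  using s0 by (cases i; auto simp: Y0_def bulk2_def short_bulk_def)+

lemma m_min_bulk: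
  "(if (1, j) \<in> H_all then m_min s (2 * k) 1 j else 0) = of_int (step X0 j)"
  "(if (2, j) \<in> H_all then m_min s (2 * k) 2 j else 0) = of_int (step Y0 j)"
proof -
  have "s mod 3 = s0"
    using s0 unfolding s_def by presburger
  moreover have "s0 = 1 \<Longrightarrow> (s - 1) div 3 = l \<and> (s + 2) div 3 = Suc l \<and> s - 1 = 3 * l"
    "s0 = 2 \<Longrightarrow> (s - 2) div 3 = l \<and> (s + 1) div 3 = Suc l \<and> s - 2 = 3 * l"
    unfolding s_def by presburger+
  ultimately have "m_min s (2 * k) 1 j = real (2 * k) *
      (if s0 = 1 then 2 * of_bool (j = l) + of_bool (j = Suc l) else of_bool (j = l) + 2 * of_bool (j = Suc l))"
    "m_min s (2 * k) 2 j = real (2 * k) *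
      (if s0 = 1 then of_bool (j = 3 * l) + 1/2 * of_bool (j = s) + 1/2 * of_bool (j = s + 2)
       else 1/2 * of_bool (j = 3 * l) + 1/2 * of_bool (j = s) + of_bool (j = s + 1))" for j
    unfolding m_min_def using s0 by auto
  note m = this
  have H1: "(1, j) \<in> H_all \<longleftrightarrow> j \<noteq> 0" and H2: "(2, j) \<in> H_all \<longleftrightarrow> j \<noteq> 0"
    by (auto simp: H_all_def)
  show "(if (1, j) \<in> H_all then m_min s (2 * k) 1 j else 0) = of_int (step X0 j)"
    unfolding m H1 using s0 by (cases j; elim disjE) (auto simp: X0_def bulk1_def)
  show "(if (2, j) \<in> H_all then m_min s (2 * k) 2 j else 0) = of_int (step Y0 j)"
    unfolding m H2 using s0 by (cases j; elim disjE) (auto simp: Y0_def bulk2_def s_def)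
qed

lemma supp_W_short: "(\<Sum>j\<in>supp_in H_all (W_short s L) a. f (W_short s L a j) j)
    = (if a = 2 then f L s else 0)" if "f 0 s = 0"
proof -
  have "supp_in H_all (W_short s L) a = (if a = 2 \<and> L \<noteq> 0 then {s} else {})"
    using s0 by (auto simp: supp_in_def W_short_def H_all_def s_def)
  then show ?thesis using that by (simp add: W_short_def)
qed

lemma linear_part_W_short: "linear_part H_all (W_short s L) X Y = int L * (\<Sum>i<s. Y i)"
  unfolding linear_part_def
  using supp_W_short[of "\<lambda>n j. int n * (\<Sum>i<j. X i)" L 1] supp_W_short[of "\<lambda>n j. int n * (\<Sum>i<j. Y i)" L 2]
  by simp

lemma vac_offset_W_short: "vac_offset H_all (W_short s L) a i = (if a = 2 then int L * int (min i s) else 0)"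
  unfolding vac_offset_def using supp_W_short[of "\<lambda>n j. int n * int (min i j)" L a] by simp

lemma weight_total_W_short: "weight_total H_all (W_short s L) a = (if a = 2 then real s * real L else 0)"
  unfolding weight_total_def using supp_W_short[of "\<lambda>n j. real j * real n" L a] by simp

lemma cform_m_min: "cform H_all (W_short s (2 * k)) (m_min s (2 * k))
    = of_int (energy X0 Y0 - 2 * int k * (\<Sum>j<s. Y0 j))"
  using cform_energy[OF eventually_zero_bulk m_min_bulk, of "W_short s (2 * k)"]
  by (simp add: linear_part_W_short)

text \<open>The deviations that are realised at the present k, that is, those that do not push an
  entry at a bulk position below 0.\<close>

definition shifted :: "real \<times> real \<Rightarrow> ((nat \<Rightarrow> int) \<times> (nat \<Rightarrow> int)) set" where
  "shifted wt = {(x, y) \<in> deviations l s0 wt.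
     (\<forall>i. step X0 i + step x i \<ge> 0) \<and> (\<forall>i. step Y0 i + step y i \<ge> 0)}"

lemma shifted_iff:
  "(\<lambda>i. X0 i + x i, \<lambda>i. Y0 i + y i) \<in> tail_configs H_all (W_short s (2 * k)) wt \<longleftrightarrow> (x, y) \<in> shifted wt"
proof -
  have v1: "vac_offset H_all (W_short s (2 * k)) 1 i + vac1 (\<lambda>i. X0 i + x i) (\<lambda>i. Y0 i + y i) i = vac1 x y i" for i
    by (simp add: vac_offset_W_short vac1_add vac1_bulk)
  have v2: "vac_offset H_all (W_short s (2 * k)) 2 i + vac2 (\<lambda>i. X0 i + x i) (\<lambda>i. Y0 i + y i) i = vac2 x y i" for i
    by (simp add: vac_offset_W_short vac2_add vac2_bulk)
  have L: "vac_limit (\<lambda>i. X0 i + x i) (\<lambda>i. Y0 i + y i)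
      (fst wt - weight_total H_all (W_short s (2 * k)) 1) (snd wt - weight_total H_all (W_short s (2 * k)) 2)
    \<longleftrightarrow> vac_limit x y (fst wt) (snd wt)"
    unfolding vac_limit_def
  \<comment> \<open>From n = s on, the bulk contributes - 2 k * s to the vacancy numbers of node 2,
    which is minus the total weight s * L of W.\<close>
  proof (rule eventually_subst, unfold eventually_sequentially, intro exI[of _ s] allI impI)
    fix n assume "s \<le> n"
    then show "(real_of_int (vac1 (\<lambda>i. X0 i + x i) (\<lambda>i. Y0 i + y i) n) = fst wt - weight_total H_all (W_short s (2 * k)) 1 \<and>
       real_of_int (vac2 (\<lambda>i. X0 i + x i) (\<lambda>i. Y0 i + y i) n) = snd wt - weight_total H_all (W_short s (2 * k)) 2)
      = (real_of_int (vac1 x y n) = fst wt \<and> real_of_int (vac2 x y n) = snd wt)"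
      by (auto simp: weight_total_W_short vac1_add vac2_add vac1_bulk vac2_bulk min_absorb2 algebra_simps)
  qed
  have H1: "(1, i) \<in> H_all \<longleftrightarrow> i \<noteq> 0" and H2: "(2, i) \<in> H_all \<longleftrightarrow> i \<noteq> 0" for i
    by (auto simp: H_all_def)
  have V1: "(\<forall>i. i \<noteq> 0 \<longrightarrow> vac1 x y i \<ge> 0) \<longleftrightarrow> (\<forall>i. vac1 x y i \<ge> 0)"
    using vac_0(1) by (metis order_refl)
  have V2: "(\<forall>i. i \<noteq> 0 \<longrightarrow> vac2 x y i \<ge> 0) \<longleftrightarrow> (\<forall>i. vac2 x y i \<ge> 0)"
    using vac_0(2) by (metis order_refl)
  have S1: "(\<forall>i. step X0 i + step x i \<ge> 0 \<and> (\<not> i \<noteq> 0 \<longrightarrow> step X0 i + step x i = 0))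
     \<longleftrightarrow> (\<forall>i. i \<notin> long_bulk l \<longrightarrow> step x i \<ge> 0) \<and> (\<forall>i. step X0 i + step x i \<ge> 0)"
    using step_bulk1(1) by (rule step_nonneg_split)
  have S2: "(\<forall>i. step Y0 i + step y i \<ge> 0 \<and> (\<not> i \<noteq> 0 \<longrightarrow> step Y0 i + step y i = 0))
     \<longleftrightarrow> (\<forall>i. i \<notin> short_bulk l s0 \<longrightarrow> step y i \<ge> 0) \<and> (\<forall>i. step Y0 i + step y i \<ge> 0)"
    using step_bulk2(1) by (rule step_nonneg_split)
  show ?thesis
    unfolding tail_configs_def shifted_def deviations_def mem_Collect_eq prod.case v1 v2
      eventually_zero_add[OF eventually_zero_bulk(1)] eventually_zero_add[OF eventually_zero_bulk(2)] step_add H1 H2 L V1 V2 S1 S2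
    by blast
qed

lemma bij_betw_shift:
  "bij_betw (\<lambda>(x, y). (\<lambda>i. X0 i + x i, \<lambda>i. Y0 i + y i)) (shifted wt)
     (tail_configs H_all (W_short s (2 * k)) wt)"
proof (rule bij_betw_byWitness[where f' = "\<lambda>(x, y). (\<lambda>i. x i - X0 i, \<lambda>i. y i - Y0 i)"])
  show "(\<lambda>(x, y). (\<lambda>i. X0 i + x i, \<lambda>i. Y0 i + y i)) ` shifted wt
      \<subseteq> tail_configs H_all (W_short s (2 * k)) wt"
    by (auto simp: shifted_iff)
  show "(\<lambda>(x, y). (\<lambda>i. x i - X0 i, \<lambda>i. y i - Y0 i)) ` tail_configs H_all (W_short s (2 * k)) wt
      \<subseteq> shifted wt"
  proof clarify
    fix x y assume "(x, y) \<in> tail_configs H_all (W_short s (2 * k)) wt"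
    then show "(\<lambda>i. x i - X0 i, \<lambda>i. y i - Y0 i) \<in> shifted wt"
      using shifted_iff[of "\<lambda>i. x i - X0 i" "\<lambda>i. y i - Y0 i" wt] by simp
  qed
qed auto

lemma finite_shifted: "finite (shifted wt)"
  using bij_betw_finite[OF bij_betw_shift] finite_tail_configs[of H_all] by blast

lemma normalised_M_ferm:
  assumes q: "q \<noteq> 0"
  shows "q powi (- \<lfloor>cform H_all (W_short s (2 * k)) (m_min s (2 * k))\<rfloor>) * M_ferm (W_short s (2 * k)) wt q
    = (\<Sum>(x, y)\<in>shifted wt. q powi energy x y
        * (qfac_prod q (vac1 x y) (\<lambda>i. X0 i + x i) * qfac_prod q (vac2 x y) (\<lambda>i. Y0 i + y i)))"
  unfolding M_ferm_def fermionic_tails[OF order_refl] sum_distrib_left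
    sum.reindex_bij_betw[OF bij_betw_shift, symmetric]
  unfolding cform_m_min floor_of_int
proof (intro sum.cong refl, clarify)
  fix x y assume xy: "(x, y) \<in> shifted wt"
  have v: "(\<lambda>i. vac_offset H_all (W_short s (2 * k)) 1 i + vac1 (\<lambda>i. X0 i + x i) (\<lambda>i. Y0 i + y i) i) = vac1 x y"
    "(\<lambda>i. vac_offset H_all (W_short s (2 * k)) 2 i + vac2 (\<lambda>i. X0 i + x i) (\<lambda>i. Y0 i + y i) i) = vac2 x y"
    by (simp_all add: fun_eq_iff vac_offset_W_short vac1_add vac1_bulk vac2_add vac2_bulk)
  have "eventually_zero x" "eventually_zero y" using xy by (auto simp: shifted_def deviations_def)
  then have "q powi energy x y = q powi (- (energy X0 Y0 - 2 * int k * (\<Sum>j<s. Y0 j))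
      + (energy (\<lambda>i. X0 i + x i) (\<lambda>i. Y0 i + y i) - linear_part H_all (W_short s (2 * k)) (\<lambda>i. X0 i + x i) (\<lambda>i. Y0 i + y i)))"
    using energy_bulk_add[of x y] by (simp add: linear_part_W_short)
  also have "\<dots> = q powi (- (energy X0 Y0 - 2 * int k * (\<Sum>j<s. Y0 j)))
      * q powi (energy (\<lambda>i. X0 i + x i) (\<lambda>i. Y0 i + y i) - linear_part H_all (W_short s (2 * k)) (\<lambda>i. X0 i + x i) (\<lambda>i. Y0 i + y i))"
    using q by (intro power_int_add) simp
  finally show "q powi - (energy X0 Y0 - 2 * int k * (\<Sum>j<s. Y0 j)) *
      (q powi (energy (\<lambda>i. X0 i + x i) (\<lambda>i. Y0 i + y i) - linear_part H_all (W_short s (2 * k)) (\<lambda>i. X0 i + x i) (\<lambda>i. Y0 i + y i)) *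
       (qfac_prod q (\<lambda>i. vac_offset H_all (W_short s (2 * k)) 1 i + vac1 (\<lambda>i. X0 i + x i) (\<lambda>i. Y0 i + y i) i) (\<lambda>i. X0 i + x i) *
        qfac_prod q (\<lambda>i. vac_offset H_all (W_short s (2 * k)) 2 i + vac2 (\<lambda>i. X0 i + x i) (\<lambda>i. Y0 i + y i) i) (\<lambda>i. Y0 i + y i)))
    = q powi energy x y * (qfac_prod q (vac1 x y) (\<lambda>i. X0 i + x i) * qfac_prod q (vac2 x y) (\<lambda>i. Y0 i + y i))"
    unfolding v by (simp only: mult.assoc)
qed

lemma fls_agree_limit_term:
  assumes xy: "(x, y) \<in> deviations l s0 wt"
    and 1: "\<And>i. step X0 i + step x i \<ge> 0" "\<And>i. i \<in> long_bulk l \<Longrightarrow> i > 0 \<Longrightarrow> step X0 i + step x i > int c"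
    and 2: "\<And>i. step Y0 i + step y i \<ge> 0" "\<And>i. i \<in> short_bulk l s0 \<Longrightarrow> i > 0 \<Longrightarrow> step Y0 i + step y i > int c"
  shows "fls_agree c (fls_X powi energy x y
        * (qfac_prod fls_X (vac1 x y) (\<lambda>i. X0 i + x i) * qfac_prod fls_X (vac2 x y) (\<lambda>i. Y0 i + y i)))
     (limit_term l s0 fls_X (x, y))"
  unfolding limit_term_def prod.case
proof (intro fls_agree_mult)
  have eventually_zero: "eventually_zero x" "eventually_zero y" "eventually_zero (\<lambda>i. X0 i + x i)" "eventually_zero (\<lambda>i. Y0 i + y i)"
    using xy by (auto simp: deviations_def eventually_zero_add eventually_zero_bulk)
  then show "fls_agree c (fls_X powi energy x y) (fls_X powi energy x y)"
    by (intro fls_agree_X_powi energy_nonneg)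
  have vac: "vac1 x y i \<ge> 0" "vac2 x y i \<ge> 0" for i
    using xy by (auto simp: deviations_def)
  show "fls_agree c (qfac_prod fls_X (vac1 x y) (\<lambda>i. X0 i + x i)) (limit_prod fls_X (long_bulk l) (vac1 x y) x)"
    using eventually_zero(1,3) _ vac(1) vac_0(1)
    by (rule fls_agree_qfac_prod) (use 1 step_bulk1(1) in \<open>simp_all add: step_add long_bulk_def\<close>)
  show "fls_agree c (qfac_prod fls_X (vac2 x y) (\<lambda>i. Y0 i + y i)) (limit_prod fls_X (short_bulk l s0) (vac2 x y) y)"
    using eventually_zero(2,4) _ vac(2) vac_0(2)
    by (rule fls_agree_qfac_prod) (use 2 step_bulk2(1) in \<open>simp_all add: step_add short_bulk_def\<close>)
qed

lemma normalised_M_ferm_neg: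
  assumes "n < 0"
  shows "fls_nth (fls_X powi (- \<lfloor>cform H_all (W_short s (2 * k)) (m_min s (2 * k))\<rfloor>)
     * M_ferm (W_short s (2 * k)) wt (fls_X :: 'a::field fls)) n = 0"
proof -
  have "fls_nth (fls_X powi energy x y * (qfac_prod fls_X (vac1 x y) (\<lambda>i. X0 i + x i)
      * qfac_prod fls_X (vac2 x y) (\<lambda>i. Y0 i + y i)) :: 'a fls) n = 0" if xy: "(x, y) \<in> shifted wt" for x y
  proof (rule fls_agree_neg[OF _ assms])
    have "fls_agree 0 (qfac_prod fls_X p X) (qfac_prod fls_X p X :: 'a fls)"
      if "\<And>i. p i \<ge> 0" "\<And>i. step X i \<ge> 0" for p X
      unfolding qfac_prod_def by (intro fls_agree_prod fls_agree_qfac that)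
    then show "fls_agree 0 (fls_X powi energy x y * (qfac_prod fls_X (vac1 x y) (\<lambda>i. X0 i + x i)
      * qfac_prod fls_X (vac2 x y) (\<lambda>i. Y0 i + y i)) :: 'a fls) (fls_X powi energy x y * (qfac_prod fls_X (vac1 x y) (\<lambda>i. X0 i + x i)
      * qfac_prod fls_X (vac2 x y) (\<lambda>i. Y0 i + y i)) :: 'a fls)"
      using xy by (intro fls_agree_mult fls_agree_X_powi)
        (auto simp: shifted_def deviations_def energy_nonneg step_add)
  qed
  then show ?thesis
    unfolding normalised_M_ferm[OF fls_X_nonzero] fls_nth_sum
    by (intro sum.neutral ballI) (simp only: case_prod_unfold prod.collapse)
qed

text \<open>The hypotheses say that k is so large that every deviation of energy at most c is
  realised with all bulk entries above c, so that its term already agrees with its limit up to q^c.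
  Deviations of larger energy start beyond q^c.\<close>

lemma normalised_M_ferm_nth:
  assumes 1: "\<And>x y i. (x, y) \<in> deviations l s0 wt \<Longrightarrow> energy x y \<le> int c \<Longrightarrow> i \<in> long_bulk l \<Longrightarrow>
      int k + step x i > int c"
    and 2: "\<And>x y i. (x, y) \<in> deviations l s0 wt \<Longrightarrow> energy x y \<le> int c \<Longrightarrow> i \<in> short_bulk l s0 \<Longrightarrow>
      int k + step y i > int c"
  shows "fls_nth (fls_X powi (- \<lfloor>cform H_all (W_short s (2 * k)) (m_min s (2 * k))\<rfloor>)
      * M_ferm (W_short s (2 * k)) wt (fls_X :: 'a::field fls)) (int c)
    = (\<Sum>z\<in>{(x, y) \<in> deviations l s0 wt. energy x y \<le> int c}. fls_nth (limit_term l s0 fls_X z) (int c))"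
proof -
  define f :: "(nat \<Rightarrow> int) \<times> (nat \<Rightarrow> int) \<Rightarrow> 'a fls" where
    "f = (\<lambda>(x, y). fls_X powi energy x y
        * (qfac_prod fls_X (vac1 x y) (\<lambda>i. X0 i + x i) * qfac_prod fls_X (vac2 x y) (\<lambda>i. Y0 i + y i)))"
  let ?D = "{(x, y) \<in> deviations l s0 wt. energy x y \<le> int c}"
  have bulk1: "step X0 i + step x i > int c" if "(x, y) \<in> ?D" "i \<in> long_bulk l" "i > 0" for x y i
    using 1[of x y i] step_bulk1(2)[of i] that by auto
  have nonneg1: "step X0 i + step x i \<ge> 0" if "(x, y) \<in> ?D" for x y i
  proof (cases "i \<in> long_bulk l")
    case True
    then show ?thesis using bulk1[OF that True] by (cases "i = 0") auto
  next
    case False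
    then show ?thesis using that step_bulk1(1)[OF False] by (auto simp: deviations_def)
  qed
  have bulk2: "step Y0 i + step y i > int c" if "(x, y) \<in> ?D" "i \<in> short_bulk l s0" "i > 0" for x y i
    using 2[of x y i] step_bulk2(2)[of i] that by auto
  have nonneg2: "step Y0 i + step y i \<ge> 0" if "(x, y) \<in> ?D" for x y i
  proof (cases "i \<in> short_bulk l s0")
    case True
    then show ?thesis using bulk2[OF that True] by (cases "i = 0") auto
  next
    case False
    then show ?thesis using that step_bulk2(1)[OF False] by (auto simp: deviations_def)
  qed
  have D: "?D \<subseteq> shifted wt"
    using nonneg1 nonneg2 by (auto simp: shifted_def)
  have "fls_nth (f z) (int c) = 0" if z: "z \<in> shifted wt - ?D" for z
  proof -
    obtain x y where xy: "z = (x, y)" by (cases z)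
    have "fls_agree 0 (qfac_prod fls_X p X) (qfac_prod fls_X p X :: 'a fls)"
      if "\<And>i. p i \<ge> 0" "\<And>i. step X i \<ge> 0" for p X
      unfolding qfac_prod_def by (intro fls_agree_prod fls_agree_qfac that)
    then have "fls_agree 0 (qfac_prod fls_X (vac1 x y) (\<lambda>i. X0 i + x i) * qfac_prod fls_X (vac2 x y) (\<lambda>i. Y0 i + y i) :: 'a fls)
       (qfac_prod fls_X (vac1 x y) (\<lambda>i. X0 i + x i) * qfac_prod fls_X (vac2 x y) (\<lambda>i. Y0 i + y i))"
      using z xy by (intro fls_agree_mult) (auto simp: shifted_def deviations_def step_add)
    then show ?thesis
      unfolding f_def xy prod.case
      by (rule fls_nth_X_powi_mult_small) (use z xy in \<open>auto simp: shifted_def\<close>)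
  qed
  then have "(\<Sum>z\<in>shifted wt. fls_nth (f z) (int c)) = (\<Sum>z\<in>?D. fls_nth (f z) (int c))"
    by (intro sum.mono_neutral_right finite_shifted D) blast
  also have "\<dots> = (\<Sum>z\<in>?D. fls_nth (limit_term l s0 fls_X z) (int c))"
  proof (intro sum.cong refl)
    fix z assume z: "z \<in> ?D"
    obtain x y where xy: "z = (x, y)" by (cases z)
    have "fls_agree c (f z) (limit_term l s0 fls_X z)"
      unfolding f_def xy prod.case
      by (rule fls_agree_limit_term)
        (use z xy in \<open>auto intro: nonneg1[of x y] nonneg2[of x y] bulk1[of x y] bulk2[of x y]\<close>)
    then show "fls_nth (f z) (int c) = fls_nth (limit_term l s0 fls_X z) (int c)"
      by (rule fls_agree_nth) simp
  qed
  finally show ?thesis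
    unfolding normalised_M_ferm[OF fls_X_nonzero] fls_nth_sum
    unfolding f_def case_prod_unfold by simp
qed

end

text \<open>Only finitely many deviations have energy at most c, so their steps at bulk positions
  have a common bound B, and every k > B + c is large enough.\<close>

lemma eventually_normalised_M_ferm_nth:
  assumes "s0 = 1 \<or> s0 = 2"
  shows "\<forall>\<^sub>F k in sequentially. fls_nth (fls_X powi (- \<lfloor>cform H_all (W_short (3 * l + s0) (2 * k)) (m_min (3 * l + s0) (2 * k))\<rfloor>)
      * M_ferm (W_short (3 * l + s0) (2 * k)) wt (fls_X :: 'a::field fls)) (int c)
    = (\<Sum>z\<in>{(x, y) \<in> deviations l s0 wt. energy x y \<le> int c}. fls_nth (limit_term l s0 fls_X z) (int c))"
proof -
  let ?D = "{(x, y) \<in> deviations l s0 wt. energy x y \<le> int c}"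
  define V where "V = (\<lambda>((x, y), i). \<bar>step x i\<bar> + \<bar>step y i\<bar>) ` (?D \<times> (long_bulk l \<union> short_bulk l s0))"
  have "finite V"
    unfolding V_def using assms finite_deviations_energy[of s0 l wt c]
    by (intro finite_imageI finite_cartesian_product) (auto simp: long_bulk_def short_bulk_def)
  define B where "B = Max V"
  have bound: "\<bar>step x i\<bar> + \<bar>step y i\<bar> \<le> B"
    if "(x, y) \<in> ?D" "i \<in> long_bulk l \<union> short_bulk l s0" for x y i
    unfolding B_def
  proof (rule Max_ge[OF \<open>finite V\<close>])
    show "\<bar>step x i\<bar> + \<bar>step y i\<bar> \<in> V"
      unfolding V_def by (rule image_eqI[of _ _ "((x, y), i)"]) (use that in simp_all)
  qed
  show ?thesis
    unfolding eventually_sequentially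
  proof (intro exI[of _ "nat (B + int c + 1)"] allI impI)
    fix k assume k: "nat (B + int c + 1) \<le> k"
    show "fls_nth (fls_X powi (- \<lfloor>cform H_all (W_short (3 * l + s0) (2 * k)) (m_min (3 * l + s0) (2 * k))\<rfloor>)
      * M_ferm (W_short (3 * l + s0) (2 * k)) wt (fls_X :: 'a::field fls)) (int c)
    = (\<Sum>z\<in>?D. fls_nth (limit_term l s0 fls_X z) (int c))"
    proof (rule normalised_M_ferm_nth[OF assms])
      fix x y i assume xy: "(x, y) \<in> deviations l s0 wt" "energy x y \<le> int c"
      show "int k + step x i > int c" if "i \<in> long_bulk l"
        using bound[of x y i] xy that k by auto
      show "int k + step y i > int c" if "i \<in> short_bulk l s0"
        using bound[of x y i] xy that k by auto
    qed
  qed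
qed

section \<open>Cutting at the central block\<close>

text \<open>Reading tails backwards would turn entries into their negatives; the minus sign restores
  them. The cut at l creates one new entry, - X 0, at the last position.\<close>

definition left_part :: "nat \<Rightarrow> (nat \<Rightarrow> int) \<Rightarrow> nat \<Rightarrow> int" where
  "left_part l X k = (if k < l then - X (l - Suc k) else 0)"

definition right_part :: "nat \<Rightarrow> (nat \<Rightarrow> int) \<Rightarrow> nat \<Rightarrow> int" where
  "right_part l X k = X (l + k)"

lemma step_left_part:
  "0 < i \<Longrightarrow> i < l \<Longrightarrow> step (left_part l X) i = step X (l - i)"
  "step (left_part l X) l = (if l = 0 then 0 else - X 0)"
  "i > l \<Longrightarrow> step (left_part l X) i = 0"
  by (auto simp: step_def left_part_def)

lemma step_right_part: "i > 0 \<Longrightarrow> step (right_part l X) i = step X (l + i)"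
  by (simp add: step_def right_part_def)

text \<open>The block i of the left part is minus the block l - Suc i of the original, so adding it
  removes the topmost remaining block from the partial sum.\<close>

lemma vac1_left_part:
  "i \<le> l \<Longrightarrow> vac1 X Y l + vac1 (left_part l X) (left_part (3*l) Y) i = vac1 X Y (l - i)"
proof (induction i)
  case (Suc i)
  then have "l - i = Suc (l - Suc i)" by simp
  moreover have "3 * l - Suc (3 * i) = 3 * (l - Suc i) + 2" "3 * l - Suc (3 * i + 1) = 3 * (l - Suc i) + 1"
    "3 * l - Suc (3 * i + 2) = 3 * (l - Suc i)" using Suc.prems by simp_all
  ultimately show ?case
    using Suc by (simp add: vac1_def left_part_def)
qed (simp add: vac_0)

lemma vac2_left_part:
  "i \<le> 3*l \<Longrightarrow> vac2 X Y (3*l) + vac2 (left_part l X) (left_part (3*l) Y) i = vac2 X Y (3*l - i)"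
proof (induction i)
  case (Suc i)
  then have "3*l - i = Suc (3*l - Suc i)" by simp
  moreover have "l - Suc (i div 3) = (3 * l - Suc i) div 3" "i div 3 < l"
    using Suc.prems by presburger+
  ultimately show ?case
    using Suc by (simp add: vac2_def left_part_def)
qed (simp add: vac_0)

lemma vac1_right_part:
  "vac1 X Y (l + i) = vac1 X Y l + vac1 (right_part l X) (right_part (3*l) Y) i"
  by (induction i) (simp_all add: vac1_def right_part_def distrib_left add.assoc)

lemma vac2_right_part:
  "vac2 X Y (3*l + i) = vac2 X Y (3*l) + vac2 (right_part l X) (right_part (3*l) Y) i"
  by (induction i) (simp_all add: vac2_def right_part_def)

lemma block_energy_left_part: "i < l \<Longrightarrow> block_energy (left_part l X) (left_part (3*l) Y) i = block_energy X Y (l - Suc i)"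
proof -
  assume i: "i < l"
  then have "3 * l - Suc (3 * i) = 3 * (l - Suc i) + 2" "3 * l - Suc (3 * i + 1) = 3 * (l - Suc i) + 1"
    "3 * l - Suc (3 * i + 2) = 3 * (l - Suc i)" "3 * i + 2 < 3 * l" by simp_all
  then show ?thesis
    using i by (simp add: block_energy_def left_part_def) (simp add: algebra_simps)
qed

lemma block_energy_right_part: "block_energy (right_part l X) (right_part (3*l) Y) i = block_energy X Y (l + i)"
  by (simp add: block_energy_def right_part_def distrib_left add.assoc)

lemma eventually_zero_parts:
  assumes "eventually_zero X"
  shows "eventually_zero (left_part l X)" "eventually_zero (right_part l X)"
proof -
  show "eventually_zero (left_part l X)" by (rule eventually_zeroI[of l]) (simp add: left_part_def)
  obtain N where "\<And>k. k \<ge> N \<Longrightarrow> X k = 0"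
    using eventually_zero_bound[OF assms assms] by blast
  then show "eventually_zero (right_part l X)" by (intro eventually_zeroI[of N]) (simp add: right_part_def)
qed

lemma energy_split:
  assumes "eventually_zero X" "eventually_zero Y"
  shows "energy X Y = energy (left_part l X) (left_part (3*l) Y) + block_energy X Y l
    + energy (right_part (Suc l) X) (right_part (3 * Suc l) Y)"
proof -
  obtain N where N: "\<And>k. k \<ge> N \<Longrightarrow> X k = 0" "\<And>k. k \<ge> N \<Longrightarrow> Y k = 0"
    using eventually_zero_bound[OF assms] by blast
  have "energy X Y = (\<Sum>k<Suc l + N. block_energy X Y k)"
    using N by (intro energy_eq) auto
  moreover have "energy (left_part l X) (left_part (3*l) Y) = (\<Sum>k<l. block_energy (left_part l X) (left_part (3*l) Y) k)"
    by (intro energy_eq) (auto simp: left_part_def)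
  moreover have "(\<Sum>k<l. block_energy (left_part l X) (left_part (3*l) Y) k) = (\<Sum>k<l. block_energy X Y k)"
    by (subst sum.nat_diff_reindex[symmetric]) (simp add: block_energy_left_part)
  moreover have "energy (right_part (Suc l) X) (right_part (3 * Suc l) Y)
      = (\<Sum>k<N. block_energy (right_part (Suc l) X) (right_part (3 * Suc l) Y) k)"
    using N by (intro energy_eq) (auto simp: right_part_def)
  ultimately show ?thesis
    unfolding sum_lessThan_add[of _ "Suc l"] block_energy_right_part sum.lessThan_Suc by linarith
qed

lemma prod_lessThan_add:
  fixes f :: "nat \<Rightarrow> 'a::comm_monoid_mult"
  shows "(\<Prod>k<n + m. f k) = (\<Prod>k<n. f k) * (\<Prod>k<m. f (n + k))"
  by (induction m) (simp_all add: mult.assoc)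

lemma qfac_prod_Suc:
  assumes "\<And>k. qpoch q k \<noteq> 0" "\<And>i. i < N \<Longrightarrow> p (Suc i) \<ge> 0" "\<And>k. k \<ge> N \<Longrightarrow> X k = 0"
  shows "qfac_prod q p X = (\<Prod>i<N. qfac q (p (Suc i)) (step X (Suc i)))"
proof -
  have "qfac_prod q p X = (\<Prod>i\<in>Suc ` {..<N}. qfac q (p i) (step X i))"
  proof (rule qfac_prod_eq[OF assms(1)])
    show "{i. step X i \<noteq> 0} \<subseteq> Suc ` {..<N}"
    proof
      fix i assume "i \<in> {i. step X i \<noteq> 0}"
      then have "\<not> i > N" "i \<noteq> 0"
        using step_beyond[of N X i] assms(3) step_0[of X] by (blast, metis mem_Collect_eq)
      then show "i \<in> Suc ` {..<N}" by (cases i) auto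
    qed
  qed (use assms(2) in auto)
  also have "\<dots> = (\<Prod>i<N. qfac q (p (Suc i)) (step X (Suc i)))"
    by (subst prod.reindex) simp_all
  finally show ?thesis .
qed

text \<open>
  The reversal matches position i of the left part with position l - i; at i = l the vacancy
  number vanishes, so the factor there is 1 although the left part has the entry - X 0.
\<close>

lemma prod_limit_factor_left:
  assumes "\<And>k. qpoch q k \<noteq> 0" "\<And>i. p i \<ge> 0" "p 0 = 0" "\<And>i. i < l \<Longrightarrow> i \<notin> B"
    and "\<And>i. i \<le> l \<Longrightarrow> p' i = p (l - i)" "X 0 \<le> 0"
  shows "qfac_prod q p' (left_part l X) = (\<Prod>i<l. limit_factor q B p X i)"
proof -
  have "qfac_prod q p' (left_part l X) = (\<Prod>i<l. qfac q (p' (Suc i)) (step (left_part l X) (Suc i)))"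
    using assms by (intro qfac_prod_Suc) (simp_all add: left_part_def)
  also have "\<dots> = (\<Prod>i<l. limit_factor q B p X (l - Suc i))"
  proof (intro prod.cong refl)
    fix i assume i: "i \<in> {..<l}"
    show "qfac q (p' (Suc i)) (step (left_part l X) (Suc i)) = limit_factor q B p X (l - Suc i)"
    proof (cases "Suc i = l")
      case True
      then have "qfac q (p' (Suc i)) (step (left_part l X) (Suc i)) = qfac q 0 (- X 0)"
        using assms(3,5) step_left_part(2)[of l X] by auto
      also have "\<dots> = 1"
        using assms(1,6) by (simp add: qfac_eq) (simp add: qpoch_def)
      finally show ?thesis
        using True i assms(3,4) qfac_0_right[OF _ assms(1), of 0] by (simp add: limit_factor_def)
    next
      case False
      then show ?thesis
        using i assms(4,5) by (simp add: limit_factor_def step_left_part(1) del: step_Suc)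
    qed
  qed
  also have "\<dots> = (\<Prod>i<l. limit_factor q B p X i)"
    by (rule prod.nat_diff_reindex)
  finally show ?thesis .
qed

lemma prod_limit_factor_right:
  assumes "\<And>k. qpoch q k \<noteq> 0" "\<And>i. p i \<ge> 0" "\<And>i. i > l \<Longrightarrow> i \<notin> B"
    and "\<And>i. p' i = p (l + i)" "\<And>k. k \<ge> N \<Longrightarrow> X k = 0"
  shows "qfac_prod q p' (right_part l X) = (\<Prod>i<N. limit_factor q B p X (Suc l + i))"
proof -
  have "qfac_prod q p' (right_part l X) = (\<Prod>i<N. qfac q (p' (Suc i)) (step (right_part l X) (Suc i)))"
    using assms by (intro qfac_prod_Suc) (simp_all add: right_part_def)
  also have "\<dots> = (\<Prod>i<N. limit_factor q B p X (Suc l + i))"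
    using assms(3,4) by (intro prod.cong refl) (simp add: limit_factor_def step_right_part del: step_Suc)
  finally show ?thesis .
qed

lemma limit_prod_long_split:
  assumes "\<And>k. qpoch q k \<noteq> 0" "\<And>i. p i \<ge> 0" "p 0 = 0" "eventually_zero X" "X 0 \<le> 0"
    and "\<And>i. i \<le> l \<Longrightarrow> pl i = p (l - i)" "\<And>i. pr i = p (Suc l + i)"
  shows "limit_prod q (long_bulk l) p X = qfac_prod q pl (left_part l X)
    * inverse (qpoch q (nat (p l))) * inverse (qpoch q (nat (p (Suc l))))
    * qfac_prod q pr (right_part (Suc l) X)"
proof -
  obtain N where N: "\<And>k. k \<ge> N \<Longrightarrow> X k = 0"
    using eventually_zero_bound[OF assms(4,4)] by blast
  have "limit_prod q (long_bulk l) p X = (\<Prod>i<l + (2 + N). limit_factor q (long_bulk l) p X i)"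
  proof (rule limit_prod_eq[OF assms(1,2)])
    show "{i. step X i \<noteq> 0} \<subseteq> {..<l + (2 + N)}"
      using step_beyond[of N X] N by (force simp: not_less)
  qed (auto simp: long_bulk_def)
  also have "\<dots> = (\<Prod>i<l. limit_factor q (long_bulk l) p X i)
      * inverse (qpoch q (nat (p l))) * inverse (qpoch q (nat (p (Suc l))))
      * (\<Prod>i<N. limit_factor q (long_bulk l) p X (Suc (Suc l) + i))"
    unfolding prod_lessThan_add by (simp add: numeral_2_eq_2 limit_factor_def long_bulk_def mult.assoc)
  also have "(\<Prod>i<l. limit_factor q (long_bulk l) p X i) = qfac_prod q pl (left_part l X)"
    by (rule prod_limit_factor_left[symmetric]) (use assms in \<open>auto simp: long_bulk_def\<close>)
  also have "(\<Prod>i<N. limit_factor q (long_bulk l) p X (Suc (Suc l) + i)) = qfac_prod q pr (right_part (Suc l) X)"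
    by (rule prod_limit_factor_right[symmetric]) (use assms N in \<open>auto simp: long_bulk_def\<close>)
  finally show ?thesis .
qed

text \<open>Of the four positions 3 l, ..., 3 l + 3, three are bulk positions. The remaining one is
  3 l + 3 - s0, where the entry stays finite and a full q-binomial survives.\<close>

lemma limit_prod_short_split:
  assumes "\<And>k. qpoch q k \<noteq> 0" "\<And>i. p i \<ge> 0" "p 0 = 0" "eventually_zero Y" "Y 0 \<le> 0" "s0 = 1 \<or> s0 = 2"
    and "\<And>i. i \<le> 3*l \<Longrightarrow> pl i = p (3*l - i)" "\<And>i. pr i = p (3 * Suc l + i)"
  shows "limit_prod q (short_bulk l s0) p Y = qfac_prod q pl (left_part (3*l) Y)
    * inverse (qpoch q (nat (p (3*l)))) * inverse (qpoch q (nat (p (3*l + s0))))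
    * qfac q (p (3*l + 3 - s0)) (step Y (3*l + 3 - s0)) * inverse (qpoch q (nat (p (3 * Suc l))))
    * qfac_prod q pr (right_part (3 * Suc l) Y)"
proof -
  obtain N where N: "\<And>k. k \<ge> N \<Longrightarrow> Y k = 0"
    using eventually_zero_bound[OF assms(4,4)] by blast
  have "limit_prod q (short_bulk l s0) p Y = (\<Prod>i<3*l + (4 + N). limit_factor q (short_bulk l s0) p Y i)"
  proof (rule limit_prod_eq[OF assms(1,2)])
    show "{i. step Y i \<noteq> 0} \<subseteq> {..<3*l + (4 + N)}"
      using step_beyond[of N Y] N by (force simp: not_less)
  qed (use assms(6) in \<open>auto simp: short_bulk_def\<close>)
  also have "\<dots> = (\<Prod>i<3*l. limit_factor q (short_bulk l s0) p Y i)
      * (limit_factor q (short_bulk l s0) p Y (3*l) * limit_factor q (short_bulk l s0) p Y (3*l+1)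
         * limit_factor q (short_bulk l s0) p Y (3*l+2) * limit_factor q (short_bulk l s0) p Y (3*l+3))
      * (\<Prod>i<N. limit_factor q (short_bulk l s0) p Y (Suc (3 * Suc l) + i))"
  proof -
    have four: "(\<Prod>i<4. f i) = f 0 * f 1 * f 2 * f 3" for f :: "nat \<Rightarrow> 'a"
      by (simp add: eval_nat_numeral)
    have "3 * l + (4 + i) = Suc (3 * Suc l) + i" for i by simp
    then show ?thesis
      unfolding prod_lessThan_add[of _ "3*l"] prod_lessThan_add[of _ 4] four
      by (simp only: mult.assoc add_0_right)
  qed
  also have "limit_factor q (short_bulk l s0) p Y (3*l) * limit_factor q (short_bulk l s0) p Y (3*l+1)
         * limit_factor q (short_bulk l s0) p Y (3*l+2) * limit_factor q (short_bulk l s0) p Y (3*l+3)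
      = inverse (qpoch q (nat (p (3*l)))) * inverse (qpoch q (nat (p (3*l + s0))))
    * qfac q (p (3*l + 3 - s0)) (step Y (3*l + 3 - s0)) * inverse (qpoch q (nat (p (3 * Suc l))))"
    using assms(6) by (elim disjE) (simp_all add: limit_factor_def short_bulk_def eval_nat_numeral mult_ac del: step_Suc)
  also have "(\<Prod>i<3*l. limit_factor q (short_bulk l s0) p Y i) = qfac_prod q pl (left_part (3*l) Y)"
    by (rule prod_limit_factor_left[symmetric]) (use assms in \<open>auto simp: short_bulk_def\<close>)
  also have "(\<Prod>i<N. limit_factor q (short_bulk l s0) p Y (Suc (3 * Suc l) + i)) = qfac_prod q pr (right_part (3 * Suc l) Y)"
    by (rule prod_limit_factor_right[symmetric]) (use assms N in \<open>auto simp: short_bulk_def\<close>)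
  finally show ?thesis by (simp add: mult.assoc)
qed

section \<open>The outer parts as configurations of W(eta) and W(xi)\<close>

lemma sum_supp_W_one:
  assumes "f 0 1 = 0"
  shows "(\<Sum>j\<in>supp_in H (W_one e1 e2) 1. f (W_one e1 e2 1 j) j) = (if (1, 1) \<in> H then f e1 1 else 0)"
    and "(\<Sum>j\<in>supp_in H (W_one e1 e2) 2. f (W_one e1 e2 2 j) j) = (if (2, 1) \<in> H then f e2 1 else 0)"
proof -
  have "supp_in H (W_one e1 e2) 1 = (if (1, 1) \<in> H \<and> e1 \<noteq> 0 then {1} else {})"
    "supp_in H (W_one e1 e2) 2 = (if (2, 1) \<in> H \<and> e2 \<noteq> 0 then {1} else {})"
    by (auto simp: supp_in_def W_one_def split: if_splits)
  then show "(\<Sum>j\<in>supp_in H (W_one e1 e2) 1. f (W_one e1 e2 1 j) j) = (if (1, 1) \<in> H then f e1 1 else 0)"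
    "(\<Sum>j\<in>supp_in H (W_one e1 e2) 2. f (W_one e1 e2 2 j) j) = (if (2, 1) \<in> H then f e2 1 else 0)"
    using assms by (simp_all add: W_one_def)
qed

lemma vac_offset_W_one:
  "vac_offset H (W_one e1 e2) 1 i = (if (1, 1) \<in> H \<and> i > 0 then int e1 else 0)"
  "vac_offset H (W_one e1 e2) 2 i = (if (2, 1) \<in> H \<and> i > 0 then int e2 else 0)"
  unfolding vac_offset_def using sum_supp_W_one[where f = "\<lambda>n j. int n * int (min i j)"] by auto

lemma weight_total_W_one:
  "weight_total H (W_one e1 e2) 1 = (if (1, 1) \<in> H then real e1 else 0)"
  "weight_total H (W_one e1 e2) 2 = (if (2, 1) \<in> H then real e2 else 0)"
  unfolding weight_total_def using sum_supp_W_one[where f = "\<lambda>n j. real j * real n"] by simp_all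

text \<open>Position 0 never occurs in the product. This allows the offset of \<open>W_one\<close>,
  which is constant only at positive positions, to be replaced by a constant.\<close>

lemma qfac_prod_cong:
  assumes "\<And>i. i > 0 \<Longrightarrow> p i = p' i"
  shows "qfac_prod q p X = qfac_prod q p' X"
  unfolding qfac_prod_def
proof (rule prod.cong[OF refl])
  fix i assume "i \<in> {i. step X i \<noteq> 0}"
  then have "i > 0" by (cases i) simp_all
  then show "qfac q (p i) (step X i) = qfac q (p' i) (step X i)" using assms by simp
qed

text \<open>The vacancy conditions can be extended to i = 0 because \<open>vac1\<close> and
  \<open>vac2\<close> vanish there and the constant offsets are non-negative.\<close>

lemma tail_configs_right:
  "(X, Y) \<in> tail_configs H_all (W_one e1 e2) wt \<longleftrightarrow>
     eventually_zero X \<and> eventually_zero Y \<and> (\<forall>i. step X i \<ge> 0) \<and> (\<forall>i. step Y i \<ge> 0) \<and>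
     (\<forall>i. int e1 + vac1 X Y i \<ge> 0) \<and> (\<forall>i. int e2 + vac2 X Y i \<ge> 0) \<and>
     vac_limit X Y (fst wt - real e1) (snd wt - real e2)"
proof -
  have H: "(1, i) \<in> H_all \<longleftrightarrow> i > 0" "(2, i) \<in> H_all \<longleftrightarrow> i > 0" for i
    by (auto simp: H_all_def)
  have 1: "(\<forall>i. step X i \<ge> 0 \<and> ((1, i) \<notin> H_all \<longrightarrow> step X i = 0)) \<longleftrightarrow> (\<forall>i. step X i \<ge> 0)"
    "(\<forall>i. step Y i \<ge> 0 \<and> ((2, i) \<notin> H_all \<longrightarrow> step Y i = 0)) \<longleftrightarrow> (\<forall>i. step Y i \<ge> 0)"
    unfolding H by auto
  have 2: "(\<forall>i. 0 < i \<longrightarrow> vac_offset H_all (W_one e1 e2) 1 i + vac1 X Y i \<ge> 0)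
      \<longleftrightarrow> (\<forall>i. int e1 + vac1 X Y i \<ge> 0)" (is "?a \<longleftrightarrow> ?b")
  proof (intro iffI allI impI)
    fix i assume ?a
    then show "int e1 + vac1 X Y i \<ge> 0"
      using vac_0[of X Y] by (cases "i = 0") (auto simp: vac_offset_W_one H simp del: One_nat_def)
  next
    fix i :: nat assume ?b "0 < i"
    then show "vac_offset H_all (W_one e1 e2) 1 i + vac1 X Y i \<ge> 0"
      by (auto simp: vac_offset_W_one H simp del: One_nat_def)
  qed
  have 3: "(\<forall>i. 0 < i \<longrightarrow> vac_offset H_all (W_one e1 e2) 2 i + vac2 X Y i \<ge> 0)
      \<longleftrightarrow> (\<forall>i. int e2 + vac2 X Y i \<ge> 0)" (is "?a \<longleftrightarrow> ?b")
  proof (intro iffI allI impI)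
    fix i assume ?a
    then show "int e2 + vac2 X Y i \<ge> 0"
      using vac_0[of X Y] by (cases "i = 0") (auto simp: vac_offset_W_one H simp del: One_nat_def)
  next
    fix i :: nat assume ?b "0 < i"
    then show "vac_offset H_all (W_one e1 e2) 2 i + vac2 X Y i \<ge> 0"
      by (auto simp: vac_offset_W_one H simp del: One_nat_def)
  qed
  show ?thesis
    unfolding tail_configs_def mem_Collect_eq prod.case 1
    unfolding H 2 3 weight_total_W_one by simp
qed

text \<open>Weight 0 means that the full vacancy numbers vanish at the last positions l and 3 l. For
  l = 0 there is no position to carry an offset, so the equations are correct only for xi =
  0.\<close>

lemma tail_configs_left:
  assumes "l \<noteq> 0 \<or> x1 = 0 \<and> x2 = 0"
  shows "(X, Y) \<in> tail_configs (H_level l) (W_one x1 x2) 0 \<longleftrightarrow>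
     (\<forall>k\<ge>l. X k = 0) \<and> (\<forall>k\<ge>3*l. Y k = 0) \<and> (\<forall>i. step X i \<ge> 0) \<and> (\<forall>i. step Y i \<ge> 0) \<and>
     (\<forall>i\<le>l. int x1 + vac1 X Y i \<ge> 0) \<and> (\<forall>i\<le>3*l. int x2 + vac2 X Y i \<ge> 0) \<and>
     int x1 + vac1 X Y l = 0 \<and> int x2 + vac2 X Y (3*l) = 0"
proof -
  have H: "(1, i) \<in> H_level l \<longleftrightarrow> 0 < i \<and> i \<le> l" "(2, i) \<in> H_level l \<longleftrightarrow> 0 < i \<and> i \<le> 3*l" for i
    by (auto simp: H_level_def tnum_def)
  have supp: "eventually_zero Z \<and> (\<forall>i. step Z i \<ge> 0 \<and> (\<not> (0 < i \<and> i \<le> n) \<longrightarrow> step Z i = 0))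
     \<longleftrightarrow> (\<forall>k\<ge>n. Z k = 0) \<and> (\<forall>i. step Z i \<ge> 0)" for Z n
  proof (intro iffI conjI allI impI)
    assume Z: "(\<forall>k\<ge>n. Z k = 0) \<and> (\<forall>i. step Z i \<ge> 0)"
    then show "eventually_zero Z" by (intro eventually_zeroI) blast
    fix i
    show "step Z i \<ge> 0" using Z by blast
    assume "\<not> (0 < i \<and> i \<le> n)"
    then have "i = 0 \<or> n < i" by auto
    then show "step Z i = 0"
    proof
      show "n < i \<Longrightarrow> step Z i = 0" by (rule step_beyond[of n]) (use Z in blast)+
    qed simp
  next
    fix k assume Z: "eventually_zero Z \<and> (\<forall>i. step Z i \<ge> 0 \<and> (\<not> (0 < i \<and> i \<le> n) \<longrightarrow> step Z i = 0))" and k: "n \<le> k"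
    have "eventually_zero Z" using Z by (rule conjunct1)
    then obtain N where N: "\<And>k. k \<ge> N \<Longrightarrow> Z k = 0" using eventually_zero_bound[of Z Z] by blast
    have step0: "step Z i = 0" if "n < i" for i
    proof -
      have "\<not> (0 < i \<and> i \<le> n)" using that by simp
      then show ?thesis using Z by blast
    qed
    have "Z k = Z (k + d)" for d
    proof (induction d)
      case (Suc d)
      then show ?case using step0[of "Suc (k + d)"] k by simp
    qed simp
    then show "Z k = 0" using N[of "k + N"] by simp
  next
    fix i assume "eventually_zero Z \<and> (\<forall>i. step Z i \<ge> 0 \<and> (\<not> (0 < i \<and> i \<le> n) \<longrightarrow> step Z i = 0))"
    then show "step Z i \<ge> 0" by blast
  qed
  have off: "(\<forall>i. 0 < i \<and> i \<le> l \<longrightarrow> vac_offset (H_level l) (W_one x1 x2) 1 i + vac1 X Y i \<ge> 0)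
      \<longleftrightarrow> (\<forall>i\<le>l. int x1 + vac1 X Y i \<ge> 0)"
    "(\<forall>i. 0 < i \<and> i \<le> 3*l \<longrightarrow> vac_offset (H_level l) (W_one x1 x2) 2 i + vac2 X Y i \<ge> 0)
      \<longleftrightarrow> (\<forall>i\<le>3*l. int x2 + vac2 X Y i \<ge> 0)"
  proof -
    show "(\<forall>i. 0 < i \<and> i \<le> l \<longrightarrow> vac_offset (H_level l) (W_one x1 x2) 1 i + vac1 X Y i \<ge> 0)
      \<longleftrightarrow> (\<forall>i\<le>l. int x1 + vac1 X Y i \<ge> 0)" (is "?a \<longleftrightarrow> ?b")
    proof (intro iffI allI impI)
      fix i assume ?a "i \<le> l"
      then show "int x1 + vac1 X Y i \<ge> 0"
        using vac_0[of X Y] by (cases "i = 0") (auto simp: vac_offset_W_one H simp del: One_nat_def)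
    next
      fix i assume ?b "0 < i \<and> i \<le> l"
      then show "vac_offset (H_level l) (W_one x1 x2) 1 i + vac1 X Y i \<ge> 0"
        by (auto simp: vac_offset_W_one H simp del: One_nat_def)
    qed
    show "(\<forall>i. 0 < i \<and> i \<le> 3*l \<longrightarrow> vac_offset (H_level l) (W_one x1 x2) 2 i + vac2 X Y i \<ge> 0)
      \<longleftrightarrow> (\<forall>i\<le>3*l. int x2 + vac2 X Y i \<ge> 0)" (is "?a \<longleftrightarrow> ?b")
    proof (intro iffI allI impI)
      fix i assume ?a "i \<le> 3*l"
      then show "int x2 + vac2 X Y i \<ge> 0"
        using vac_0[of X Y] by (cases "i = 0") (auto simp: vac_offset_W_one H simp del: One_nat_def)
    next
      fix i assume ?b "0 < i \<and> i \<le> 3*l"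
      then show "vac_offset (H_level l) (W_one x1 x2) 2 i + vac2 X Y i \<ge> 0"
        by (auto simp: vac_offset_W_one H simp del: One_nat_def)
    qed
  qed
  \<comment> \<open>The translation of the weight condition is available only once both tails are
    known to vanish beyond the level, hence the conditional third premise.\<close>
  have conj_rearrange: "(E1 \<and> E2 \<and> S1 \<and> S2 \<and> O1 \<and> O2 \<and> V) \<longleftrightarrow> (A1 \<and> A2 \<and> B1 \<and> B2 \<and> O1 \<and> O2 \<and> W)"
    if "(E1 \<and> S1) \<longleftrightarrow> (A1 \<and> B1)" "(E2 \<and> S2) \<longleftrightarrow> (A2 \<and> B2)" "A1 \<Longrightarrow> A2 \<Longrightarrow> V \<longleftrightarrow> W"
    for A1 A2 B1 B2 E1 E2 S1 S2 O1 O2 V W :: bool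
    using that by blast
  have wt: "fst 0 - weight_total (H_level l) (W_one x1 x2) 1 = - real x1"
    "snd 0 - weight_total (H_level l) (W_one x1 x2) 2 = - real x2"
    using assms by (auto simp: weight_total_W_one H simp del: One_nat_def)
  have lim: "vac_limit X Y (- real x1) (- real x2) \<longleftrightarrow> int x1 + vac1 X Y l = 0 \<and> int x2 + vac2 X Y (3*l) = 0"
    if "\<forall>k\<ge>l. X k = 0" "\<forall>k\<ge>3*l. Y k = 0"
    using that by (subst vac_limit_iff[of l]) auto
  show ?thesis
    unfolding tail_configs_def mem_Collect_eq prod.case H off wt
    by (rule conj_rearrange[OF supp supp lim])
qed

lemma M_ferm_W_one_inverse:
  assumes "q \<noteq> 0"
  shows "M_ferm (W_one e1 e2) wt (inverse q) = (\<Sum>(X, Y)\<in>tail_configs H_all (W_one e1 e2) wt.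
     q powi energy X Y * (qfac_prod q (\<lambda>i. int e1 + vac1 X Y i) X * qfac_prod q (\<lambda>i. int e2 + vac2 X Y i) Y))"
proof -
  have "(1, 1) \<in> H_all" "(2, 1) \<in> H_all" by (auto simp: H_all_def)
  then have "qfac_prod q (\<lambda>i. vac_offset H_all (W_one e1 e2) 1 i + vac1 X Y i) Z = qfac_prod q (\<lambda>i. int e1 + vac1 X Y i) Z"
    "qfac_prod q (\<lambda>i. vac_offset H_all (W_one e1 e2) 2 i + vac2 X Y i) Z = qfac_prod q (\<lambda>i. int e2 + vac2 X Y i) Z" for X Y Z
    by (intro qfac_prod_cong, simp only: vac_offset_W_one simp_thms if_True)+
  then show ?thesis
    unfolding M_ferm_def fermionic_inverse_tails[OF order_refl assms] by simp
qed

lemma M_level_W_one_inverse: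
  assumes "q \<noteq> 0" "l \<noteq> 0 \<or> x1 = 0 \<and> x2 = 0"
  shows "M_level l (W_one x1 x2) (inverse q) = (\<Sum>(X, Y)\<in>tail_configs (H_level l) (W_one x1 x2) 0.
     q powi energy X Y * (qfac_prod q (\<lambda>i. int x1 + vac1 X Y i) X * qfac_prod q (\<lambda>i. int x2 + vac2 X Y i) Y))"
proof -
  have H: "H_level l \<subseteq> H_all" by (auto simp: H_level_def H_all_def)
  have "(1, 1) \<in> H_level l \<longleftrightarrow> l \<noteq> 0" "(2, 1) \<in> H_level l \<longleftrightarrow> l \<noteq> 0"
    by (auto simp: H_level_def tnum_def)
  then have "qfac_prod q (\<lambda>i. vac_offset (H_level l) (W_one x1 x2) 1 i + vac1 X Y i) Z = qfac_prod q (\<lambda>i. int x1 + vac1 X Y i) Z"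
    "qfac_prod q (\<lambda>i. vac_offset (H_level l) (W_one x1 x2) 2 i + vac2 X Y i) Z = qfac_prod q (\<lambda>i. int x2 + vac2 X Y i) Z" for X Y Z
    using assms(2) by (intro qfac_prod_cong; cases "l = 0"; simp only: vac_offset_W_one simp_thms if_True if_False of_nat_0)+
  then show ?thesis
    unfolding M_level_def fermionic_inverse_tails[OF H assms(1)] by simp
qed

lemma vac_limit_right_part:
  "vac_limit X Y w1 w2 \<longleftrightarrow> vac_limit (right_part l X) (right_part (3*l) Y)
     (w1 - of_int (vac1 X Y l)) (w2 - of_int (vac2 X Y (3*l)))"
proof -
  have "vac_limit X Y w1 w2 \<longleftrightarrow> (\<forall>\<^sub>F i in sequentially. of_int (vac1 X Y (l + i)) = w1) \<and>
      (\<forall>\<^sub>F i in sequentially. of_int (vac2 X Y (3*l + i)) = w2)"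
    unfolding vac_limit_def eventually_conj_iff
    using eventually_sequentially_seg[of "\<lambda>i. of_int (vac1 X Y i) = w1" l]
      eventually_sequentially_seg[of "\<lambda>i. of_int (vac2 X Y i) = w2" "3*l"]
    by (simp add: add.commute)
  then show ?thesis
    unfolding vac1_right_part vac2_right_part vac_limit_def eventually_conj_iff
    by (simp add: eq_diff_eq add.commute)
qed

text \<open>Here n is the number of tails in the central block: 1 for node 1 and 3 for node
  2.\<close>

definition glue :: "nat \<Rightarrow> nat \<Rightarrow> (nat \<Rightarrow> int) \<Rightarrow> (nat \<Rightarrow> int) \<Rightarrow> (nat \<Rightarrow> int) \<Rightarrow> nat \<Rightarrow> int" where
  "glue l n L C R k = (if k < l then - L (l - Suc k) else if k < l + n then C (k - l) else R (k - (l + n)))"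

definition left_tails :: "nat \<Rightarrow> (nat \<Rightarrow> int) \<times> (nat \<Rightarrow> int) \<Rightarrow> (nat \<Rightarrow> int) \<times> (nat \<Rightarrow> int)" where
  "left_tails l = (\<lambda>(X, Y). (left_part l X, left_part (3 * l) Y))"

definition right_tails :: "nat \<Rightarrow> (nat \<Rightarrow> int) \<times> (nat \<Rightarrow> int) \<Rightarrow> (nat \<Rightarrow> int) \<times> (nat \<Rightarrow> int)" where
  "right_tails l = (\<lambda>(X, Y). (right_part (Suc l) X, right_part (3 * Suc l) Y))"

definition glue_tails :: "nat \<Rightarrow> int \<Rightarrow> (nat \<Rightarrow> int)
    \<Rightarrow> ((nat \<Rightarrow> int) \<times> (nat \<Rightarrow> int)) \<times> ((nat \<Rightarrow> int) \<times> (nat \<Rightarrow> int)) \<Rightarrow> (nat \<Rightarrow> int) \<times> (nat \<Rightarrow> int)" where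
  "glue_tails l a C = (\<lambda>((RX, RY), (LX, LY)). (glue l 1 LX (\<lambda>_. a) RX, glue (3 * l) 3 LY C RY))"

lemma left_part_glue: "(\<And>k. k \<ge> l \<Longrightarrow> L k = 0) \<Longrightarrow> left_part l (glue l n L C R) = L"
  by (auto simp: left_part_def glue_def fun_eq_iff)

lemma right_part_glue: "right_part (l + n) (glue l n L C R) = R"
  by (auto simp: right_part_def glue_def fun_eq_iff)

lemma glue_parts:
  "(\<And>i. i < n \<Longrightarrow> C i = X (l + i)) \<Longrightarrow> glue l n (left_part l X) C (right_part (l + n) X) = X"
  by (auto simp: left_part_def right_part_def glue_def fun_eq_iff)

lemma glue_middle: "i < n \<Longrightarrow> glue l n L C R (l + i) = C i"
  by (simp add: glue_def)

lemma eventually_zero_glue: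
  assumes "eventually_zero R"
  shows "eventually_zero (glue l n L C R)"
proof -
  obtain N where N: "\<And>k. k \<ge> N \<Longrightarrow> R k = 0" using eventually_zero_bound[OF assms assms] by blast
  show ?thesis by (rule eventually_zeroI[of "l + n + N"]) (use N in \<open>auto simp: glue_def\<close>)
qed

section \<open>The sum over cut deviations\<close>

definition index_of :: "nat \<Rightarrow> nat \<Rightarrow> (nat \<Rightarrow> int) \<times> (nat \<Rightarrow> int) \<Rightarrow> sum_index" where
  "index_of l s0 = (\<lambda>(X, Y). (nat (vac1 X Y (Suc l)), nat (vac2 X Y (3 * Suc l)), nat (vac1 X Y l),
     nat (vac2 X Y (3 * l)), nat (vac2 X Y (3 * l + s0)), nat (step Y (3 * l + 3 - s0))))"

lemma vac_middle:
  "vac1 X Y (Suc l) = vac1 X Y l + (Y (3*l) + Y (3*l+1) + Y (3*l+2) - 2 * X l)"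
  "vac2 X Y (3*l+1) = vac2 X Y (3*l) + (X l - 2 * Y (3*l))"
  "vac2 X Y (3*l+2) = vac2 X Y (3*l+1) + (X l - 2 * Y (3*l+1))"
  "vac2 X Y (3 * Suc l) = vac2 X Y (3*l+2) + (X l - 2 * Y (3*l+2))"
proof -
  have e: "3 * Suc l = Suc (3*l+2)" "3*l+2 = Suc (3*l+1)" "3*l+1 = Suc (3*l)" by simp_all
  have v: "vac2 X Y (Suc j) = vac2 X Y j + (X (j div 3) - 2 * Y j)" for j
    by (simp add: vac2_def)
  show "vac1 X Y (Suc l) = vac1 X Y l + (Y (3*l) + Y (3*l+1) + Y (3*l+2) - 2 * X l)"
    by (simp add: vac1_def)
  show "vac2 X Y (3*l+1) = vac2 X Y (3*l) + (X l - 2 * Y (3*l))"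
    unfolding e(3) v by simp
  show "vac2 X Y (3*l+2) = vac2 X Y (3*l+1) + (X l - 2 * Y (3*l+1))"
    unfolding e(2) v by (simp add: div_3)
  show "vac2 X Y (3 * Suc l) = vac2 X Y (3*l+2) + (X l - 2 * Y (3*l+2))"
    unfolding e(1) v by (simp add: div_3)
qed

lemma deviations_origin:
  assumes "(X, Y) \<in> deviations l s0 wt"
  shows "X 0 \<le> 0" "Y 0 \<le> 0"
proof -
  have "vac1 X Y 1 \<ge> 0" "vac2 X Y 1 \<ge> 0" "vac2 X Y 3 \<ge> 0"
    using assms by (auto simp: deviations_def)
  \<comment> \<open>The combination 2 * vac1 X Y 1 + vac2 X Y 3 equals - X 0, and vac2 X Y 1 = X 0 -
    2 * Y 0 then gives the sign of Y 0.\<close>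
  then show "X 0 \<le> 0" "Y 0 \<le> 0"
    using vac_middle[of X Y 0] by (simp_all add: vac_0)
qed

lemma index_of_eq_iff:
  assumes "(X, Y) \<in> deviations l s0 wt" "s0 = 1 \<or> s0 = 2"
  shows "index_of l s0 (X, Y) = (e1, e2, x1, x2, z, m) \<longleftrightarrow>
     vac1 X Y (Suc l) = int e1 \<and> vac2 X Y (3 * Suc l) = int e2 \<and> vac1 X Y l = int x1 \<and>
     vac2 X Y (3 * l) = int x2 \<and> vac2 X Y (3 * l + s0) = int z \<and> step Y (3 * l + 3 - s0) = int m"
proof -
  have "vac1 X Y i \<ge> 0" "vac2 X Y i \<ge> 0" for i
    using assms(1) by (simp_all add: deviations_def)
  moreover have "3 * l + 3 - s0 \<notin> short_bulk l s0"
    using assms(2) by (auto simp: short_bulk_def)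
  then have "step Y (3 * l + 3 - s0) \<ge> 0"
    using assms(1) unfolding deviations_def by blast
  ultimately have "nat (vac1 X Y i) = n \<longleftrightarrow> vac1 X Y i = int n" "nat (vac2 X Y i) = n \<longleftrightarrow> vac2 X Y i = int n"
    "nat (step Y (3 * l + 3 - s0)) = n \<longleftrightarrow> step Y (3 * l + 3 - s0) = int n" for i n
    by (metis int_nat_eq nat_int)+
  then show ?thesis
    unfolding index_of_def prod.case prod.inject by simp
qed

text \<open>The parity conditions follow by expressing \<open>z\<close>, \<open>e2\<close> and
  \<open>m\<close> through the integer tails of block l.\<close>

lemma index_of_in_sum_indices:
  assumes "(X, Y) \<in> deviations l s0 wt" "s0 = 1 \<or> s0 = 2"
  shows "index_of l s0 (X, Y) \<in> sum_indices (3 * l + s0) s0"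
proof -
  obtain e1 e2 x1 x2 z m where x: "index_of l s0 (X, Y) = (e1, e2, x1, x2, z, m)"
    by (rule prod_cases6)
  have eqs: "vac1 X Y (Suc l) = int e1" "vac2 X Y (3 * Suc l) = int e2" "vac1 X Y l = int x1"
    "vac2 X Y (3 * l) = int x2" "vac2 X Y (3 * l + s0) = int z" "step Y (3 * l + 3 - s0) = int m"
    using x[unfolded index_of_eq_iff[OF assms]] by blast+
  note mid = vac_middle[of X Y l]
  \<comment> \<open>For l = 0 the left cut is at the origin, where the vacancy numbers are 0; this
    is the case s = s0.\<close>
  have "l = 0 \<Longrightarrow> x1 = 0 \<and> x2 = 0"
    using eqs by (simp add: vac_0)
  moreover have "even (z + (2 - s0) * e2 + (s0 - 1) * x2) \<and> even ((3 - s0) * x2 + s0 * e2 + z) \<and>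
     even (m + ((3 - s0) * x2 + s0 * e2 + z) div 2)"
    using assms(2)
  proof
    assume s0: "s0 = 1"
    then have "step Y (3 * l + 3 - s0) = Y (3*l+1) - Y (3*l+2)"
      by (simp add: step_def)
    then have m: "int m = Y (3*l+1) - Y (3*l+2)"
      and z: "int z = int x2 + X l - 2 * Y (3*l)"
      and e2: "int e2 = int x2 + 3 * X l - 2 * Y (3*l) - 2 * Y (3*l+1) - 2 * Y (3*l+2)"
      using eqs mid s0 by simp_all
    show ?thesis unfolding s0 using m z e2 by simp presburger
  next
    assume s0: "s0 = 2"
    then have "step Y (3 * l + 3 - s0) = Y (3*l) - Y (3*l+1)"
      by (simp add: step_def)
    then have m: "int m = Y (3*l) - Y (3*l+1)"
      and z: "int z = int x2 + 2 * X l - 2 * Y (3*l) - 2 * Y (3*l+1)"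
      and e2: "int e2 = int x2 + 3 * X l - 2 * Y (3*l) - 2 * Y (3*l+1) - 2 * Y (3*l+2)"
      using eqs mid s0 by simp_all
    show ?thesis unfolding s0 using m z e2 by simp presburger
  qed
  ultimately show ?thesis
    unfolding x sum_indices_def by simp
qed

text \<open>
  Here h is the upper entry of the q-binomial Phi, P1 and P2 are the vacancy numbers of node 2 at
  3 l + 1 and 3 l + 2, and a and C are the tails in block l, obtained by solving for them in terms
  of the vacancy numbers; the parity conditions on the summation indices say exactly that C is
  integral.
\<close>

context
  fixes l s0 e1 e2 x1 x2 z m :: nat and h P1 P2 a :: int and C :: "nat \<Rightarrow> int"
  assumes s0: "s0 = 1 \<or> s0 = 2"
    and idx: "(e1, e2, x1, x2, z, m) \<in> sum_indices (3 * l + s0) s0"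
  defines "h \<equiv> int ((z + (2 - s0) * e2 + (s0 - 1) * x2) div 2)"
  defines "P1 \<equiv> (if s0 = 1 then int z else h - int m)"
    and "P2 \<equiv> (if s0 = 1 then h - int m else int z)"
  defines "a \<equiv> 2 * (int x1 - int e1) + (int x2 - int e2)"
  defines "C \<equiv> (\<lambda>i. if i = 0 then (a + int x2 - P1) div 2 else if i = 1 then (a + P1 - P2) div 2
     else (a + P2 - int e2) div 2)"
begin

lemma h_double: "2 * h = int z + (2 - int s0) * int e2 + (int s0 - 1) * int x2"
proof -
  have "even (z + (2 - s0) * e2 + (s0 - 1) * x2)"
    using idx by (simp add: sum_indices_def)
  then have "2 * h = int (z + (2 - s0) * e2 + (s0 - 1) * x2)"
    unfolding h_def by (metis dvd_mult_div_cancel of_nat_mult of_nat_numeral)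
  then show ?thesis using s0 by auto
qed

lemma C_double:
  "2 * C 0 = a + int x2 - P1" "2 * C 1 = a + P1 - P2" "2 * C 2 = a + P2 - int e2"
proof -
  have ev: "even (m + ((3 - s0) * x2 + s0 * e2 + z) div 2)" "even ((3 - s0) * x2 + s0 * e2 + z)"
    using idx by (simp_all add: sum_indices_def)
  have "even (a + int x2 - P1) \<and> even (a + P1 - P2) \<and> even (a + P2 - int e2)"
    using s0
  proof
    assume [simp]: "s0 = 1"
    have "2 * h = int z + int e2" using h_double by simp
    then show ?thesis using ev unfolding a_def P1_def P2_def by simp presburger
  next
    assume [simp]: "s0 = 2"
    have "2 * h = int z + int x2" using h_double by simp
    then show ?thesis using ev unfolding a_def P1_def P2_def by simp presburger
  qed
  then show "2 * C 0 = a + int x2 - P1" "2 * C 1 = a + P1 - P2" "2 * C 2 = a + P2 - int e2"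
    by (simp_all add: C_def)
qed

text \<open>The six indices determine block l: the growth of the two vacancy numbers across it
  yields X l, and the successive vacancy numbers of node 2 then yield the three tails of that
  node.\<close>

lemma index_middle:
  assumes "(X, Y) \<in> deviations l s0 wt" "index_of l s0 (X, Y) = (e1, e2, x1, x2, z, m)"
  shows "X l = a" "i < 3 \<Longrightarrow> Y (3 * l + i) = C i" "vac2 X Y (3 * l + 3 - s0) = h - int m"
proof -
  have eqs: "vac1 X Y (Suc l) = int e1" "vac2 X Y (3 * Suc l) = int e2" "vac1 X Y l = int x1"
    "vac2 X Y (3 * l) = int x2" "vac2 X Y (3 * l + s0) = int z" "step Y (3 * l + 3 - s0) = int m"
    using assms(2)[unfolded index_of_eq_iff[OF assms(1) s0]] by blast+
  note mid = vac_middle[of X Y l]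
  \<comment> \<open>Twice the first relation plus the second eliminates the sum of the three tails
    of node 2 and leaves - X l.\<close>
  have "int e1 = int x1 + (Y (3*l) + Y (3*l+1) + Y (3*l+2) - 2 * X l)"
    using eqs mid(1) by simp
  moreover have "int e2 = int x2 + 3 * X l - 2 * (Y (3*l) + Y (3*l+1) + Y (3*l+2))"
    using eqs mid(2-4) by simp
  ultimately show X: "X l = a" unfolding a_def by simp
  \<comment> \<open>The claim h - m comes from the second difference at 3 l + 3 - s0: its neighbours
    have vacancy numbers \<open>z\<close> and \<open>e2\<close> if s0 = 1, and \<open>x2\<close> and
    \<open>z\<close> if s0 = 2.\<close>
  have P: "vac2 X Y (3*l+1) = P1 \<and> vac2 X Y (3*l+2) = P2 \<and> vac2 X Y (3 * l + 3 - s0) = h - int m"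
    using s0
  proof
    assume s: "s0 = 1"
    then have e: "3 * l + 3 - s0 = 3 * l + 2" by simp
    have "step Y (3 * l + 2) = Y (3*l+1) - Y (3*l+2)" by (simp add: step_def)
    moreover have "2 * h = int z + int e2" using h_double s by simp
    ultimately show ?thesis using eqs mid unfolding e P1_def P2_def s by simp
  next
    assume s: "s0 = 2"
    then have e: "3 * l + 3 - s0 = 3 * l + 1" by simp
    have "step Y (3 * l + 1) = Y (3*l) - Y (3*l+1)" by (simp add: step_def)
    moreover have "2 * h = int z + int x2" using h_double s by simp
    ultimately show ?thesis using eqs mid unfolding e P1_def P2_def s by simp
  qed
  then show "vac2 X Y (3 * l + 3 - s0) = h - int m" by blast
  have Y: "Y (3*l) = C 0 \<and> Y (3*l+1) = C 1 \<and> Y (3*l+2) = C 2"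
    using P eqs mid C_double X by linarith
  assume "i < 3"
  then have "i = 0 \<or> i = 1 \<or> i = 2" by auto
  then show "Y (3 * l + i) = C i" using Y by auto
qed

text \<open>The increments of the vacancy numbers of node 2 in block l are X - 2 Y, so four times
  the energy is a^2 plus the squared differences of the successive numbers \<open>x2\<close>,
  \<open>P1\<close>, \<open>P2\<close>, \<open>e2\<close>. The two differences adjoining the
  position of \<open>m\<close> are d + m and d - m, with d half the difference of its neighbours;
  this splits off m^2 / 2. Completing the square in \<open>z\<close> gives the coefficient 3/8 = 1/4
  + 1/8, and the leftover (e2 - x2)^2 / 12 together with a^2 / 4 is half the norm of the
  weight.\<close>

lemma floor_phi:
  assumes "X l = a" "\<And>i. i < 3 \<Longrightarrow> Y (3 * l + i) = C i"
  shows "\<lfloor>phi s0 (e1, e2, x1, x2, z, m)\<rfloor> = block_energy X Y l"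
proof -
  have Y: "2 * Y (3*l) - X l = int x2 - P1" "2 * Y (3*l+1) - X l = P1 - P2" "2 * Y (3*l+2) - X l = P2 - int e2"
    using assms(2)[of 0] assms(2)[of 1] assms(2)[of 2] C_double assms(1) by simp_all
  have "4 * block_energy X Y l = a\<^sup>2 + (int x2 - P1)\<^sup>2 + (P1 - P2)\<^sup>2 + (P2 - int e2)\<^sup>2"
    unfolding block_energy_squares Y using assms(1) by simp
  then have "4 * real_of_int (block_energy X Y l) = (of_int a)\<^sup>2 + (real x2 - of_int P1)\<^sup>2
      + (of_int P1 - of_int P2)\<^sup>2 + (of_int P2 - real e2)\<^sup>2"
    by (metis (mono_tags, lifting) of_int_add of_int_diff of_int_mult of_int_numeral of_int_of_nat_eq of_int_power)
  moreover have "real_of_int a = 2 * (real x1 - real e1) + (real x2 - real e2)"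
    unfolding a_def by simp
  moreover have h: "real_of_int h = (real z + (2 - real s0) * real e2 + (real s0 - 1) * real x2) / 2"
    using arg_cong[OF h_double, of real_of_int] by simp
  ultimately have "real_of_int (block_energy X Y l) = phi s0 (e1, e2, x1, x2, z, m)"
    using s0 unfolding P1_def P2_def phi_def prod.case Let_def
    by (elim disjE) (simp_all add: weight_form_def fund_weight_def power2_eq_square field_simps)
  then show ?thesis by (metis floor_of_int)
qed

lemma limit_term_split:
  fixes q :: "'a::field"
  assumes q: "q \<noteq> 0" "\<And>k. qpoch q k \<noteq> 0"
    and dev: "(X, Y) \<in> deviations l s0 wt" "index_of l s0 (X, Y) = (e1, e2, x1, x2, z, m)"
  shows "limit_term l s0 q (X, Y) =
     q powi \<lfloor>phi s0 (e1, e2, x1, x2, z, m)\<rfloor> * Phi s0 (e1, e2, x1, x2, z, m) q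
       / (qpoch q e1 * qpoch q x1 * (qpoch q e2 * qpoch q x2) * qpoch q z)
     * ((q powi energy (right_part (Suc l) X) (right_part (3 * Suc l) Y)
         * (qfac_prod q (\<lambda>i. int e1 + vac1 (right_part (Suc l) X) (right_part (3 * Suc l) Y) i) (right_part (Suc l) X)
          * qfac_prod q (\<lambda>i. int e2 + vac2 (right_part (Suc l) X) (right_part (3 * Suc l) Y) i) (right_part (3 * Suc l) Y)))
      * (q powi energy (left_part l X) (left_part (3 * l) Y)
         * (qfac_prod q (\<lambda>i. int x1 + vac1 (left_part l X) (left_part (3 * l) Y) i) (left_part l X)
          * qfac_prod q (\<lambda>i. int x2 + vac2 (left_part l X) (left_part (3 * l) Y) i) (left_part (3 * l) Y))))"
proof -
  have eqs: "vac1 X Y (Suc l) = int e1" "vac2 X Y (3 * Suc l) = int e2" "vac1 X Y l = int x1"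
    "vac2 X Y (3 * l) = int x2" "vac2 X Y (3 * l + s0) = int z" "step Y (3 * l + 3 - s0) = int m"
    using dev(2)[unfolded index_of_eq_iff[OF dev(1) s0]] by blast+
  have eventually_zero: "eventually_zero X" "eventually_zero Y" and vac: "\<And>i. vac1 X Y i \<ge> 0" "\<And>i. vac2 X Y i \<ge> 0"
    using dev(1) by (auto simp: deviations_def)
  note mid = index_middle[OF dev]
  have long: "limit_prod q (long_bulk l) (vac1 X Y) X
      = qfac_prod q (\<lambda>i. int x1 + vac1 (left_part l X) (left_part (3 * l) Y) i) (left_part l X)
      * inverse (qpoch q x1) * inverse (qpoch q e1)
      * qfac_prod q (\<lambda>i. int e1 + vac1 (right_part (Suc l) X) (right_part (3 * Suc l) Y) i) (right_part (Suc l) X)"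
    using limit_prod_long_split[where p = "vac1 X Y", OF q(2) vac(1) vac_0(1) eventually_zero(1) deviations_origin(1)[OF dev(1)],
        of l "\<lambda>i. int x1 + vac1 (left_part l X) (left_part (3 * l) Y) i"
        "\<lambda>i. int e1 + vac1 (right_part (Suc l) X) (right_part (3 * Suc l) Y) i"]
      vac1_left_part[of _ l X Y] vac1_right_part[of X Y "Suc l"] eqs by (simp del: mult_Suc_right)
  have short: "limit_prod q (short_bulk l s0) (vac2 X Y) Y
      = qfac_prod q (\<lambda>i. int x2 + vac2 (left_part l X) (left_part (3 * l) Y) i) (left_part (3 * l) Y)
      * inverse (qpoch q x2) * inverse (qpoch q z) * qfac q (h - int m) (int m) * inverse (qpoch q e2)
      * qfac_prod q (\<lambda>i. int e2 + vac2 (right_part (Suc l) X) (right_part (3 * Suc l) Y) i) (right_part (3 * Suc l) Y)"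
    using limit_prod_short_split[where p = "vac2 X Y", OF q(2) vac(2) vac_0(2) eventually_zero(2) deviations_origin(2)[OF dev(1)] s0,
        of l "\<lambda>i. int x2 + vac2 (left_part l X) (left_part (3 * l) Y) i"
        "\<lambda>i. int e2 + vac2 (right_part (Suc l) X) (right_part (3 * Suc l) Y) i"]
      vac2_left_part[of _ l X Y] vac2_right_part[of X Y "Suc l"] eqs mid(3) by (simp del: mult_Suc_right)
  have Phi: "qfac q (h - int m) (int m) = Phi s0 (e1, e2, x1, x2, z, m) q"
    by (simp add: qfac_def Phi_def h_def)
  have fl: "\<lfloor>phi s0 (e1, e2, x1, x2, z, m)\<rfloor> = block_energy X Y l"
    using mid(1,2) by (rule floor_phi)
  have e: "q powi energy X Y = q powi energy (left_part l X) (left_part (3 * l) Y) * q powi block_energy X Y l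
      * q powi energy (right_part (Suc l) X) (right_part (3 * Suc l) Y)"
    unfolding energy_split[OF eventually_zero, of l] using q(1) by (simp add: power_int_add)
  show ?thesis
    unfolding limit_term_def prod.case long short Phi e fl
    by (simp only: divide_inverse inverse_mult_distrib mult.assoc mult.commute mult.left_commute)
qed


lemma level_0: "l \<noteq> 0 \<or> x1 = 0 \<and> x2 = 0"
  using idx by (cases "l = 0") (simp_all add: sum_indices_def)

lemma right_tails_in:
  assumes dev: "(X, Y) \<in> deviations l s0 wt" "index_of l s0 (X, Y) = (e1, e2, x1, x2, z, m)"
  shows "right_tails l (X, Y) \<in> tail_configs H_all (W_one e1 e2) wt"
proof -
  have eqs: "vac1 X Y (Suc l) = int e1" "vac2 X Y (3 * Suc l) = int e2"
    using dev(2)[unfolded index_of_eq_iff[OF dev(1) s0]] by blast+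
  have D: "eventually_zero X" "eventually_zero Y" "\<And>i. i \<notin> long_bulk l \<Longrightarrow> step X i \<ge> 0" "\<And>i. i \<notin> short_bulk l s0 \<Longrightarrow> step Y i \<ge> 0"
    "\<And>i. vac1 X Y i \<ge> 0" "\<And>i. vac2 X Y i \<ge> 0" "vac_limit X Y (fst wt) (snd wt)"
    using dev(1) by (auto simp: deviations_def)
  have "step (right_part (Suc l) X) i \<ge> 0" for i
    using D(3)[of "Suc l + i"] step_right_part[of i "Suc l" X] by (cases "i = 0") (auto simp: long_bulk_def)
  moreover have "step (right_part (3 * Suc l) Y) i \<ge> 0" for i
    using D(4)[of "3 * Suc l + i"] step_right_part[of i "3 * Suc l" Y] s0
    by (cases "i = 0") (auto simp: short_bulk_def)
  moreover have "int e1 + vac1 (right_part (Suc l) X) (right_part (3 * Suc l) Y) i \<ge> 0"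
    "int e2 + vac2 (right_part (Suc l) X) (right_part (3 * Suc l) Y) i \<ge> 0" for i
    using D(5)[of "Suc l + i"] D(6)[of "3 * Suc l + i"] unfolding vac1_right_part vac2_right_part eqs by simp_all
  moreover have "vac_limit (right_part (Suc l) X) (right_part (3 * Suc l) Y) (fst wt - real e1) (snd wt - real e2)"
    using D(7) unfolding vac_limit_right_part[of X Y _ _ "Suc l"] eqs by simp
  ultimately show ?thesis
    unfolding right_tails_def prod.case tail_configs_right using eventually_zero_parts(2) D(1,2) by blast
qed

text \<open>The entries at inner positions are entries of the deviation to the left of the bulk. The
  entry at the last position is minus the tail at the origin, whose sign is given by
  \<open>deviations_origin\<close>.\<close>

lemma left_tails_in:
  assumes dev: "(X, Y) \<in> deviations l s0 wt" "index_of l s0 (X, Y) = (e1, e2, x1, x2, z, m)"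
  shows "left_tails l (X, Y) \<in> tail_configs (H_level l) (W_one x1 x2) 0"
proof -
  have eqs: "vac1 X Y l = int x1" "vac2 X Y (3 * l) = int x2"
    using dev(2)[unfolded index_of_eq_iff[OF dev(1) s0]] by blast+
  have D: "\<And>i. i \<notin> long_bulk l \<Longrightarrow> step X i \<ge> 0" "\<And>i. i \<notin> short_bulk l s0 \<Longrightarrow> step Y i \<ge> 0"
    "\<And>i. vac1 X Y i \<ge> 0" "\<And>i. vac2 X Y i \<ge> 0"
    using dev(1) by (auto simp: deviations_def)
  note origin = deviations_origin[OF dev(1)]
  have nonneg: "step (left_part n Z) i \<ge> 0" if "\<And>i. i < n \<Longrightarrow> step Z i \<ge> 0" "Z 0 \<le> 0" for n Z i
  proof -
    consider "i = 0" | "0 < i" "i < n" | "i = n" | "i > n" by linarith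
    then show ?thesis
      using that step_left_part(1)[of i n Z] step_left_part(3)[of n i Z] step_left_part(2)[of n Z] by cases auto
  qed
  have "step (left_part l X) i \<ge> 0" for i
    by (rule nonneg) (use D(1) origin in \<open>auto simp: long_bulk_def\<close>)
  moreover have "step (left_part (3 * l) Y) i \<ge> 0" for i
    by (rule nonneg) (use D(2) origin in \<open>auto simp: short_bulk_def\<close>)
  moreover have v1: "int x1 + vac1 (left_part l X) (left_part (3 * l) Y) i = vac1 X Y (l - i)" if "i \<le> l" for i
    using vac1_left_part[OF that, of X Y] eqs by simp
  moreover have v2: "int x2 + vac2 (left_part l X) (left_part (3 * l) Y) i = vac2 X Y (3 * l - i)" if "i \<le> 3 * l" for i
    using vac2_left_part[OF that, of X Y] eqs by simp
  ultimately show ?thesis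
    unfolding left_tails_def prod.case tail_configs_left[OF level_0] using D(3,4)
    by (simp add: vac_0 left_part_def)
qed

lemma glue_tails_parts:
  assumes "(LX, LY) \<in> tail_configs (H_level l) (W_one x1 x2) 0"
  shows "left_tails l (glue_tails l a C ((RX, RY), (LX, LY))) = (LX, LY)"
    "right_tails l (glue_tails l a C ((RX, RY), (LX, LY))) = (RX, RY)"
proof -
  have "\<And>k. k \<ge> l \<Longrightarrow> LX k = 0" "\<And>k. k \<ge> 3 * l \<Longrightarrow> LY k = 0"
    using assms unfolding tail_configs_left[OF level_0] by blast+
  then show "left_tails l (glue_tails l a C ((RX, RY), (LX, LY))) = (LX, LY)"
    by (simp add: left_part_glue left_tails_def glue_tails_def)
  show "right_tails l (glue_tails l a C ((RX, RY), (LX, LY))) = (RX, RY)"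
    using right_part_glue[of l 1 LX "\<lambda>_. a" RX] right_part_glue[of "3 * l" 3 LY C RY] by (simp add: right_tails_def glue_tails_def add.commute)
qed

text \<open>Most vacancy numbers are inherited from the two parts or are among the indices. The
  exception is h - m at the position of \<open>m\<close>, and \<open>int m \<le> h\<close> is its
  non-negativity.\<close>

lemma glue_tails_in:
  assumes L: "(LX, LY) \<in> tail_configs (H_level l) (W_one x1 x2) 0"
    and R: "(RX, RY) \<in> tail_configs H_all (W_one e1 e2) wt"
    and le: "int m \<le> h"
  shows "glue_tails l a C ((RX, RY), (LX, LY)) \<in> deviations l s0 wt"
    and "index_of l s0 (glue_tails l a C ((RX, RY), (LX, LY))) = (e1, e2, x1, x2, z, m)"
proof -
  define X Y where "X = glue l 1 LX (\<lambda>_. a) RX" and "Y = glue (3 * l) 3 LY C RY"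
  have parts: "left_part l X = LX" "left_part (3 * l) Y = LY" "right_part (Suc l) X = RX" "right_part (3 * Suc l) Y = RY"
    using glue_tails_parts[OF L, of RX RY]
    by (simp_all add: left_tails_def right_tails_def glue_tails_def X_def Y_def)
  note Lc = L[unfolded tail_configs_left[OF level_0]] and Rc = R[unfolded tail_configs_right]
  have Lv: "\<And>i. i \<le> l \<Longrightarrow> int x1 + vac1 LX LY i \<ge> 0" "\<And>i. i \<le> 3 * l \<Longrightarrow> int x2 + vac2 LX LY i \<ge> 0"
    "int x1 + vac1 LX LY l = 0" "int x2 + vac2 LX LY (3 * l) = 0"
    and Ls: "\<And>i. step LX i \<ge> 0" "\<And>i. step LY i \<ge> 0"
    using Lc by blast+
  have Rv: "\<And>i. int e1 + vac1 RX RY i \<ge> 0" "\<And>i. int e2 + vac2 RX RY i \<ge> 0"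
    "vac_limit RX RY (fst wt - real e1) (snd wt - real e2)"
    and Rs: "\<And>i. step RX i \<ge> 0" "\<And>i. step RY i \<ge> 0" "eventually_zero RX" "eventually_zero RY"
    using Rc by blast+
  have eventually_zero: "eventually_zero X" "eventually_zero Y" unfolding X_def Y_def by (intro eventually_zero_glue Rs)+
  have mX: "X l = a" using glue_middle[of 0 1 l LX "\<lambda>_. a" RX] by (simp add: X_def)
  have mY: "Y (3 * l) = C 0" "Y (3 * l + 1) = C 1" "Y (3 * l + 2) = C 2"
    using glue_middle[of 0 3 "3 * l" LY C RY] glue_middle[of 1 3 "3 * l" LY C RY]
      glue_middle[of 2 3 "3 * l" LY C RY] by (simp_all add: Y_def)
  have vl1: "vac1 X Y l = int x1"
    using vac1_left_part[of l l X Y] Lv(3) by (simp add: parts vac_0)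
  have vl2: "vac2 X Y (3 * l) = int x2"
    using vac2_left_part[of "3 * l" l X Y] Lv(4) by (simp add: parts vac_0)
  note mid = vac_middle[of X Y l, unfolded mX mY vl1 vl2]
  have vm1: "vac1 X Y (Suc l) = int e1"
    using mid(1) C_double unfolding a_def by simp
  have p1: "vac2 X Y (3 * l + 1) = P1" using mid(2) C_double by simp
  have p2: "vac2 X Y (3 * l + 2) = P2" using mid(3) C_double p1 by simp
  have vm2: "vac2 X Y (3 * Suc l) = int e2" using mid(4) C_double p2 by simp
  have P: "P1 \<ge> 0" "P2 \<ge> 0" using le by (auto simp: P1_def P2_def)
  have z: "vac2 X Y (3 * l + s0) = int z"
    using s0 p1 p2 by (elim disjE) (auto simp: P1_def P2_def)
  have step_mid: "step Y (3 * l + 3 - s0) = int m"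
    using s0
  proof
    assume s: "s0 = 1"
    then have e: "3 * l + 3 - s0 = 3 * l + 2" by simp
    have "step Y (3 * l + 2) = C 1 - C 2" using mY by (simp add: step_def)
    moreover have "2 * h = int z + int e2" using h_double s by simp
    ultimately show ?thesis using C_double unfolding e P1_def P2_def s by simp
  next
    assume s: "s0 = 2"
    then have e: "3 * l + 3 - s0 = 3 * l + 1" by simp
    have "step Y (3 * l + 1) = C 0 - C 1" using mY by (simp add: step_def)
    moreover have "2 * h = int z + int x2" using h_double s by simp
    ultimately show ?thesis using C_double unfolding e P1_def P2_def s by simp
  qed
  have v1: "vac1 X Y i \<ge> 0" for i
  proof (cases "i \<le> l")
    case True
    then show ?thesis using vac1_left_part[of "l - i" l X Y] Lv(1)[of "l - i"] vl1 by (simp add: parts)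
  next
    case False
    then show ?thesis
      using vac1_right_part[of X Y "Suc l" "i - Suc l"] Rv(1)[of "i - Suc l"] vm1 by (simp add: parts del: mult_Suc_right)
  qed
  have v2: "vac2 X Y i \<ge> 0" for i
  proof -
    consider "i \<le> 3 * l" | "i = 3 * l + 1" | "i = 3 * l + 2" | "i \<ge> 3 * Suc l" by fastforce
    then show ?thesis
    proof cases
      case 1
      then show ?thesis using vac2_left_part[of "3 * l - i" l X Y] Lv(2)[of "3 * l - i"] vl2 by (simp add: parts)
    next
      case 4
      then show ?thesis
        using vac2_right_part[of X Y "Suc l" "i - 3 * Suc l"] Rv(2)[of "i - 3 * Suc l"] vm2
        by (simp add: parts del: mult_Suc_right)
    qed (use p1 p2 P in simp_all)
  qed
  have s1: "step X i \<ge> 0" if "i \<notin> long_bulk l" for i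
  proof (cases "i < l")
    case True
    then show ?thesis
      using Ls(1)[of "l - i"] step_left_part(1)[of "l - i" l X] parts by (cases "i = 0") auto
  next
    case False
    then have "i - Suc l > 0" "Suc l + (i - Suc l) = i" using that by (auto simp: long_bulk_def)
    then show ?thesis
      using Rs(1)[of "i - Suc l"] step_right_part[of "i - Suc l" "Suc l" X] parts by simp
  qed
  have s2: "step Y i \<ge> 0" if "i \<notin> short_bulk l s0" for i
  proof -
    have "i \<noteq> 3 * l" "i \<noteq> 3 * l + s0" "i \<noteq> 3 * l + 3"
      using that by (auto simp: short_bulk_def)
    then have "i < 3 * l \<or> i = 3 * l + 3 - s0 \<or> i > 3 * Suc l"
      using s0 by presburger
    then consider "i < 3 * l" | "i = 3 * l + 3 - s0" | "i > 3 * Suc l" by blast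
    then show ?thesis
    proof cases
      case 1
      then show ?thesis
        using Ls(2)[of "3 * l - i"] step_left_part(1)[of "3 * l - i" "3 * l" Y] parts by (cases "i = 0") auto
    next
      case 3
      then have "i - 3 * Suc l > 0" "3 * Suc l + (i - 3 * Suc l) = i" by auto
      then show ?thesis
        using Rs(2)[of "i - 3 * Suc l"] step_right_part[of "i - 3 * Suc l" "3 * Suc l" Y] parts by simp
    qed (simp add: step_mid)
  qed
  have "vac_limit X Y (fst wt) (snd wt)"
    unfolding vac_limit_right_part[of X Y _ _ "Suc l"] parts vm1 vm2 using Rv(3) by simp
  then have dev: "(X, Y) \<in> deviations l s0 wt"
    using eventually_zero s1 s2 v1 v2 by (simp add: deviations_def)
  then show "glue_tails l a C ((RX, RY), (LX, LY)) \<in> deviations l s0 wt"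
    by (simp add: glue_tails_def X_def Y_def)
  have "index_of l s0 (X, Y) = (e1, e2, x1, x2, z, m)"
    unfolding index_of_eq_iff[OF dev s0] using vl1 vl2 vm1 vm2 z step_mid by blast
  then show "index_of l s0 (glue_tails l a C ((RX, RY), (LX, LY))) = (e1, e2, x1, x2, z, m)"
    by (simp add: glue_tails_def X_def Y_def)
qed

lemma glue_tails_inverse:
  assumes "(X, Y) \<in> deviations l s0 wt" "index_of l s0 (X, Y) = (e1, e2, x1, x2, z, m)"
  shows "glue_tails l a C (right_tails l (X, Y), left_tails l (X, Y)) = (X, Y)"
proof -
  have "glue l 1 (left_part l X) (\<lambda>_. a) (right_part (l + 1) X) = X"
    using index_middle(1)[OF assms] by (intro glue_parts) auto
  moreover have "glue (3 * l) 3 (left_part (3 * l) Y) C (right_part (3 * l + 3) Y) = Y"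
    using index_middle(2)[OF assms] by (intro glue_parts) auto
  ultimately show ?thesis by (simp add: left_tails_def right_tails_def glue_tails_def add.commute)
qed

text \<open>Cutting and gluing are inverse bijections between the deviations with the given index
  and the pairs of outer configurations, and under them the limit term factorises.\<close>

lemma summand_eq_sum_limit_term:
  fixes q :: "'a::field"
  assumes q: "q \<noteq> 0" "\<And>k. qpoch q k \<noteq> 0"
  shows "summand (3 * l + s0) s0 wt (e1, e2, x1, x2, z, m) q =
    (\<Sum>w | w \<in> deviations l s0 wt \<and> index_of l s0 w = (e1, e2, x1, x2, z, m). limit_term l s0 q w)"
proof -
  define D where "D = {w. w \<in> deviations l s0 wt \<and> index_of l s0 w = (e1, e2, x1, x2, z, m)}"
  define TR where "TR = tail_configs H_all (W_one e1 e2) wt"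
  define TL where "TL = tail_configs (H_level l) (W_one x1 x2) 0"
  define fR where "fR = (\<lambda>(X, Y). q powi energy X Y
     * (qfac_prod q (\<lambda>i. int e1 + vac1 X Y i) X * qfac_prod q (\<lambda>i. int e2 + vac2 X Y i) Y))"
  define fL where "fL = (\<lambda>(X, Y). q powi energy X Y
     * (qfac_prod q (\<lambda>i. int x1 + vac1 X Y i) X * qfac_prod q (\<lambda>i. int x2 + vac2 X Y i) Y))"
  define K where "K = q powi \<lfloor>phi s0 (e1, e2, x1, x2, z, m)\<rfloor> * Phi s0 (e1, e2, x1, x2, z, m) q
       / (qpoch q e1 * qpoch q x1 * (qpoch q e2 * qpoch q x2) * qpoch q z)"
  have "summand (3 * l + s0) s0 wt (e1, e2, x1, x2, z, m) q
     = K * (M_ferm (W_one e1 e2) wt (inverse q) * M_level l (W_one x1 x2) (inverse q))"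
    by (simp add: summand_def K_def)
  also have "M_ferm (W_one e1 e2) wt (inverse q) = sum fR TR"
    unfolding fR_def TR_def by (rule M_ferm_W_one_inverse[OF q(1)])
  also have "M_level l (W_one x1 x2) (inverse q) = sum fL TL"
    unfolding fL_def TL_def by (rule M_level_W_one_inverse[OF q(1) level_0])
  also have "sum fR TR * sum fL TL = (\<Sum>(r, t)\<in>TR \<times> TL. fR r * fL t)"
    by (simp add: sum_product sum.cartesian_product)
  also have "K * \<dots> = (\<Sum>(r, t)\<in>TR \<times> TL. K * (fR r * fL t))"
    by (simp add: sum_distrib_left case_prod_unfold)
  also have "\<dots> = (\<Sum>w\<in>D. limit_term l s0 q w)"
  \<comment> \<open>If m > h, both sides are 0: the q-binomial Phi vanishes, and no deviation has
    this index because its vacancy number h - m would be negative.\<close>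
  proof (cases "int m \<le> h")
    case False
    then have "Phi s0 (e1, e2, x1, x2, z, m) q = 0"
      by (simp add: Phi_def qbinom_def h_def Let_def)
    then have "K = 0" by (simp add: K_def)
    moreover have "D = {}"
    proof (rule ccontr)
      assume "D \<noteq> {}"
      then obtain X Y where XY: "(X, Y) \<in> deviations l s0 wt" "index_of l s0 (X, Y) = (e1, e2, x1, x2, z, m)"
        unfolding D_def by (metis (mono_tags, lifting) Collect_empty_eq surj_pair)
      have "vac2 X Y (3 * l + 3 - s0) \<ge> 0"
        using XY(1) by (simp add: deviations_def)
      then have "h - int m \<ge> 0"
        using index_middle(3)[OF XY] by simp
      then show False using False by simp
    qed
    ultimately show ?thesis by simp
  next
    case True
    show ?thesis
    proof (rule sum.reindex_bij_witness[symmetric, where i = "glue_tails l a C" and j = "\<lambda>w. (right_tails l w, left_tails l w)"])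
      fix w assume "w \<in> D"
      then obtain X Y where w: "w = (X, Y)" and XY: "(X, Y) \<in> deviations l s0 wt"
        "index_of l s0 (X, Y) = (e1, e2, x1, x2, z, m)"
        unfolding D_def by (cases w) auto
      show "glue_tails l a C (right_tails l w, left_tails l w) = w"
        unfolding w by (rule glue_tails_inverse[OF XY])
      show "(right_tails l w, left_tails l w) \<in> TR \<times> TL"
        unfolding w TR_def TL_def using right_tails_in[OF XY] left_tails_in[OF XY] by blast
      show "(case (right_tails l w, left_tails l w) of (r, t) \<Rightarrow> K * (fR r * fL t)) = limit_term l s0 q w"
        unfolding w limit_term_split[OF q XY] K_def fR_def fL_def left_tails_def right_tails_def prod.case ..
    next
      fix p assume "p \<in> TR \<times> TL"
      then obtain RX RY LX LY where p: "p = ((RX, RY), (LX, LY))"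
        and R: "(RX, RY) \<in> tail_configs H_all (W_one e1 e2) wt"
        and L: "(LX, LY) \<in> tail_configs (H_level l) (W_one x1 x2) 0"
        unfolding TR_def TL_def by (cases p) auto
      show "(right_tails l (glue_tails l a C p), left_tails l (glue_tails l a C p)) = p"
        unfolding p glue_tails_parts[OF L] ..
      show "glue_tails l a C p \<in> D"
        unfolding p D_def using glue_tails_in[OF L R True] by blast
    qed
  qed
  finally show ?thesis unfolding D_def .
qed

text \<open>No bound on the energy is assumed. The fibre is finite since gluing covers it by pairs
  from two finite sets of configurations; the final regrouping needs this to restrict a fibre to
  bounded energy.\<close>

lemma finite_index_fibre:
  "finite {w. w \<in> deviations l s0 wt \<and> index_of l s0 w = (e1, e2, x1, x2, z, m)}"
proof (rule finite_subset)
  have "H_level l \<subseteq> H_all" by (auto simp: H_level_def H_all_def)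
  then show "finite (glue_tails l a C ` (tail_configs H_all (W_one e1 e2) wt \<times> tail_configs (H_level l) (W_one x1 x2) 0))"
    by (intro finite_imageI finite_cartesian_product finite_tail_configs) auto
  show "{w. w \<in> deviations l s0 wt \<and> index_of l s0 w = (e1, e2, x1, x2, z, m)}
     \<subseteq> glue_tails l a C ` (tail_configs H_all (W_one e1 e2) wt \<times> tail_configs (H_level l) (W_one x1 x2) 0)"
  proof clarify
    fix X Y assume XY: "(X, Y) \<in> deviations l s0 wt" "index_of l s0 (X, Y) = (e1, e2, x1, x2, z, m)"
    show "(X, Y) \<in> glue_tails l a C ` (tail_configs H_all (W_one e1 e2) wt \<times> tail_configs (H_level l) (W_one x1 x2) 0)"
      using glue_tails_inverse[OF XY] right_tails_in[OF XY] left_tails_in[OF XY]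
      by (intro image_eqI[of _ _ "(right_tails l (X, Y), left_tails l (X, Y))"]) auto
  qed
qed

end

section \<open>Comparison of coefficients\<close>

lemma fls_nth_limit_term_small:
  assumes "(X, Y) \<in> deviations l s0 wt" "n < energy X Y"
  shows "fls_nth (limit_term l s0 (fls_X :: 'a::field fls) (X, Y)) n = 0"
proof -
  have D: "eventually_zero X" "eventually_zero Y" "\<And>i. i \<notin> long_bulk l \<Longrightarrow> step X i \<ge> 0" "\<And>i. i \<notin> short_bulk l s0 \<Longrightarrow> step Y i \<ge> 0"
    "\<And>i. vac1 X Y i \<ge> 0" "\<And>i. vac2 X Y i \<ge> 0"
    using assms(1) by (auto simp: deviations_def)
  have agree: "fls_agree 0 (limit_prod fls_X B p Z) (limit_prod fls_X B p Z :: 'a fls)"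
    if "\<And>i. i \<notin> B \<Longrightarrow> step Z i \<ge> 0" "\<And>i. p i \<ge> 0" for B p Z
    unfolding limit_prod_def Prod_any.expand_set limit_factor_def
    by (intro fls_agree_prod) (auto intro!: fls_agree_qpoch(2) fls_agree_qfac that)
  show ?thesis
    unfolding limit_term_def prod.case
    by (rule fls_nth_X_powi_mult_small[OF fls_agree_mult[OF agree agree] assms(2)]) (use D in auto)
qed

theorem theorem5p6:
  fixes s s0 :: nat and wt :: "real \<times> real"
  assumes "wt \<in> weight_lattice"
    and "s > 0"
    and "(s mod 3 = 1 \<and> s0 = 1) \<or> (s mod 3 = 2 \<and> s0 = 2)"
  shows "\<exists>F :: rat fps.
    coeffwise_limit
      (\<lambda>k. fls_X powi (- \<lfloor>cform H_all (W_short s (2 * k)) (m_min s (2 * k))\<rfloor>)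
             * M_ferm (W_short s (2 * k)) wt fls_X)
      (fps_to_fls F) \<and>
    coeffwise_sum (\<lambda>x. summand s s0 wt x fls_X) (sum_indices s s0) (fps_to_fls F)"
proof -
  define l where "l = s div 3"
  have s0: "s0 = 1 \<or> s0 = 2" using assms(3) by blast
  have s: "s = 3 * l + s0" unfolding l_def using assms(3) by (metis mult_div_mod_eq)
  define D where "D c = {(X, Y) \<in> deviations l s0 wt. energy X Y \<le> int c}" for c
  define T :: "(nat \<Rightarrow> int) \<times> (nat \<Rightarrow> int) \<Rightarrow> int \<Rightarrow> rat" where
    "T w = fls_nth (limit_term l s0 fls_X w)" for w
  \<comment> \<open>The term of a deviation starts at the power of q given by its energy, so the
    coefficient of q^c involves only the finite set D c.\<close>
  define F where "F = Abs_fps (\<lambda>c. \<Sum>w\<in>D c. T w (int c))"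
  have finite_D: "finite (D c)" for c
    unfolding D_def using s0 by (intro finite_deviations_energy) auto
  \<comment> \<open>The case n < 0 is listed separately because \<open>nat n\<close> is then 0, and
    D 0 may contain deviations of energy 0.\<close>
  have T_0: "T w n = 0" if "w \<in> deviations l s0 wt" "w \<notin> D (nat n) \<or> n < 0" for w n
  proof -
    obtain X Y where w: "w = (X, Y)" by (cases w)
    have "energy X Y \<ge> 0"
      using that(1) w by (intro energy_nonneg) (auto simp: deviations_def)
    then have "n < energy X Y"
      using that w by (auto simp: D_def split: if_splits)
    then show ?thesis
      unfolding T_def w using that(1) w by (intro fls_nth_limit_term_small) auto
  qed
  have F_nth: "fls_nth (fps_to_fls F) n = (\<Sum>w\<in>D (nat n). T w n)" for n
  proof (cases "n < 0")
    case True
    then have "(\<Sum>w\<in>D (nat n). T w n) = 0"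
      by (intro sum.neutral) (auto simp: D_def intro!: T_0)
    then show ?thesis using True by simp
  qed (simp add: F_def)
  have "coeffwise_limit
      (\<lambda>k. fls_X powi (- \<lfloor>cform H_all (W_short s (2 * k)) (m_min s (2 * k))\<rfloor>)
             * M_ferm (W_short s (2 * k)) wt fls_X) (fps_to_fls F)"
    unfolding coeffwise_limit_def
  proof
    fix n :: int
    show "\<forall>\<^sub>F k in sequentially. fls_nth (fls_X powi (- \<lfloor>cform H_all (W_short s (2 * k)) (m_min s (2 * k))\<rfloor>)
             * M_ferm (W_short s (2 * k)) wt fls_X) n = fls_nth (fps_to_fls F) n"
    proof (cases "n < 0")
      case True
      show ?thesis
        unfolding s by (intro always_eventually allI, subst normalised_M_ferm_neg[OF s0 True]) (simp add: True)
    next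
      case False
      then have "int (nat n) = n" by simp
      then show ?thesis
        using eventually_normalised_M_ferm_nth[OF s0, where c = "nat n" and l = l and wt = wt and 'a = rat]
        unfolding s F_nth D_def T_def by metis
    qed
  qed
  moreover have "coeffwise_sum (\<lambda>x. summand s s0 wt x fls_X) (sum_indices s s0) (fps_to_fls F)"
    unfolding coeffwise_sum_def
  proof
    fix n :: int
    define c where "c x = fls_nth (summand s s0 wt x fls_X :: rat fls) n" for x
    have c_eq: "c x = (\<Sum>w | w \<in> D (nat n) \<and> index_of l s0 w = x. T w n)" if x: "x \<in> sum_indices s s0" for x
    proof -
      obtain e1 e2 x1 x2 z m where x': "x = (e1, e2, x1, x2, z, m)" by (rule prod_cases6)
      note idx = x[unfolded x' s]
      have "c x = (\<Sum>w | w \<in> deviations l s0 wt \<and> index_of l s0 w = x. T w n)"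
        unfolding c_def T_def unfolding x' s
        by (subst summand_eq_sum_limit_term[OF s0 idx fls_X_nonzero fls_agree_qpoch(3)]) (rule fls_nth_sum)
      also have "\<dots> = (\<Sum>w | w \<in> D (nat n) \<and> index_of l s0 w = x. T w n)"
        by (rule sum.mono_neutral_right)
          (use finite_index_fibre[OF s0 idx] x' in \<open>auto simp: D_def intro!: T_0\<close>)
      finally show ?thesis .
    qed
    have sub: "index_of l s0 ` D (nat n) \<subseteq> sum_indices s s0"
    proof (rule image_subsetI)
      fix w assume "w \<in> D (nat n)"
      then show "index_of l s0 w \<in> sum_indices s s0"
        unfolding s by (cases w) (auto simp only: D_def mem_Collect_eq prod.case intro!: index_of_in_sum_indices[OF _ s0])
    qed
    have supp: "{x \<in> sum_indices s s0. c x \<noteq> 0} \<subseteq> index_of l s0 ` D (nat n)"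
    proof
      fix x assume "x \<in> {x \<in> sum_indices s s0. c x \<noteq> 0}"
      then have "x \<in> sum_indices s s0" "c x \<noteq> 0" by blast+
      then have "(\<Sum>w | w \<in> D (nat n) \<and> index_of l s0 w = x. T w n) \<noteq> 0"
        using c_eq[of x] by simp
      then obtain w where "w \<in> D (nat n)" "index_of l s0 w = x"
        by (metis (mono_tags, lifting) mem_Collect_eq sum.neutral)
      then show "x \<in> index_of l s0 ` D (nat n)" by blast
    qed
    \<comment> \<open>The image of D may contain indices at which the contributions cancel; adding
      them changes nothing. Over the full image the double sum runs over the fibres of
      \<open>index_of\<close> and collapses to a sum over D.\<close>
    have "(\<Sum>x | x \<in> sum_indices s s0 \<and> c x \<noteq> 0. c x) = (\<Sum>x\<in>index_of l s0 ` D (nat n). c x)"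
      using sub supp finite_D by (intro sum.mono_neutral_left) auto
    also have "\<dots> = (\<Sum>x\<in>index_of l s0 ` D (nat n). \<Sum>w | w \<in> D (nat n) \<and> index_of l s0 w = x. T w n)"
      by (rule sum.cong[OF refl], rule c_eq, rule subsetD[OF sub])
    also have "\<dots> = (\<Sum>w\<in>D (nat n). T w n)"
      by (rule sum.image_gen[OF finite_D, symmetric])
    finally show "finite {x \<in> sum_indices s s0. fls_nth (summand s s0 wt x (fls_X :: rat fls)) n \<noteq> 0} \<and>
       (\<Sum>x | x \<in> sum_indices s s0 \<and> fls_nth (summand s s0 wt x (fls_X :: rat fls)) n \<noteq> 0.
          fls_nth (summand s s0 wt x (fls_X :: rat fls)) n) = fls_nth (fps_to_fls F) n"
      using finite_subset[OF supp finite_imageI[OF finite_D]] unfolding F_nth c_def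
      by (rule conjI[rotated])
  qed
  ultimately show ?thesis by blast
qed

end
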